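(* Let $L_2 f=0$ be an orbifold uniformizing differential equation on $\mathbb{P}^1$ (with coordinate $x$), let $x=\mathcal{R}(z)$ be a nonconstant rational function, and let $\mathcal{R}^*(L_2)$ be the pulled back second order Fuchsian equation on $\mathbb{P}^1$ (with coordinate $z$). Then the types of the regular singular points of $\mathcal{R}^*(L_2)$ are as follows. (1) The extra ramification points of $\mathcal{R}$ (the ramification points of $\mathcal{R}$ not lying over a regular singular point of $L_2$) are all apparent singularities. (2) The points in the inverse image under $\mathcal{R}$ of logarithmic singularities of orbifold type of $L_2$ (i.e. those with equal characteristic exponents) are logarithmic singularities of orbifold type of $\mathcal{R}^*(L_2)$. (3) For a regular singular point of $\mathcal{R}^*(L_2)$ in the inverse image of a finite order orbifold point of $L_2$ with characteristic exponent difference $1/b$: if the characteristic exponent difference is integral (i.e. if $b$ divides the ramification index of $\mathcal{R}$ at that point), then the regular singular point is apparent; if the characteristic exponent difference is not integral (i.e. if $b$ does not divide the ramification index), then the singular point is generic.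
   Context: Schwarzian derivative: $\{w;x\}=\dfrac{3(w'')^2-2w'w'''}{4(w')^2}$. Let $Y\subset\mathbb{P}^1$ be a finite set of points with weights $b_j\in\{2,3,\dots\}\cup\{\infty\}$, such that the orbifold $(\mathbb{P}^1,Y,\vec b)$ is uniformized by the upper half plane $\mathbb{H}$: there is a holomorphic covering map from $\mathbb{H}$ onto $\mathbb{P}^1\setminus\{Y_j: b_j=\infty\}$, ramified exactly over the $Y_j$ with $b_j<\infty$, with index $b_j$. Its multivalued inverse $w(x)$ is the developing map. The orbifold uniformizing differential equation of $(\mathbb{P}^1,Y,\vec b)$ is $\frac{d^2u}{dx^2}-\{w(x);x\}u=0$; $w$ is a ratio of two independent solutions. At a point $Y_j$ the difference of characteristic exponents is $1/b_j$ if $b_j<\infty$ ("finite order orbifold point") and $0$ if $b_j=\infty$ ("logarithmic singularity of orbifold type"). Pullback: if $L_2=\frac{d^2}{dx^2}+P_1(x)\frac{d}{dx}+P_2(x)$, then $\mathcal{R}^*(L_2)$ is the equation satisfied by the functions $f(\mathcal{R}(z))$ for $L_2f=0$, namely $$\frac{d^2f}{dz^2}+\Big(P_1(\mathcal{R}(z))\mathcal{R}'(z)-\frac{\mathcal{R}''(z)}{\mathcal{R}'(z)}\Big)\frac{df}{dz}+P_2(\mathcal{R}(z))\,\mathcal{R}'(z)^2 f=0 .$$ Types of a regular singular point of a second order Fuchsian equation: generic if the difference of characteristic exponents is not an integer; logarithmic if the local solutions involve a logarithm; apparent if the difference of characteristic exponents is a positive integer and no local solution involves a logarithm. A point at infinity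 is treated in the local coordinate given by the reciprocal. *)

theory Defs
  imports
    "HOL-Complex_Analysis.Complex_Analysis"
    "HOL-Computational_Algebra.Polynomial"
    "HOL-Library.Extended_Nat"
begin

subsection \<open>The Riemann sphere and rational maps\<close>

datatype sphere = Fin complex | Infty

text \<open>
  \<open>param x\<close> and \<open>chart x\<close> describe the same centred coordinate \<open>t\<close> at \<open>x\<close> (\<open>t = z - a\<close>, or \<open>t = 1 / z\<close>
  at infinity), once as a map into the plane for \<open>t \<noteq> 0\<close> and once as a map into the sphere with
  \<open>chart x 0 = x\<close>. Conversely \<open>coord x\<close> is the coordinate as a function on the sphere; it is
  meaningful only near \<open>x\<close>.
\<close>

fun param :: "sphere \<Rightarrow> complex \<Rightarrow> complex" where
  "param (Fin a) t = a + t"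
| "param Infty t = 1 / t"

fun chart :: "sphere \<Rightarrow> complex \<Rightarrow> sphere" where
  "chart (Fin a) t = Fin (a + t)"
| "chart Infty t = (if t = 0 then Infty else Fin (1 / t))"

fun coord :: "sphere \<Rightarrow> sphere \<Rightarrow> complex" where
  "coord (Fin a) (Fin z) = z - a"
| "coord (Fin a) Infty = 0"
| "coord Infty (Fin z) = 1 / z"
| "coord Infty Infty = 0"

text \<open>For coprime \<open>A\<close>, \<open>B\<close> with \<open>B \<noteq> 0\<close> this is the self-map \<open>A / B\<close> of the sphere.\<close>

fun rat_map :: "complex poly \<Rightarrow> complex poly \<Rightarrow> sphere \<Rightarrow> sphere" where
  "rat_map A B (Fin z) = (if poly B z = 0 then Infty else Fin (poly A z / poly B z))"
| "rat_map A B Infty =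
     (if degree B < degree A then Infty else Fin (coeff A (degree B) / lead_coeff B))"

definition rational_map :: "(sphere \<Rightarrow> sphere) \<Rightarrow> bool" where
  "rational_map R \<longleftrightarrow> (\<exists>A B. coprime A B \<and> B \<noteq> 0 \<and> R = rat_map A B)"

definition affine_part :: "(sphere \<Rightarrow> sphere) \<Rightarrow> complex \<Rightarrow> complex" where
  "affine_part R z = (case R (Fin z) of Fin x \<Rightarrow> x | Infty \<Rightarrow> 0)"

definition ramification_index :: "(sphere \<Rightarrow> sphere) \<Rightarrow> sphere \<Rightarrow> nat" where
  "ramification_index R z = nat (zorder (\<lambda>t. coord (R z) (R (chart z t))) 0)"

definition ramification_point :: "(sphere \<Rightarrow> sphere) \<Rightarrow> sphere \<Rightarrow> bool" where
  "ramification_point R z \<longleftrightarrow> 1 < ramification_index R z"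


subsection \<open>Second order linear equations and their singular points\<close>

text \<open>
  The pair \<open>(p, q)\<close> stands for \<open>f'' + p f' + q f = 0\<close>. Only the values of \<open>p\<close> and \<open>q\<close> on punctured
  neighbourhoods of points matter below, so values at poles are irrelevant.
\<close>

type_synonym ode = "(complex \<Rightarrow> complex) \<times> (complex \<Rightarrow> complex)"

definition pullback :: "(complex \<Rightarrow> complex) \<Rightarrow> ode \<Rightarrow> ode" where
  "pullback g L =
     (\<lambda>z. fst L (g z) * deriv g z - deriv (deriv g) z / deriv g z,
      \<lambda>z. snd L (g z) * (deriv g z)\<^sup>2)"

definition sphere_pullback :: "(sphere \<Rightarrow> sphere) \<Rightarrow> ode \<Rightarrow> ode" where
  "sphere_pullback R L = pullback (affine_part R) L"

text \<open>The equation rewritten in the centred coordinate at \<open>x\<close>; the point becomes \<open>t = 0\<close>.\<close>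

definition local_eqn :: "ode \<Rightarrow> sphere \<Rightarrow> ode" where
  "local_eqn L x = pullback (param x) L"

definition extends_analytically :: "(complex \<Rightarrow> complex) \<Rightarrow> bool" where
  "extends_analytically f \<longleftrightarrow> (\<exists>g. g analytic_on {0} \<and> (\<forall>\<^sub>F t in at 0. f t = g t))"

definition singular_point :: "ode \<Rightarrow> sphere \<Rightarrow> bool" where
  "singular_point L x \<longleftrightarrow>
     \<not> (extends_analytically (fst (local_eqn L x)) \<and> extends_analytically (snd (local_eqn L x)))"

definition regular_singular_point :: "ode \<Rightarrow> sphere \<Rightarrow> bool" where
  "regular_singular_point L x \<longleftrightarrow> singular_point L x \<and>
     extends_analytically (\<lambda>t. t * fst (local_eqn L x) t) \<and>
     extends_analytically (\<lambda>t. t\<^sup>2 * snd (local_eqn L x) t)"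

definition fuchsian :: "ode \<Rightarrow> bool" where
  "fuchsian L \<longleftrightarrow> (\<forall>x. singular_point L x \<longrightarrow> regular_singular_point L x)"

text \<open>\<open>s (s - 1) + p\<^sub>0 s + q\<^sub>0\<close> as a polynomial in \<open>s\<close>; its roots are the characteristic exponents.\<close>

definition indicial_poly :: "ode \<Rightarrow> sphere \<Rightarrow> complex poly" where
  "indicial_poly L x =
     (let p0 = Lim (at 0) (\<lambda>t. t * fst (local_eqn L x) t);
          q0 = Lim (at 0) (\<lambda>t. t\<^sup>2 * snd (local_eqn L x) t)
      in [:q0, p0 - 1, 1:])"

text \<open>The exponents are not ordered, so the exponent difference \<open>d\<close> is determined up to sign.\<close>

definition exponent_difference :: "ode \<Rightarrow> sphere \<Rightarrow> complex \<Rightarrow> bool" where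
  "exponent_difference L x d \<longleftrightarrow>
     (\<exists>r s. indicial_poly L x = [:- r, 1:] * [:- s, 1:] \<and> d = r - s)"

definition integral_exponent_difference :: "ode \<Rightarrow> sphere \<Rightarrow> bool" where
  "integral_exponent_difference L x \<longleftrightarrow> (\<exists>d\<in>\<int>. exponent_difference L x d)"

text \<open>
  Local solutions are taken on a disc around \<open>t = 0\<close> slit along the negative real axis, where the
  principal branches of \<open>t powr \<alpha>\<close> and \<open>Ln t\<close> are available.
\<close>

definition local_solution :: "ode \<Rightarrow> sphere \<Rightarrow> (complex \<Rightarrow> complex) \<Rightarrow> bool" where
  "local_solution L x f \<longleftrightarrow> (\<exists>\<epsilon>>0. f holomorphic_on (ball 0 \<epsilon> - \<real>\<^sub>\<le>\<^sub>0) \<and>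
     (\<forall>t \<in> ball 0 \<epsilon> - \<real>\<^sub>\<le>\<^sub>0. deriv (deriv f) t
        + fst (local_eqn L x) t * deriv f t + snd (local_eqn L x) t * f t = 0))"

text \<open>
  By Frobenius, at a regular singular point with integral exponent difference every local solution
  has the form \<open>t powr \<alpha> * (k t + h t * Ln t)\<close> with \<open>h\<close>, \<open>k\<close> analytic at \<open>0\<close> (possible poles are absorbed
  in \<open>\<alpha>\<close>). Whether the logarithmic coefficient \<open>h\<close> vanishes does not depend on the representation.
\<close>

definition log_expansion ::
    "(complex \<Rightarrow> complex) \<Rightarrow> complex \<Rightarrow> (complex \<Rightarrow> complex) \<Rightarrow> (complex \<Rightarrow> complex) \<Rightarrow> bool" where
  "log_expansion f \<alpha> k h \<longleftrightarrow> k analytic_on {0} \<and> h analytic_on {0} \<and>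
     (\<forall>\<^sub>F t in at 0 within - \<real>\<^sub>\<le>\<^sub>0. f t = t powr \<alpha> * (k t + h t * Ln t))"

definition log_free :: "(complex \<Rightarrow> complex) \<Rightarrow> bool" where
  "log_free f \<longleftrightarrow> (\<exists>\<alpha> k. log_expansion f \<alpha> k (\<lambda>t. 0))"

definition involves_log :: "(complex \<Rightarrow> complex) \<Rightarrow> bool" where
  "involves_log f \<longleftrightarrow> (\<exists>\<alpha> k h. log_expansion f \<alpha> k h \<and> \<not> (\<forall>\<^sub>F t in at 0. h t = 0))"

definition generic_singularity :: "ode \<Rightarrow> sphere \<Rightarrow> bool" where
  "generic_singularity L x \<longleftrightarrow>
     regular_singular_point L x \<and> \<not> integral_exponent_difference L x"

definition logarithmic_singularity :: "ode \<Rightarrow> sphere \<Rightarrow> bool" where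
  "logarithmic_singularity L x \<longleftrightarrow>
     regular_singular_point L x \<and> (\<exists>f. local_solution L x f \<and> involves_log f)"

definition apparent_singularity :: "ode \<Rightarrow> sphere \<Rightarrow> bool" where
  "apparent_singularity L x \<longleftrightarrow> regular_singular_point L x \<and>
     (\<exists>n::nat. 0 < n \<and> exponent_difference L x (of_nat n)) \<and>
     (\<forall>f. local_solution L x f \<longrightarrow> log_free f)"

definition orbifold_logarithmic_singularity :: "ode \<Rightarrow> sphere \<Rightarrow> bool" where
  "orbifold_logarithmic_singularity L x \<longleftrightarrow>
     logarithmic_singularity L x \<and> exponent_difference L x 0"


subsection \<open>Orbifold uniformization\<close>

abbreviation upper_half_plane :: "complex set" where
  "upper_half_plane \<equiv> {z. 0 < Im z}"

definition orbifold_weight :: "sphere set \<Rightarrow> (sphere \<Rightarrow> enat) \<Rightarrow> sphere \<Rightarrow> enat" where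
  "orbifold_weight Y b y = (if y \<in> Y then b y else 1)"

text \<open>
  A covering of the sphere minus the points of infinite weight, branched exactly over the points of
  finite weight \<open>n \<ge> 2\<close> with index \<open>n\<close>: each \<open>y\<close> of finite weight \<open>n\<close> has a disc \<open>U\<close> around it whose
  preimage is a disjoint union of open sets \<open>V\<close>, each identified biholomorphically by some \<open>\<phi>\<close> with
  the unit disc in such a way that the covering becomes the \<open>n\<close>-th power map, up to the scaling by
  the radius \<open>r\<close> of \<open>U\<close>. These local models include holomorphy.
\<close>

definition orbifold_uniformization ::
    "sphere set \<Rightarrow> (sphere \<Rightarrow> enat) \<Rightarrow> (complex \<Rightarrow> sphere) \<Rightarrow> bool" where
  "orbifold_uniformization Y b \<pi> \<longleftrightarrow>
     \<pi> ` upper_half_plane = - {y \<in> Y. b y = \<infinity>} \<and>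
     (\<forall>y n. orbifold_weight Y b y = enat n \<longrightarrow>
       (\<exists>r>0. \<exists>\<V>. \<Union>\<V> = {\<tau> \<in> upper_half_plane. \<pi> \<tau> \<in> chart y ` ball 0 r} \<and> pairwise disjnt \<V> \<and>
          (\<forall>V\<in>\<V>. open V \<and>
             (\<exists>\<phi>. \<phi> holomorphic_on V \<and> bij_betw \<phi> V (ball 0 1) \<and>
                (\<forall>\<tau>\<in>V. \<pi> \<tau> = chart y (of_real r * \<phi> \<tau> ^ n))))))"

definition schwarzian :: "(complex \<Rightarrow> complex) \<Rightarrow> complex \<Rightarrow> complex" where
  "schwarzian w x =
     (3 * ((deriv ^^ 2) w x)\<^sup>2 - 2 * deriv w x * (deriv ^^ 3) w x) / (4 * (deriv w x)\<^sup>2)"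

text \<open>A holomorphic branch \<open>w\<close>, on the open set \<open>D\<close>, of the multivalued inverse of \<open>\<pi>\<close>.\<close>

definition developing_branch ::
    "(complex \<Rightarrow> sphere) \<Rightarrow> complex set \<Rightarrow> (complex \<Rightarrow> complex) \<Rightarrow> bool" where
  "developing_branch \<pi> D w \<longleftrightarrow> open D \<and> w holomorphic_on D \<and> w ` D \<subseteq> upper_half_plane \<and>
     (\<forall>x\<in>D. \<pi> (w x) = Fin x)"

text \<open>
  Branches exist near every finite point outside \<open>Y\<close>, and there they all have the same Schwarzian,
  since they differ by Moebius transformations.
\<close>

definition orbifold_uniformizing_eqn :: "sphere set \<Rightarrow> (sphere \<Rightarrow> enat) \<Rightarrow> ode \<Rightarrow> bool" where
  "orbifold_uniformizing_eqn Y b L \<longleftrightarrow>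
     (\<exists>\<pi>. orbifold_uniformization Y b \<pi> \<and> fst L = (\<lambda>x. 0) \<and>
        (\<forall>D w. developing_branch \<pi> D w \<longrightarrow> (\<forall>x\<in>D. snd L x = - schwarzian w x)))"

text \<open>
  If infinity is not in \<open>Y\<close>, the equation \<open>u'' = {w;x} u\<close> nevertheless has exponents \<open>-1\<close>, \<open>0\<close> there in
  the coordinate \<open>1 / x\<close> and is formally singular. The disjunction makes the ramification
  points over such a point count as extra ones too.
\<close>

definition extra_ramification_point ::
    "sphere set \<Rightarrow> ode \<Rightarrow> (sphere \<Rightarrow> sphere) \<Rightarrow> sphere \<Rightarrow> bool" where
  "extra_ramification_point Y L R z \<longleftrightarrow>
     ramification_point R z \<and> (\<not> regular_singular_point L (R z) \<or> R z \<notin> Y)"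

end

theory Submission
  imports Defs "HOL-Real_Asymp.Real_Asymp"
begin

text \<open>
  Near a point with coordinate \<open>t\<close> the pulled back equation has the solutions \<open>f\<close> and \<open>v f\<close>, where
  \<open>v = w \<circ> \<R>\<close> for a branch \<open>w\<close> of the developing map, \<open>f\<^sup>2 = g' / v'\<close> and \<open>g\<close> is the rational map in
  coordinates. Over a point of finite weight \<open>n\<close>, where the ramification index is \<open>e\<close>, the local models
  of the uniformization give \<open>v = \<psi> (t\<^sup>m h)\<close> with \<open>m = e / n\<close>; this is single valued if \<open>n\<close> divides \<open>e\<close>,
  and then no logarithm occurs. The exponents are read off the leading coefficient of the Schwarzian,
  which is computed at \<open>e = n\<close> and carried over to arbitrary \<open>e\<close>.

  Over a cusp nothing is prescribed. There the developing map lifts through \<open>exp\<close> to a map \<open>W\<close> from a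
  left half plane to the upper half plane. As \<open>W\<close> and \<open>W (s + 2\<pi>i)\<close> have the same Schwarzian, they
  differ by a Moebius transformation, which preserves the upper half plane because it permutes the
  fibres of the covering. It is not elliptic, for otherwise \<open>W\<close> would converge to a point of the upper
  half plane lying over the cusp. A bounded exponential of \<open>W\<close> descends to the punctured disc, where the
  singularity is removable; this excludes the hyperbolic case, and in the parabolic case it shows that
  a Moebius transform of \<open>W\<close> is \<open>s\<close> plus an analytic function of \<open>exp s\<close>, which is the logarithm.
\<close>

subsection \<open>The Schwarzian derivative and ratios of solutions\<close>

text \<open>The coefficient of L is given only through branches of the developing map; nothing is
  assumed about its growth at a point of \<open>Y\<close> or at infinity. Even regularity has to be
  extracted from t^2 ({g;t} - {v;t}), which is t^2 times the pulled back coefficient and extends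
  analytically once v' is t^j times a unit; its value at 0 is (e^2 - (j + 1)^2)/4.

  If n does not divide e, the lift v is multivalued, hence the detour through e = n: there v is
  unramified (j = 0), the limit of x^2 q(x) can be read off, and any other ramification multiplies
  this limit by e^2.

  At a cusp v contains a logarithm for every e, so identities are first proved on slit discs; the
  coefficient itself is single valued, which carries them to the punctured disc. The monodromy is
  found only as a complex Moebius transformation. That its coefficients are real up to a factor
  needs the inverse to preserve the half plane as well. A hyperbolic monodromy fails by growth: a
  logarithm of W would have bounded real part and yet equal s up to a bounded term.\<close>

lemma deriv_eq_on_open:
  assumes "open S" "x \<in> S" "\<And>x. x \<in> S \<Longrightarrow> f x = k x"
  shows "deriv f x = deriv k x"
  using assms by (intro deriv_cong_ev) (auto simp: eventually_nhds)

lemma schwarzian_cong: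
  assumes "open S" "z \<in> S" "\<And>x. x \<in> S \<Longrightarrow> f x = g x"
  shows "schwarzian f z = schwarzian g z"
proof -
  have ev: "\<forall>\<^sub>F x in nhds z. f x = g x"
    using assms eventually_nhds by blast
  then have "(deriv ^^ n) f z = (deriv ^^ n) g z" for n
    by (intro higher_deriv_cong_ev) auto
  from this[of 1] this[of 2] this[of 3] show ?thesis
    by (simp add: schwarzian_def)
qed

text \<open>The right side is f''/f for f = (v')^(-1/2). This is why the present normalisation, -1/2
  times the classical Schwarzian, is the coefficient in u'' = {v;x} u.\<close>

lemma schwarzian_alt:
  assumes "open S" "v holomorphic_on S" "z \<in> S" "deriv v z \<noteq> 0"
  shows "schwarzian v z = (deriv (deriv v) z / deriv v z)\<^sup>2 / 4
           - deriv (\<lambda>x. deriv (deriv v) x / deriv v x) z / 2"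
proof -
  have h: "deriv v holomorphic_on S" "deriv (deriv v) holomorphic_on S"
    using assms by (auto intro!: holomorphic_deriv)
  have "((\<lambda>x. deriv (deriv v) x / deriv v x) has_field_derivative
      (deriv (deriv (deriv v)) z * deriv v z - deriv (deriv v) z * deriv (deriv v) z)
        / (deriv v z * deriv v z)) (at z)"
    using assms h by (intro DERIV_divide holomorphic_derivI[of _ S]) auto
  then show ?thesis
    using assms(4)
    by (simp add: DERIV_imp_deriv schwarzian_def numeral_2_eq_2 numeral_3_eq_3 field_simps power2_eq_square)
qed

text \<open>Cocycle rule of weight two. It turns the pulled back coefficient
  \<open>- schwarzian w (g z) * (deriv g z)^2\<close> into {g;z} - {v;z} with v = w o g, the form in
  which the pullback is handled from here on.\<close>

lemma schwarzian_compose: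
  assumes "open S" "g holomorphic_on S" "z \<in> S" "deriv g z \<noteq> 0"
    and "open D" "w holomorphic_on D" "g ` S \<subseteq> D" "deriv w (g z) \<noteq> 0"
  shows "schwarzian (\<lambda>x. w (g x)) z = schwarzian w (g z) * (deriv g z)\<^sup>2 + schwarzian g z"
proof -
  have hg: "deriv g holomorphic_on S" "deriv (deriv g) holomorphic_on S"
    using assms by (auto intro!: holomorphic_deriv)
  have hw: "deriv w holomorphic_on D" "deriv (deriv w) holomorphic_on D"
    using assms by (auto intro!: holomorphic_deriv)
  have comp: "((\<lambda>x. f (g x)) has_field_derivative deriv f (g x) * deriv g x) (at x)"
    if "x \<in> S" "f holomorphic_on D" for f x
    using that assms by (intro DERIV_chain2 holomorphic_derivI[of _ D] holomorphic_derivI[of _ S]) auto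
  have dd: "(deriv f has_field_derivative deriv (deriv f) x) (at x)"
    if "x \<in> S" "f holomorphic_on S" for f x
    using that assms by (intro holomorphic_derivI[of _ S]) (auto intro!: holomorphic_deriv)
  note ev = deriv_eq_on_open[OF assms(1)]
  let ?v = "\<lambda>x. w (g x)"
  have v1: "deriv ?v x = deriv w (g x) * deriv g x" if "x \<in> S" for x
    using comp[OF that assms(6)] by (rule DERIV_imp_deriv)
  have v2: "deriv (deriv ?v) x = deriv (deriv w) (g x) * (deriv g x)\<^sup>2 + deriv w (g x) * deriv (deriv g) x"
    if x: "x \<in> S" for x
  proof -
    have "deriv (deriv ?v) x = deriv (\<lambda>x. deriv w (g x) * deriv g x) x"
      using ev[OF x v1] by simp
    also have "\<dots> = deriv (deriv w) (g x) * deriv g x * deriv g x + deriv (deriv g) x * deriv w (g x)"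
      by (rule DERIV_imp_deriv, rule DERIV_mult[OF comp[OF x hw(1)] dd[OF x assms(2)]])
    finally show ?thesis by (simp add: power2_eq_square)
  qed
  have v3: "deriv (deriv (deriv ?v)) z = deriv (deriv (deriv w)) (g z) * (deriv g z)^3
      + 3 * deriv (deriv w) (g z) * deriv g z * deriv (deriv g) z + deriv w (g z) * deriv (deriv (deriv g)) z"
  proof -
    have "deriv (deriv (deriv ?v)) z = deriv (\<lambda>x. deriv (deriv w) (g x) * (deriv g x)\<^sup>2 + deriv w (g x) * deriv (deriv g) x) z"
      using ev[OF assms(3) v2] by simp
    also have "\<dots> = (deriv (deriv (deriv w)) (g z) * deriv g z) * (deriv g z)\<^sup>2
        + (of_nat 2 * (deriv (deriv g) z * deriv g z ^ (2 - Suc 0))) * deriv (deriv w) (g z)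
        + ((deriv (deriv w) (g z) * deriv g z) * deriv (deriv g) z + deriv (deriv (deriv g)) z * deriv w (g z))"
      by (rule DERIV_imp_deriv, rule DERIV_add, rule DERIV_mult[OF comp[OF assms(3) hw(2)]],
          rule DERIV_power, rule dd[OF assms(3,2)],
          rule DERIV_mult[OF comp[OF assms(3) hw(1)] dd[OF assms(3) hg(1)]])
    finally show ?thesis by (simp add: power2_eq_square power3_eq_cube algebra_simps)
  qed
  show ?thesis
    using assms(4,8) v1[OF assms(3)] v2[OF assms(3)] v3
    by (simp add: schwarzian_def numeral_2_eq_2 numeral_3_eq_3 divide_simps)
       (simp add: algebra_simps power2_eq_square power3_eq_cube eval_nat_numeral)
qed

text \<open>\<open>(g' / v')\<^sup>1\<^sup>/\<^sup>2\<close> and \<open>v (g' / v')\<^sup>1\<^sup>/\<^sup>2\<close> solve the equation with ratio of solutions \<open>v\<close>.\<close>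

locale ratio_of_solutions =
  fixes D :: "complex set" and g v f1 :: "complex \<Rightarrow> complex"
  assumes D: "open D" and hol: "g holomorphic_on D" "v holomorphic_on D" "f1 holomorphic_on D"
    and nz: "\<And>z. z \<in> D \<Longrightarrow> deriv g z \<noteq> 0" "\<And>z. z \<in> D \<Longrightarrow> deriv v z \<noteq> 0"
    and sq: "\<And>z. z \<in> D \<Longrightarrow> (f1 z)\<^sup>2 * deriv v z = deriv g z"
begin

text \<open>The pullback by g of u'' = {w;x} u when v = w o g. Since w itself does not occur, no
  branch over the image of g has to be chosen.\<close>

definition solves :: "(complex \<Rightarrow> complex) \<Rightarrow> bool" where
  "solves f \<longleftrightarrow> (\<forall>z\<in>D. deriv (deriv f) z + - (deriv (deriv g) z / deriv g z) * deriv f z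
       + (schwarzian g z - schwarzian v z) * f z = 0)"

lemma f1_nz: "z \<in> D \<Longrightarrow> f1 z \<noteq> 0"
  using sq[of z] nz(1)[of z] by auto

lemma deriv_eqI:
  assumes "\<And>x. x \<in> D \<Longrightarrow> f x = k x" "z \<in> D"
  shows "deriv f z = deriv k z"
  using deriv_eq_on_open[OF D assms(2,1)] .

lemma D_derivI: "f holomorphic_on D \<Longrightarrow> z \<in> D \<Longrightarrow> (f has_field_derivative deriv f z) (at z)"
  using D by (rule_tac holomorphic_derivI[of _ D]) auto

lemma deriv_f1:
  assumes z: "z \<in> D"
  shows "deriv f1 z = f1 z * ((deriv (deriv g) z / deriv g z - deriv (deriv v) z / deriv v z) / 2)"
proof -
  have "deriv (deriv g) z = deriv (\<lambda>z. (f1 z)\<^sup>2 * deriv v z) z"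
    using deriv_eqI[OF _ z, of "\<lambda>z. (f1 z)\<^sup>2 * deriv v z" "deriv g"] sq by simp
  also have "\<dots> = of_nat 2 * (deriv f1 z * f1 z ^ (2 - Suc 0)) * deriv v z + deriv (deriv v) z * (f1 z)\<^sup>2"
    using D hol by (intro DERIV_imp_deriv DERIV_mult DERIV_power D_derivI z) (auto intro!: holomorphic_deriv)
  finally have "deriv (deriv g) z = 2 * deriv f1 z * f1 z * deriv v z + deriv (deriv v) z * (f1 z)\<^sup>2"
    by simp
  then show ?thesis
    using nz[OF z] f1_nz[OF z] unfolding sq[OF z, symmetric]
    by (simp add: field_simps power2_eq_square)
qed

lemma deriv2_f1:
  assumes z: "z \<in> D"
  shows "deriv (deriv f1) z = f1 z * (((deriv (deriv g) z / deriv g z - deriv (deriv v) z / deriv v z) / 2)\<^sup>2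
     + (deriv (\<lambda>z. deriv (deriv g) z / deriv g z) z - deriv (\<lambda>z. deriv (deriv v) z / deriv v z) z) / 2)"
proof -
  let ?a = "\<lambda>z. deriv (deriv g) z / deriv g z" and ?b = "\<lambda>z. deriv (deriv v) z / deriv v z"
  have h: "?a holomorphic_on D" "?b holomorphic_on D"
    using D hol nz by (auto intro!: holomorphic_intros)
  have "deriv (deriv f1) z = deriv (\<lambda>z. f1 z * ((?a z - ?b z) / 2)) z"
    using deriv_eqI[OF deriv_f1 z] .
  also have "\<dots> = deriv f1 z * ((?a z - ?b z) / 2) + ((deriv ?a z - deriv ?b z) / 2) * f1 z"
    using D hol h by (intro DERIV_imp_deriv DERIV_mult DERIV_cdivide DERIV_diff D_derivI z) auto
  moreover have "f * ((a - b) / 2) * ((a - b) / 2) + ((da - db) / 2) * f = f * (((a - b) / 2)\<^sup>2 + (da - db) / 2)"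
    for f a b da db :: complex
    by (simp add: power2_eq_square algebra_simps)
  ultimately show ?thesis
    unfolding deriv_f1[OF z] by simp
qed

lemma solves_f1: "solves f1"
  unfolding solves_def
proof
  fix z assume z: "z \<in> D"
  have "f * (((a - b) / 2)\<^sup>2 + (da - db) / 2) + - a * (f * ((a - b) / 2))
      + (a\<^sup>2 / 4 - da / 2 - (b\<^sup>2 / 4 - db / 2)) * f = 0" for f a b da db :: complex
    by (simp add: field_simps power2_eq_square)
  then show "deriv (deriv f1) z + - (deriv (deriv g) z / deriv g z) * deriv f1 z
       + (schwarzian g z - schwarzian v z) * f1 z = 0"
    unfolding deriv2_f1[OF z] deriv_f1[OF z] schwarzian_alt[OF D hol(1) z nz(1)[OF z]]
      schwarzian_alt[OF D hol(2) z nz(2)[OF z]] .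
qed

lemma solves_v_f1: "solves (\<lambda>z. v z * f1 z)"
  unfolding solves_def
proof
  fix z assume z: "z \<in> D"
  have d1: "deriv (\<lambda>z. v z * f1 z) z = deriv v z * f1 z + deriv f1 z * v z" if z: "z \<in> D" for z
    using hol by (intro DERIV_imp_deriv DERIV_mult D_derivI z) auto
  have "deriv (deriv (\<lambda>z. v z * f1 z)) z = deriv (\<lambda>z. deriv v z * f1 z + deriv f1 z * v z) z"
    using deriv_eqI[OF d1 z] .
  also have "\<dots> = (deriv (deriv v) z * f1 z + deriv f1 z * deriv v z) + (deriv (deriv f1) z * v z + deriv v z * deriv f1 z)"
    using D hol by (intro DERIV_imp_deriv DERIV_add DERIV_mult D_derivI z) (auto intro!: holomorphic_deriv)
  finally have d2: "deriv (deriv (\<lambda>z. v z * f1 z)) z = deriv (deriv v) z * f1 z + 2 * deriv v z * deriv f1 z + v z * deriv (deriv f1) z"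
    by simp
  have "deriv (deriv v) z * f1 z + 2 * deriv v z * deriv f1 z - (deriv (deriv g) z / deriv g z) * deriv v z * f1 z = 0"
    using nz[OF z] by (simp add: deriv_f1[OF z] field_simps)
  moreover have "v z * (deriv (deriv f1) z + - (deriv (deriv g) z / deriv g z) * deriv f1 z
       + (schwarzian g z - schwarzian v z) * f1 z) = 0"
    using solves_f1 z by (simp add: solves_def)
  ultimately show "deriv (deriv (\<lambda>z. v z * f1 z)) z + - (deriv (deriv g) z / deriv g z) * deriv (\<lambda>z. v z * f1 z) z
       + (schwarzian g z - schwarzian v z) * (v z * f1 z) = 0"
    unfolding d1[OF z] d2 by (simp add: algebra_simps)
qed

text \<open>The first order coefficient is -g''/g', so by Abel the Wronskian of f and f1 is a
  constant B times g'. Reduction of order then gives (f/f1)' = B g'/f1^2 = B v', which integrates to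
  A + B v.\<close>

lemma solution_space:
  assumes "connected D" and f: "f holomorphic_on D" and "solves f"
  shows "\<exists>A B. \<forall>z\<in>D. f z = (A + B * v z) * f1 z"
proof (cases "D = {}")
  case True
  then show ?thesis by blast
next
  case False
  let ?W = "\<lambda>z. (deriv f z * f1 z - deriv f1 z * f z) / deriv g z"
  have "(?W has_field_derivative 0) (at z)" if z: "z \<in> D" for z
  proof -
    have "(?W has_field_derivative
        ((deriv (deriv f) z * f1 z + deriv f1 z * deriv f z - (deriv (deriv f1) z * f z + deriv f z * deriv f1 z)) * deriv g z
          - (deriv f z * f1 z - deriv f1 z * f z) * deriv (deriv g) z) / (deriv g z * deriv g z)) (at z)"
      using D hol f nz[OF z] by (intro DERIV_divide DERIV_diff DERIV_mult D_derivI z) (auto intro!: holomorphic_deriv)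
    moreover have 1: "deriv (deriv f) z = deriv (deriv g) z / deriv g z * deriv f z - (schwarzian g z - schwarzian v z) * f z"
      using assms(3) z by (simp add: solves_def algebra_simps eq_neg_iff_add_eq_0)
    moreover have 2: "deriv (deriv f1) z = deriv (deriv g) z / deriv g z * deriv f1 z - (schwarzian g z - schwarzian v z) * f1 z"
      using solves_f1 z by (simp add: solves_def algebra_simps eq_neg_iff_add_eq_0)
    ultimately show ?thesis
      unfolding 1 2 using nz[OF z] by (simp add: field_simps)
  qed
  then have "?W constant_on D"
    using D assms(1) by (intro has_field_derivative_0_imp_constant_on) auto
  then obtain B where B: "\<And>z. z \<in> D \<Longrightarrow> ?W z = B"
    unfolding constant_on_def by blast
  let ?h = "\<lambda>z. f z / f1 z - B * v z"
  have "(?h has_field_derivative 0) (at z)" if z: "z \<in> D" for z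
  proof -
    have "(?h has_field_derivative ((deriv f z * f1 z - f z * deriv f1 z) / (f1 z * f1 z) - B * deriv v z)) (at z)"
      using D hol f f1_nz[OF z] by (intro DERIV_divide DERIV_diff DERIV_cmult D_derivI z) auto
    moreover have "deriv f z * f1 z - f z * deriv f1 z = B * ((f1 z)\<^sup>2 * deriv v z)"
      using B[OF z] nz[OF z] unfolding sq[OF z] by (simp add: field_simps)
    ultimately show ?thesis
      using f1_nz[OF z] by (simp add: field_simps power2_eq_square)
  qed
  then have "?h constant_on D"
    using D assms(1) by (intro has_field_derivative_0_imp_constant_on) auto
  then obtain A where "\<And>z. z \<in> D \<Longrightarrow> ?h z = A"
    unfolding constant_on_def by blast
  then have "f z = (A + B * v z) * f1 z" if "z \<in> D" for z
    using that f1_nz[OF that] by (force simp: field_simps)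
  then show ?thesis by blast
qed

end

section \<open>Moebius rigidity and local form of the Schwarzian\<close>

lemma schwarzian_id [simp]: "schwarzian (\<lambda>x. x) z = 0"
  by (simp add: schwarzian_def numeral_2_eq_2 numeral_3_eq_3)

text \<open>With g the identity the equation is u'' = {v;x} u, and a convex domain allows a
  holomorphic logarithm of v', hence the root (v')^(-1/2).\<close>

lemma ratio_of_solutions_convex:
  assumes "open D" "convex D" "v holomorphic_on D" "\<And>z. z \<in> D \<Longrightarrow> deriv v z \<noteq> 0"
  obtains f1 where "ratio_of_solutions D (\<lambda>x. x) v f1"
proof -
  have "deriv v holomorphic_on D"
    using assms by (auto intro!: holomorphic_deriv)
  then obtain l where l: "l holomorphic_on D" "\<And>z. z \<in> D \<Longrightarrow> deriv v z = exp (l z)"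
    using contractible_imp_holomorphic_log[of "deriv v" D] assms convex_imp_contractible by metis
  have "(exp (- (x / 2)))\<^sup>2 * exp x = 1" for x :: complex
    by (simp flip: exp_double exp_add)
  then have "ratio_of_solutions D (\<lambda>x. x) v (\<lambda>z. exp (- (l z / 2)))"
    using assms l(1) by unfold_locales (auto intro!: holomorphic_intros simp: l(2))
  then show ?thesis by (rule that)
qed

text \<open>Both functions are ratios of solutions of the same equation u'' = {v;x} u, so the
  numerator and the denominator of w are combinations of f1 and v f1.\<close>

lemma eq_schwarzian_imp_moebius:
  assumes D: "open D" "convex D" "D \<noteq> {}"
    and v: "v holomorphic_on D" "\<And>z. z \<in> D \<Longrightarrow> deriv v z \<noteq> 0"
    and w: "w holomorphic_on D" "\<And>z. z \<in> D \<Longrightarrow> deriv w z \<noteq> 0"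
    and eq: "\<And>z. z \<in> D \<Longrightarrow> schwarzian v z = schwarzian w z"
  obtains a b c d where "a * d - b * c \<noteq> 0" "\<And>z. z \<in> D \<Longrightarrow> c * v z + d \<noteq> 0"
    "\<And>z. z \<in> D \<Longrightarrow> w z = (a * v z + b) / (c * v z + d)"
proof -
  obtain f1 where f1: "ratio_of_solutions D (\<lambda>x. x) v f1"
    using ratio_of_solutions_convex[OF D(1,2) v] .
  obtain k1 where k1: "ratio_of_solutions D (\<lambda>x. x) w k1"
    using ratio_of_solutions_convex[OF D(1,2) w] .
  interpret V: ratio_of_solutions D "\<lambda>x. x" v f1 by (rule f1)
  interpret W: ratio_of_solutions D "\<lambda>x. x" w k1 by (rule k1)
  have "V.solves f \<longleftrightarrow> W.solves f" for f
    by (simp add: V.solves_def W.solves_def eq)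
  then have s: "V.solves k1" "V.solves (\<lambda>z. w z * k1 z)"
    using W.solves_f1 W.solves_v_f1 by auto
  have con: "connected D" using D convex_connected by blast
  obtain d c where 1: "\<And>z. z \<in> D \<Longrightarrow> k1 z = (d + c * v z) * f1 z"
    using V.solution_space[OF con W.hol(3) s(1)] by blast
  have "(\<lambda>z. w z * k1 z) holomorphic_on D" using W.hol by (intro holomorphic_intros)
  then obtain b a where 2: "\<And>z. z \<in> D \<Longrightarrow> w z * k1 z = (b + a * v z) * f1 z"
    using V.solution_space[OF con _ s(2)] by blast
  have 3: "c * v z + d \<noteq> 0" if "z \<in> D" for z
    using 1[OF that] W.f1_nz[OF that] by (auto simp: add.commute)
  have 4: "w z = (a * v z + b) / (c * v z + d)" if "z \<in> D" for z
  proof -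
    have "(w z * (c * v z + d)) * f1 z = (a * v z + b) * f1 z"
      using 2[OF that] unfolding 1[OF that] by (simp add: algebra_simps)
    then have "w z * (c * v z + d) = a * v z + b"
      using V.f1_nz[OF that] by simp
    then show ?thesis
      using 3[OF that] by (simp add: nonzero_eq_divide_eq)
  qed
  \<comment> \<open>A vanishing determinant would make w constant, against w' \<noteq> 0.\<close>
  have "a * d - b * c \<noteq> 0"
  proof
    assume 0: "a * d - b * c = 0"
    obtain z0 where z0: "z0 \<in> D" using D(3) by auto
    have "w z = w z0" if "z \<in> D" for z
    proof -
      have "(a * v z + b) * (c * v z0 + d) = (a * v z0 + b) * (c * v z + d) + (a * d - b * c) * (v z - v z0)"
        by (simp add: algebra_simps)
      then have "(a * v z + b) * (c * v z0 + d) = (a * v z0 + b) * (c * v z + d)"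
        by (simp only: 0 mult_zero_left add_0_right)
      then show ?thesis
        unfolding 4[OF that] 4[OF z0] frac_eq_eq[OF 3[OF that] 3[OF z0]] .
    qed
    then have "deriv w z0 = deriv (\<lambda>_. w z0) z0"
      by (rule W.deriv_eqI[OF _ z0])
    then show False using w(2)[OF z0] by simp
  qed
  then show ?thesis using that 3 4 by blast
qed

text \<open>A Moebius transformation has Schwarzian zero, so only the inner term of
  \<open>schwarzian_compose\<close> survives.\<close>

lemma schwarzian_moebius:
  assumes S: "open S" "v holomorphic_on S" "z \<in> S" "deriv v z \<noteq> 0"
    and det: "a * d - b * c \<noteq> 0" and nz: "\<And>z. z \<in> S \<Longrightarrow> c * v z + d \<noteq> 0"
  shows "schwarzian (\<lambda>z. (a * v z + b) / (c * v z + d)) z = schwarzian v z"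
proof -
  define U where "U = {x. c * x + d \<noteq> 0}"
  define w where "w = (\<lambda>x. (a * x + b) / (c * x + d))"
  have U: "open U"
    unfolding U_def by (intro open_Collect_neq continuous_intros)
  have hw: "w holomorphic_on U"
    unfolding w_def U_def by (intro holomorphic_intros) auto
  note ev = deriv_eq_on_open[OF U]
  have w1: "deriv w x = (a * d - b * c) / (c * x + d)\<^sup>2" if "x \<in> U" for x
    using that unfolding w_def U_def
    by (intro DERIV_imp_deriv) (auto intro!: derivative_eq_intros simp: field_simps power2_eq_square)
  have w2: "deriv (deriv w) x = - 2 * c * (a * d - b * c) / (c * x + d)^3" if "x \<in> U" for x
  proof -
    have "deriv (deriv w) x = deriv (\<lambda>x. (a * d - b * c) / (c * x + d)\<^sup>2) x"
      using ev[OF that w1] .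
    also have "\<dots> = - 2 * c * (a * d - b * c) / (c * x + d)^3"
      using that unfolding U_def
      by (intro DERIV_imp_deriv) (auto intro!: derivative_eq_intros simp: divide_simps, auto simp: algebra_simps eval_nat_numeral)
    finally show ?thesis .
  qed
  have w3: "deriv (deriv (deriv w)) x = 6 * c\<^sup>2 * (a * d - b * c) / (c * x + d)^4" if "x \<in> U" for x
  proof -
    have "deriv (deriv (deriv w)) x = deriv (\<lambda>x. - 2 * c * (a * d - b * c) / (c * x + d)^3) x"
      using ev[OF that w2] .
    also have "\<dots> = 6 * c\<^sup>2 * (a * d - b * c) / (c * x + d)^4"
      using that unfolding U_def
      by (intro DERIV_imp_deriv) (auto intro!: derivative_eq_intros simp: divide_simps, auto simp: algebra_simps eval_nat_numeral)
    finally show ?thesis .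
  qed
  have vz: "v z \<in> U" "v ` S \<subseteq> U" using S nz by (auto simp: U_def)
  have "schwarzian w (v z) = 0"
    using w1[OF vz(1)] w2[OF vz(1)] w3[OF vz(1)] vz(1)
    by (simp add: schwarzian_def numeral_2_eq_2 numeral_3_eq_3 U_def)
      (simp add: field_simps eval_nat_numeral)
  moreover have "deriv w (v z) \<noteq> 0"
    using w1[OF vz(1)] vz(1) det by (simp add: U_def)
  ultimately show ?thesis
    using schwarzian_compose[OF S U hw vz(2)] by (simp add: w_def)
qed

text \<open>As t v''/v' = j + t U'/U, a unit U that is analytic at 0 leaves at most a double pole,
  with coefficient j^2/4 + j/2 = ((j + 1)^2 - 1)/4. Negative j is needed for poles of g and for the
  logarithm at a cusp.\<close>

lemma schwarzian_power_form:
  assumes D: "open D" "v holomorphic_on D" "t \<in> D" "0 \<notin> D"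
    and U: "U holomorphic_on D" "\<And>t. t \<in> D \<Longrightarrow> U t \<noteq> 0"
    and v: "\<And>t. t \<in> D \<Longrightarrow> deriv v t = t powi j * U t"
  shows "deriv (deriv v) t / deriv v t = of_int j / t + deriv U t / U t"
    and "t\<^sup>2 * schwarzian v t = (of_int j + t * deriv U t / U t)\<^sup>2 / 4 + of_int j / 2
       - t\<^sup>2 * deriv (\<lambda>t. deriv U t / U t) t / 2"
proof -
  note ev = deriv_eq_on_open[OF D(1)]
  have nz0: "x \<noteq> 0" if "x \<in> D" for x using that D by auto
  have nz: "deriv v x \<noteq> 0" if "x \<in> D" for x
    using that U v nz0 by simp
  have dU: "(U has_field_derivative deriv U x) (at x)" if "x \<in> D" for x
    using that D U by (intro holomorphic_derivI[of _ D]) auto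
  have v2: "deriv (deriv v) x / deriv v x = of_int j / x + deriv U x / U x" if x: "x \<in> D" for x
  proof -
    have "deriv (deriv v) x = deriv (\<lambda>t. t powi j * U t) x"
      using ev[OF x v] .
    also have "\<dots> = of_int j * x powi (j - 1) * U x + deriv U x * x powi j"
      using nz0[OF x] by (intro DERIV_imp_deriv DERIV_mult dU x)
         (auto intro!: derivative_eq_intros)
    finally show ?thesis
      using nz0[OF x] U(2)[OF x] by (simp add: v[OF x] power_int_diff field_simps)
  qed
  show "deriv (deriv v) t / deriv v t = of_int j / t + deriv U t / U t"
    using v2[OF D(3)] .
  have l: "(\<lambda>t. deriv U t / U t) holomorphic_on D"
    using D U by (auto intro!: holomorphic_intros)
  have "deriv (\<lambda>x. deriv (deriv v) x / deriv v x) t = deriv (\<lambda>x. of_int j / x + deriv U x / U x) t"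
    using ev[OF D(3) v2] .
  also have "\<dots> = - of_int j / t\<^sup>2 + deriv (\<lambda>t. deriv U t / U t) t"
    using nz0[OF D(3)]
    by (intro DERIV_imp_deriv DERIV_add holomorphic_derivI[OF l D(1,3)])
       (auto intro!: derivative_eq_intros simp: power2_eq_square)
  finally have "schwarzian v t = (of_int j / t + deriv U t / U t)\<^sup>2 / 4
      - (- of_int j / t\<^sup>2 + deriv (\<lambda>t. deriv U t / U t) t) / 2"
    using schwarzian_alt[OF D(1,2,3) nz[OF D(3)]] v2[OF D(3)] by simp
  moreover have "t\<^sup>2 * ((j / t + e)\<^sup>2 / 4 - (- j / t\<^sup>2 + f) / 2) = (j + t * e)\<^sup>2 / 4 + j / 2 - t\<^sup>2 * f / 2"
    for e f j :: complex
    using nz0[OF D(3)] by (simp add: field_simps power2_eq_square)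
  ultimately show "t\<^sup>2 * schwarzian v t = (of_int j + t * deriv U t / U t)\<^sup>2 / 4 + of_int j / 2
       - t\<^sup>2 * deriv (\<lambda>t. deriv U t / U t) t / 2"
    by simp
qed

section \<open>Analytic germs at 0 and slit discs\<close>

lemma analytic_at_0I:
  assumes "f holomorphic_on ball 0 r" "r > 0"
  shows "f analytic_on {0}"
  using assms analytic_on_open[OF open_ball] analytic_on_subset[of f "ball 0 r" "{0}"] by auto

lemma log_near_nonzero:
  assumes "U analytic_on {0}" "U 0 \<noteq> 0"
  obtains e l where "e > 0" "U holomorphic_on ball 0 e" "l holomorphic_on ball 0 e"
    "\<And>t. t \<in> ball 0 e \<Longrightarrow> U t = exp (l t)"
proof -
  obtain e1 where e1: "e1 > 0" "U holomorphic_on ball 0 e1"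
    using assms(1) analytic_at_ball by blast
  then have "isCont U 0"
    using holomorphic_on_imp_continuous_on continuous_on_interior by (metis centre_in_ball interior_open open_ball)
  then obtain e2 where e2: "e2 > 0" "\<And>t. dist 0 t < e2 \<Longrightarrow> U t \<noteq> 0"
    using assms(2) continuous_at_avoid[of 0 U 0] by auto
  have "U holomorphic_on ball 0 (min e1 e2)"
    using e1 by (auto intro: holomorphic_on_subset)
  moreover from this obtain l where "l holomorphic_on ball 0 (min e1 e2)" "\<And>t. t \<in> ball 0 (min e1 e2) \<Longrightarrow> U t = exp (l t)"
    by (rule contractible_imp_holomorphic_log) (use e2 in \<open>auto simp: convex_imp_contractible\<close>)
  ultimately show ?thesis
    using that[of "min e1 e2" l] e1 e2 by auto
qed

abbreviation slit_ball :: "real \<Rightarrow> complex set" where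
  "slit_ball r \<equiv> ball 0 r - \<real>\<^sub>\<le>\<^sub>0"

lemma open_slit_ball: "open (ball 0 e - \<real>\<^sub>\<le>\<^sub>0 :: complex set)"
  by (intro open_Diff) auto

text \<open>The slit disc is star-shaped about the point e/2 of the positive axis.\<close>

lemma connected_slit_ball: "connected (ball 0 e - \<real>\<^sub>\<le>\<^sub>0 :: complex set)"
proof (cases "e > 0")
  case True
  let ?c = "of_real (e / 2) :: complex"
  have "closed_segment ?c z \<subseteq> ball 0 e - \<real>\<^sub>\<le>\<^sub>0" if z: "z \<in> ball 0 e - \<real>\<^sub>\<le>\<^sub>0" for z
  proof -
    have "closed_segment ?c z \<subseteq> ball 0 e"
      using z True by (intro closed_segment_subset) auto
    moreover have "w \<notin> \<real>\<^sub>\<le>\<^sub>0" if w: "w \<in> closed_segment ?c z" for w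
    proof
      assume "w \<in> \<real>\<^sub>\<le>\<^sub>0"
      moreover obtain u where u: "0 \<le> u" "u \<le> 1" "w = (1 - u) *\<^sub>R ?c + u *\<^sub>R z"
        using w by (auto simp: in_segment)
      ultimately have *: "u * Im z = 0" "(1 - u) * (e / 2) + u * Re z \<le> 0"
        by (auto simp: complex_nonpos_Reals_iff)
      show False
      proof (cases "u = 0")
        case True then show False using * \<open>e > 0\<close> by auto
      next
        case False
        then have "Im z = 0" "Re z > 0" using * z by (auto simp: complex_nonpos_Reals_iff)
        then have "u * Re z > 0" "(1 - u) * (e / 2) \<ge> 0"
          using u False \<open>e > 0\<close> by auto
        then show False using * by linarith
      qed
    qed
    ultimately show ?thesis by auto
  qed
  moreover have "?c \<in> ball 0 e - \<real>\<^sub>\<le>\<^sub>0"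
    using True by (auto simp: complex_nonpos_Reals_iff)
  ultimately have "starlike (ball 0 e - \<real>\<^sub>\<le>\<^sub>0 :: complex set)"
    unfolding starlike_def by blast
  then show ?thesis
    using starlike_imp_connected by blast
qed (simp add: ball_empty)

subsection \<open>Singular points and pullbacks in local coordinates\<close>

text \<open>Properties that hold on all sufficiently small discs are combined with the filter \<open>at_right 0\<close> of radii.\<close>

lemma small_holomorphic:
  assumes "f analytic_on {0}"
  shows "\<forall>\<^sub>F e in at_right (0::real). f holomorphic_on ball (0::complex) e"
proof -
  obtain d where "d > 0" "f holomorphic_on ball 0 d"
    using assms analytic_at_ball by blast
  then show ?thesis
    unfolding eventually_at_right_field by (intro exI[of _ d]) (auto elim!: holomorphic_on_subset)
qed

lemma small_nhds:
  assumes "\<forall>\<^sub>F t in nhds (0::complex). P t"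
  shows "\<forall>\<^sub>F e in at_right (0::real). \<forall>t\<in>ball 0 e. P t"
proof -
  obtain d where "d > 0" "\<And>t. dist t 0 < d \<Longrightarrow> P t"
    using assms unfolding eventually_nhds_metric by blast
  then show ?thesis
    unfolding eventually_at_right_field by (intro exI[of _ d]) auto
qed

lemma small_at:
  assumes "\<forall>\<^sub>F t in at (0::complex). P t"
  shows "\<forall>\<^sub>F e in at_right (0::real). \<forall>t\<in>ball 0 e - {0}. P t"
  using small_nhds[of "\<lambda>t. t \<noteq> 0 \<longrightarrow> P t"] assms
  unfolding eventually_at_filter by (auto elim!: eventually_mono)

lemma small_radius:
  assumes "\<forall>\<^sub>F e in at_right (0::real). P e"
  obtains e where "e > 0" "P e"
proof -
  have "\<forall>\<^sub>F e in at_right (0::real). P e \<and> e > 0"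
    using assms eventually_at_right_less[of 0] by (rule eventually_conj)
  then show ?thesis
    using that eventually_happens'[OF trivial_limit_at_right_real] by blast
qed

lemma eventually_at_ball:
  assumes "e > 0" "\<And>t. t \<in> ball 0 e - {0} \<Longrightarrow> P t"
  shows "\<forall>\<^sub>F t in at (0::complex). P t"
  using assms unfolding eventually_at by (intro exI[of _ e]) auto

lemma tendsto_nhds_analytic:
  assumes "f analytic_on {0}"
  shows "(f \<longlongrightarrow> f 0) (nhds (0::complex))"
  using analytic_at_imp_isCont[OF assms] by (simp add: continuous_within tendsto_at_iff_tendsto_nhds)

lemma eventually_nhds_nonzero:
  assumes "f analytic_on {0}" "f 0 \<noteq> (0::complex)"
  shows "\<forall>\<^sub>F t in nhds (0::complex). f t \<noteq> 0"
  using tendsto_nhds_analytic[OF assms(1)] assms(2) tendsto_imp_eventually_ne by blast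

text \<open>Refines \<open>extends_analytically\<close> by the value at the centre, which is what
  enters the indicial polynomial.\<close>

definition extends_to :: "(complex \<Rightarrow> complex) \<Rightarrow> complex \<Rightarrow> bool" where
  "extends_to f c \<longleftrightarrow> (\<exists>g. g analytic_on {0} \<and> g 0 = c \<and> (\<forall>\<^sub>F t in at 0. f t = g t))"

lemma extends_toI: "g analytic_on {0} \<Longrightarrow> g 0 = c \<Longrightarrow> (\<forall>\<^sub>F t in at 0. f t = g t) \<Longrightarrow> extends_to f c"
  unfolding extends_to_def by blast

lemma extends_to_imp: "extends_to f c \<Longrightarrow> extends_analytically f"
  unfolding extends_to_def extends_analytically_def by blast

lemma extends_to_tendsto: "extends_to f c \<Longrightarrow> (f \<longlongrightarrow> c) (at 0)"
proof -
  assume "extends_to f c"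
  then obtain g where g: "g analytic_on {0}" "g 0 = c" "\<forall>\<^sub>F t in at 0. f t = g t"
    unfolding extends_to_def by blast
  then have "(g \<longlongrightarrow> c) (at 0)"
    using analytic_at_imp_isCont[of g 0] by (simp add: isCont_def)
  then show ?thesis
    using g(3) by (simp add: filterlim_cong)
qed

lemma extends_analytically_tendsto_0:
  assumes "extends_analytically f" "n > 0"
  shows "((\<lambda>t. t ^ n * f t) \<longlongrightarrow> 0) (at 0)"
proof -
  obtain c where "extends_to f c"
    using assms(1) unfolding extends_to_def extends_analytically_def by blast
  then have "((\<lambda>t. t ^ n * f t) \<longlongrightarrow> 0 ^ n * c) (at 0)"
    by (intro tendsto_intros extends_to_tendsto)
  then show ?thesis using assms(2) by (simp add: zero_power)
qed

locale regular_local_data =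
  fixes L :: ode and x :: sphere and P0 Q0 :: complex
  assumes P0: "extends_to (\<lambda>t. t * fst (local_eqn L x) t) P0"
    and Q0: "extends_to (\<lambda>t. t\<^sup>2 * snd (local_eqn L x) t) Q0"
begin

lemma singular_imp_regular: "singular_point L x \<Longrightarrow> regular_singular_point L x"
  unfolding regular_singular_point_def using extends_to_imp P0 Q0 by blast

text \<open>At a nonsingular point t p and t^2 q tend to 0, so a nonzero limit of either one forces
  a singularity.\<close>

lemma singular_if_nonzero:
  assumes "P0 \<noteq> 0 \<or> Q0 \<noteq> 0"
  shows "regular_singular_point L x"
proof (rule singular_imp_regular, unfold singular_point_def, rule notI)
  assume "extends_analytically (fst (local_eqn L x)) \<and> extends_analytically (snd (local_eqn L x))"
  then have s: "extends_analytically (fst (local_eqn L x))" "extends_analytically (snd (local_eqn L x))"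
    by auto
  have "((\<lambda>t. t * fst (local_eqn L x) t) \<longlongrightarrow> 0) (at 0)"
    using extends_analytically_tendsto_0[OF s(1), of 1] by simp
  moreover have "((\<lambda>t. t\<^sup>2 * snd (local_eqn L x) t) \<longlongrightarrow> 0) (at 0)"
    using extends_analytically_tendsto_0[OF s(2), of 2] by simp
  ultimately have "P0 = 0" "Q0 = 0"
    using tendsto_unique[OF trivial_limit_at extends_to_tendsto[OF P0]]
      tendsto_unique[OF trivial_limit_at extends_to_tendsto[OF Q0]] by blast+
  then show False using assms by blast
qed

lemma indicial: "indicial_poly L x = [:Q0, P0 - 1, 1:]"
  unfolding indicial_poly_def Let_def
  by (simp add: tendsto_Lim[OF trivial_limit_at extends_to_tendsto[OF P0]]
      tendsto_Lim[OF trivial_limit_at extends_to_tendsto[OF Q0]])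

text \<open>In this parametrisation the indicial polynomial is s^2 - k s + (k^2 - d^2)/4 with roots
  (k + d)/2 and (k - d)/2; the two signs come from the two orders of the roots.\<close>

lemma exponent_difference_iff:
  assumes "P0 = 1 - k" "Q0 = (k\<^sup>2 - d\<^sup>2) / 4"
  shows "exponent_difference L x d' \<longleftrightarrow> d' = d \<or> d' = - d"
proof
  assume "exponent_difference L x d'"
  then obtain r s where rs: "[:Q0, P0 - 1, 1:] = [:- r, 1:] * [:- s, 1:]" "d' = r - s"
    unfolding exponent_difference_def indicial by blast
  then have "r * s = (k\<^sup>2 - d\<^sup>2) / 4" "k = r + s"
    using assms by (auto simp: algebra_simps)
  then have "4 * (r * s) = (r + s)\<^sup>2 - d\<^sup>2" by (simp add: mult.commute)
  then have "d'\<^sup>2 = d\<^sup>2"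
    unfolding rs(2) by (simp add: power2_eq_square algebra_simps)
  then show "d' = d \<or> d' = - d"
    by (simp add: power2_eq_iff)
next
  assume d': "d' = d \<or> d' = - d"
  have "[:Q0, P0 - 1, 1:] = [:- ((k + d') / 2), 1:] * [:- ((k - d') / 2), 1:]"
    using d' by (auto simp: assms power2_eq_square field_simps)
  moreover have "d' = (k + d') / 2 - (k - d') / 2" by (simp add: field_simps)
  ultimately show "exponent_difference L x d'"
    unfolding exponent_difference_def indicial by blast
qed

end

text \<open>Chosen so that the derivative of \<open>param y\<close> has order
  \<open>orient y - 1\<close> at t = 0.\<close>

definition orient :: "sphere \<Rightarrow> int" where
  "orient y = (case y of Fin a \<Rightarrow> 1 | Infty \<Rightarrow> - 1)"

lemma orient_sq [simp]: "orient y * orient y = 1" "orient y \<noteq> 0"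
  by (auto simp: orient_def split: sphere.splits)

lemma has_deriv_param:
  assumes "t \<noteq> 0"
  shows "(param y has_field_derivative (case y of Fin a \<Rightarrow> 1 | Infty \<Rightarrow> - 1 / t\<^sup>2)) (at t)"
proof (cases y)
  case (Fin a)
  then have "param y = (\<lambda>t. a + t)" by auto
  then show ?thesis using Fin by (auto intro!: derivative_eq_intros)
next
  case Infty
  then have "param y = (\<lambda>t. 1 / t)" by auto
  then show ?thesis using Infty assms by (auto intro!: derivative_eq_intros simp: power2_eq_square)
qed

lemma deriv_param: "t \<noteq> 0 \<Longrightarrow> deriv (param y) t = (case y of Fin a \<Rightarrow> 1 | Infty \<Rightarrow> - 1 / t\<^sup>2)"
  using has_deriv_param DERIV_imp_deriv by blast

lemma deriv_param_nonzero: "t \<noteq> 0 \<Longrightarrow> deriv (param y) t \<noteq> 0"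
  by (simp add: deriv_param split: sphere.splits)

lemma holomorphic_param: "param y holomorphic_on S - {0}"
  using has_deriv_param holomorphic_on_def field_differentiable_def has_field_derivative_at_within
  by (metis DiffE singletonI)

lemma holomorphic_param' [holomorphic_intros]:
  assumes "f holomorphic_on S" "\<And>t. t \<in> S \<Longrightarrow> f t \<noteq> 0"
  shows "(\<lambda>t. param y (f t)) holomorphic_on S"
proof -
  have "f ` S \<subseteq> UNIV - {0}" using assms(2) by auto
  from holomorphic_on_compose_gen[OF assms(1) holomorphic_param this] show ?thesis
    unfolding o_def .
qed

lemma inj_on_param: "inj_on (param y) (S - {0})"
  by (cases y) (auto simp: inj_on_def)

lemma chart_nonzero: "t \<noteq> 0 \<Longrightarrow> chart y t = Fin (param y t)"
  by (cases y) auto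

lemma chart_zero [simp]: "chart y 0 = y"
  by (cases y) auto

lemma inj_chart: "inj (chart y)"
  by (cases y) (auto simp: inj_def split: if_splits)

lemma deriv_param_compose:
  assumes "(T has_field_derivative T') (at t)" "T t \<noteq> 0"
  shows "((\<lambda>t. param y (T t)) has_field_derivative deriv (param y) (T t) * T') (at t)"
  using DERIV_chain2[OF _ assms(1), of "param y"] has_deriv_param[OF assms(2), of y] deriv_param[OF assms(2), of y]
  by simp

text \<open>\<open>E\<close> is the pullback by \<open>g\<close> of \<open>u'' + q u = 0\<close> near \<open>t = 0\<close>.\<close>

definition pulled_near0 :: "ode \<Rightarrow> (complex \<Rightarrow> complex) \<Rightarrow> (complex \<Rightarrow> complex) \<Rightarrow> bool" where
  "pulled_near0 E g q \<longleftrightarrow> (\<forall>\<^sub>F t in at 0. fst E t = - (deriv (deriv g) t / deriv g t)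
      \<and> snd E t = q (g t) * (deriv g t)\<^sup>2)"

lemma pulled_near0_local_eqn:
  assumes "fst L = (\<lambda>x. 0)"
  shows "pulled_near0 (local_eqn L y) (param y) (snd L)"
  using assms by (simp add: pulled_near0_def local_eqn_def pullback_def)

text \<open>Pullback is functorial: pulling back by R in the affine coordinate and then by
  \<open>param z\<close> is pulling back by the composite, which is R read from the coordinate at z
  into the one at \<open>R z\<close>. Points at infinity cause no trouble because everything happens
  off t = 0.\<close>

lemma pulled_near0_sphere_pullback:
  assumes L: "fst L = (\<lambda>x. 0)"
    and R: "\<forall>\<^sub>F t in at 0. R (chart z t) = chart y (T t)"
    and T: "T analytic_on {0}" "\<forall>\<^sub>F t in at 0. T t \<noteq> 0" "\<forall>\<^sub>F t in at 0. deriv T t \<noteq> 0"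
  shows "pulled_near0 (local_eqn (sphere_pullback R L) z) (\<lambda>t. param y (T t)) (snd L)"
proof -
  define A where "A = affine_part R"
  define g where "g = (\<lambda>t. param y (T t))"
  obtain e where e: "e > 0" "T holomorphic_on ball 0 e" "\<forall>t\<in>ball 0 e - {0}. R (chart z t) = chart y (T t)"
     "\<forall>t\<in>ball 0 e - {0}. T t \<noteq> 0" "\<forall>t\<in>ball 0 e - {0}. deriv T t \<noteq> 0"
    using eventually_conj[OF small_holomorphic[OF T(1)] eventually_conj[OF small_at[OF R]
        eventually_conj[OF small_at[OF T(2)] small_at[OF T(3)]]]] by (rule small_radius) blast
  define B where "B = ball (0::complex) e - {0}"
  have B: "open B" unfolding B_def by auto
  have hT: "T holomorphic_on B" using e(2) by (auto simp: B_def elim!: holomorphic_on_subset)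
  have hg: "g holomorphic_on B"
    unfolding g_def using e(4) hT by (intro holomorphic_intros) (auto simp: B_def)
  have Ag: "A (param z t) = g t" if "t \<in> B" for t
  proof -
    have "R (Fin (param z t)) = Fin (param y (T t))"
      using bspec[OF e(3) that[unfolded B_def]] bspec[OF e(4) that[unfolded B_def]]
        that chart_nonzero[of t z] chart_nonzero[of "T t" y] by (simp add: B_def)
    then show ?thesis by (simp add: A_def g_def affine_part_def)
  qed
  have g': "deriv g t \<noteq> 0" if "t \<in> B" for t
  proof -
    have "deriv g t = deriv (param y) (T t) * deriv T t"
      unfolding g_def using that e
      by (intro DERIV_imp_deriv deriv_param_compose holomorphic_derivI[OF hT B]) (auto simp: B_def)
    then show ?thesis
      using that e deriv_param_nonzero by (auto simp: B_def)
  qed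
  have hp: "param z holomorphic_on B" and ip: "inj_on (param z) B"
    unfolding B_def by (rule holomorphic_param, rule inj_on_param)
  \<comment> \<open>\<open>affine_part R\<close> is known only pointwise. Its analyticity is
    recovered from that of g, as g o s with s the inverse of \<open>param z\<close> on B.\<close>
  obtain s where s: "s holomorphic_on param z ` B" "\<And>t. t \<in> B \<Longrightarrow> s (param z t) = t"
    using holomorphic_has_inverse[OF hp B ip] by metis
  have oB: "open (param z ` B)"
    using open_mapping_thm3[OF hp B ip] .
  have "(\<lambda>x. g (s x)) holomorphic_on param z ` B"
    using s by (intro holomorphic_on_compose_gen[OF s(1) hg, unfolded o_def]) auto
  then have hA: "A holomorphic_on param z ` B"
    by (rule holomorphic_transform) (use Ag s in auto)
  note ev = deriv_eq_on_open[OF B]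
  have dp: "(param z has_field_derivative deriv (param z) t) (at t)" if "t \<in> B" for t
    using holomorphic_derivI[OF hp B that] .
  have dp2: "(deriv (param z) has_field_derivative deriv (deriv (param z)) t) (at t)" if "t \<in> B" for t
    using holomorphic_derivI[OF holomorphic_deriv[OF hp B] B that] .
  have dA: "((\<lambda>t. f (param z t)) has_field_derivative deriv f (param z t) * deriv (param z) t) (at t)"
    if "t \<in> B" "f holomorphic_on param z ` B" for f t
    using that by (intro DERIV_chain2 dp holomorphic_derivI[OF _ oB]) auto
  have g1: "deriv g t = deriv A (param z t) * deriv (param z) t" if t: "t \<in> B" for t
    using ev[OF t, of "\<lambda>t. A (param z t)" g] Ag DERIV_imp_deriv[OF dA[OF t hA]] by simp
  have g2: "deriv (deriv g) t = deriv (deriv A) (param z t) * (deriv (param z) t)\<^sup>2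
      + deriv A (param z t) * deriv (deriv (param z)) t" if t: "t \<in> B" for t
  proof -
    have "deriv (deriv g) t = deriv (\<lambda>t. deriv A (param z t) * deriv (param z) t) t"
      using ev[OF t g1] .
    also have "\<dots> = deriv (deriv A) (param z t) * deriv (param z) t * deriv (param z) t
         + deriv (deriv (param z)) t * deriv A (param z t)"
      by (rule DERIV_imp_deriv, rule DERIV_mult[OF dA[OF t holomorphic_deriv[OF hA oB]] dp2[OF t]])
    finally show ?thesis by (simp add: power2_eq_square)
  qed
  have "fst (local_eqn (sphere_pullback R L) z) t = - (deriv (deriv g) t / deriv g t)
      \<and> snd (local_eqn (sphere_pullback R L) z) t = snd L (g t) * (deriv g t)\<^sup>2" if t: "t \<in> B" for t
  proof -
    have nz: "deriv A (param z t) \<noteq> 0" "deriv (param z) t \<noteq> 0"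
      using g'[OF t] g1[OF t] by auto
    \<comment> \<open>Here d1, d2 stand for the derivatives of the affine map and p1, p2 for those
      of \<open>param z\<close>.\<close>
    have "- (d2 / d1) * p1 - p2 / p1 = - ((d2 * p1\<^sup>2 + d1 * p2) / (d1 * p1))"
      if "d1 \<noteq> 0" "p1 \<noteq> 0" for d1 d2 p1 p2 :: complex
      using that by (simp add: field_simps power2_eq_square)
    from this[OF nz] show ?thesis
      unfolding local_eqn_def sphere_pullback_def pullback_def g1[OF t] g2[OF t] A_def[symmetric]
      using Ag[OF t] by (simp add: L power_mult_distrib)
  qed
  then show ?thesis
    unfolding pulled_near0_def g_def[symmetric]
    by (intro eventually_at_ball[OF e(1)]) (auto simp: B_def)
qed

lemma small_slit:
  assumes "\<forall>\<^sub>F t in at (0::complex) within - \<real>\<^sub>\<le>\<^sub>0. P t"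
  shows "\<forall>\<^sub>F e in at_right (0::real). \<forall>t\<in>ball 0 e - \<real>\<^sub>\<le>\<^sub>0. P t"
proof -
  have "\<forall>\<^sub>F t in nhds (0::complex). t \<noteq> 0 \<longrightarrow> t \<in> - \<real>\<^sub>\<le>\<^sub>0 \<longrightarrow> P t"
    using assms unfolding eventually_at_filter .
  from small_nhds[OF this] show ?thesis
    by (rule eventually_mono) (auto simp: complex_nonpos_Reals_iff)
qed

lemma eventually_slit_ball:
  assumes "e > 0" "\<And>t. t \<in> ball 0 e - \<real>\<^sub>\<le>\<^sub>0 \<Longrightarrow> P t"
  shows "\<forall>\<^sub>F t in at (0::complex) within - \<real>\<^sub>\<le>\<^sub>0. P t"
  using assms unfolding eventually_at by (intro exI[of _ e]) auto

lemma powr_half_int_square: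
  assumes "t \<noteq> 0"
  shows "(t powr (of_int i / 2))\<^sup>2 = (t::complex) powi i"
proof -
  have "(t powr (of_int i / 2))\<^sup>2 = t powr (of_int i / 2 + of_int i / 2)"
    unfolding power2_eq_square powr_add ..
  also have "\<dots> = t powi i"
    using assms by (simp add: complex_powr_of_int)
  finally show ?thesis .
qed

section \<open>Pullback along a map of given ramification index\<close>

locale ramified_coordinate =
  fixes y :: sphere and e :: nat and U :: "complex \<Rightarrow> complex"
  assumes U: "U analytic_on {0}" "U 0 \<noteq> 0" and e: "e > 0"
begin

text \<open>\<open>T\<close> is the map between centred coordinates. \<open>N\<close> and
  \<open>G\<close> are the unit parts of the derivatives: T' = t^(e-1) N and g' = t^(k-1) G. Over
  \<open>Infty\<close> the map g = 1/T has a pole of order e, so there \<open>k\<close> is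
  -e.\<close>

definition T :: "complex \<Rightarrow> complex" where "T t = t ^ e * U t"
definition N :: "complex \<Rightarrow> complex" where "N t = of_nat e * U t + t * deriv U t"
definition G :: "complex \<Rightarrow> complex" where
  "G t = (case y of Fin a \<Rightarrow> N t | Infty \<Rightarrow> - N t / (U t)\<^sup>2)"
definition g :: "complex \<Rightarrow> complex" where "g t = param y (T t)"
definition k :: int where "k = orient y * int e"

definition good :: "real \<Rightarrow> bool" where
  "good r \<longleftrightarrow> U holomorphic_on ball 0 r \<and> (\<forall>t\<in>ball 0 r. U t \<noteq> 0) \<and> (\<forall>t\<in>ball 0 r. N t \<noteq> 0)"

lemma N_analytic: "N analytic_on {0}" and N_0: "N 0 \<noteq> 0"
  using U e unfolding N_def[abs_def] by (auto intro!: analytic_intros)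

lemma T_analytic: "T analytic_on {0}" and T_0: "T 0 = 0"
  using U e unfolding T_def[abs_def] by (auto intro!: analytic_intros simp: zero_power)

lemma G_analytic: "G analytic_on {0}" and G_0: "G 0 \<noteq> 0"
  using U N_analytic N_0 unfolding G_def[abs_def]
  by (cases y; auto intro!: analytic_intros)+

lemma small_good: "\<forall>\<^sub>F r in at_right 0. good r"
  unfolding good_def
  by (intro eventually_conj small_holomorphic small_nhds eventually_nhds_nonzero U N_analytic N_0)

lemma k_sq: "k\<^sup>2 = (int e)\<^sup>2"
  by (simp add: k_def power_mult_distrib power2_eq_square)

lemma deriv_T:
  assumes "good r" "t \<in> ball 0 r"
  shows "(T has_field_derivative t ^ (e - 1) * N t) (at t)"
proof -
  have "(T has_field_derivative of_nat e * t ^ (e - Suc 0) * U t + deriv U t * t ^ e) (at t)"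
    unfolding T_def[abs_def] using assms
    by (intro DERIV_mult holomorphic_derivI[of U "ball 0 r"])
       (auto simp: good_def intro!: derivative_eq_intros)
  moreover have "of_nat e * t ^ (e - Suc 0) * U t + deriv U t * t ^ e = t ^ (e - 1) * N t"
    using e by (simp add: N_def power_eq_if algebra_simps)
  ultimately show ?thesis by metis
qed

lemma T_nonzero: "good r \<Longrightarrow> t \<in> ball 0 r - {0} \<Longrightarrow> T t \<noteq> 0"
  by (auto simp: T_def good_def)

lemma T_holomorphic: "good r \<Longrightarrow> T holomorphic_on ball 0 r"
  by (auto simp: T_def[abs_def] good_def intro!: holomorphic_intros)

lemma g_holomorphic: "good r \<Longrightarrow> g holomorphic_on ball 0 r - {0}"
  unfolding g_def[abs_def]
  by (intro holomorphic_intros T_nonzero) (auto intro: holomorphic_on_subset T_holomorphic)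

lemma N_holomorphic: "good r \<Longrightarrow> N holomorphic_on ball 0 r"
  by (auto simp: N_def[abs_def] good_def intro!: holomorphic_intros)

lemma G_holomorphic: "good r \<Longrightarrow> G holomorphic_on ball 0 r"
  and G_nonzero: "good r \<Longrightarrow> t \<in> ball 0 r \<Longrightarrow> G t \<noteq> 0"
  using N_holomorphic[of r] unfolding G_def[abs_def] good_def
  by (cases y; auto intro!: holomorphic_intros)+

lemma deriv_g_T:
  assumes "good r" "t \<in> ball 0 r - {0}"
  shows "deriv g t = deriv (param y) (T t) * (t ^ (e - 1) * N t)"
  unfolding g_def[abs_def] using assms
  by (intro DERIV_imp_deriv deriv_param_compose deriv_T[of r] T_nonzero[of r]) auto

lemma deriv_g:
  assumes "good r" "t \<in> ball 0 r - {0}"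
  shows "deriv g t = t powi (k - 1) * G t"
proof -
  have t: "t \<noteq> 0" "U t \<noteq> 0" "T t \<noteq> 0" using assms T_nonzero by (auto simp: good_def)
  have e1: "t powi (int e - 1) = t ^ (e - 1)"
    using e by (simp add: power_int_def nat_diff_distrib)
  show ?thesis
  proof (cases y)
    case (Fin a)
    then show ?thesis
      using t e1 unfolding deriv_g_T[OF assms] G_def k_def orient_def by (simp add: deriv_param)
  next
    case Infty
    have "t powi (- int e - 1) = t powi (int e - 1) / (t powi int e)\<^sup>2"
      using t by (simp add: power_int_diff power_int_minus field_simps power2_eq_square)
    then have "t powi (- int e - 1) = t ^ (e - 1) / (t ^ e)\<^sup>2"
      by (simp add: e1)
    then show ?thesis
      using Infty t unfolding deriv_g_T[OF assms] G_def k_def orient_def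
      by (simp add: deriv_param T_def power_mult_distrib)
  qed
qed

lemma T_eventually:
  "\<forall>\<^sub>F t in at 0. T t \<noteq> 0" "\<forall>\<^sub>F t in at 0. deriv T t \<noteq> 0"
proof -
  obtain r where r: "r > 0" "good r" using small_good by (rule small_radius)
  show "\<forall>\<^sub>F t in at 0. T t \<noteq> 0"
    by (rule eventually_at_ball[OF r(1)]) (rule T_nonzero[OF r(2)])
  have nz: "deriv T t \<noteq> 0" if "t \<in> ball 0 r - {0}" for t
    using that DERIV_imp_deriv[OF deriv_T[OF r(2), of t]] r(2) by (auto simp: good_def)
  then show "\<forall>\<^sub>F t in at 0. deriv T t \<noteq> 0"
    by (rule eventually_at_ball[OF r(1)]) (use nz in auto)
qed

lemma T_filterlim: "filterlim T (at 0) (at 0)"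
  using T_analytic T_0 T_eventually(1) analytic_at_imp_isCont[of T 0]
  by (auto simp: filterlim_at isCont_def)

text \<open>By t g''/g' = (k - 1) + t G'/G the limit depends only on the order of g'.\<close>

lemma extends_to_p:
  assumes "pulled_near0 E g q"
  shows "extends_to (\<lambda>t. t * fst E t) (1 - of_int k)"
proof (rule extends_toI)
  show "(\<lambda>t. - (of_int (k - 1) + t * deriv G t / G t)) analytic_on {0}"
    using G_analytic G_0 by (auto intro!: analytic_intros)
  obtain r where r: "r > 0" "good r" "\<forall>t\<in>ball 0 r - {0}. fst E t = - (deriv (deriv g) t / deriv g t) \<and> snd E t = q (g t) * (deriv g t)\<^sup>2"
    using eventually_conj[OF small_good small_at[OF assms[unfolded pulled_near0_def]]] by (rule small_radius) blast
  have eq: "t * fst E t = - (of_int (k - 1) + t * deriv G t / G t)" if t: "t \<in> ball 0 r - {0}" for t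
  proof -
    have "deriv (deriv g) t / deriv g t = of_int (k - 1) / t + deriv G t / G t"
      using t r G_holomorphic[OF r(2)] g_holomorphic[OF r(2)] G_nonzero[OF r(2)] deriv_g[OF r(2)]
      by (intro schwarzian_power_form(1)[of "ball 0 r - {0}" _ _ G])
         (auto elim: holomorphic_on_subset)
    then show ?thesis using r(3) t by (auto simp: field_simps)
  qed
  then show "\<forall>\<^sub>F t in at 0. t * fst E t = - (of_int (k - 1) + t * deriv G t / G t)"
    by (rule eventually_at_ball[OF r(1)]) (use eq in auto)
qed simp

text \<open>Up to the factor (t T'/T)^2 the left side is the same expression for the base equation
  at T t, and t T'/T = N/U tends to e. This carries the double pole coefficient from one
  ramification index to all others.\<close>

lemma extends_to_q:
  assumes E: "pulled_near0 E g q"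
    and q: "extends_to (\<lambda>x. x\<^sup>2 * (q (param y x) * (deriv (param y) x)\<^sup>2)) c"
  shows "extends_to (\<lambda>t. t\<^sup>2 * snd E t) ((of_nat e)\<^sup>2 * c)"
proof -
  obtain h where h: "h analytic_on {0}" "h 0 = c" "\<forall>\<^sub>F x in at 0. x\<^sup>2 * (q (param y x) * (deriv (param y) x)\<^sup>2) = h x"
    using q unfolding extends_to_def by blast
  have ev: "\<forall>\<^sub>F t in at 0. (T t)\<^sup>2 * (q (param y (T t)) * (deriv (param y) (T t))\<^sup>2) = h (T t)"
    using T_filterlim h(3) by (rule eventually_compose_filterlim[rotated])
  obtain r where r: "r > 0" "good r" "\<forall>t\<in>ball 0 r - {0}. fst E t = - (deriv (deriv g) t / deriv g t) \<and> snd E t = q (g t) * (deriv g t)\<^sup>2"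
    "\<forall>t\<in>ball 0 r - {0}. (T t)\<^sup>2 * (q (param y (T t)) * (deriv (param y) (T t))\<^sup>2) = h (T t)"
    using eventually_conj[OF small_good eventually_conj[OF small_at[OF assms(1)[unfolded pulled_near0_def]] small_at[OF ev]]]
    by (rule small_radius) blast
  have eq: "t\<^sup>2 * snd E t = h (T t) * (N t / U t)\<^sup>2" if t: "t \<in> ball 0 r - {0}" for t
  proof -
    have nz: "t \<noteq> 0" "U t \<noteq> 0" using t r(2) by (auto simp: good_def)
    have "t * (t ^ (e - 1) * N t) = T t * (N t / U t)"
      using e nz by (simp add: T_def power_eq_if)
    then have "t\<^sup>2 * (t ^ (e - 1) * N t)\<^sup>2 = (T t)\<^sup>2 * (N t / U t)\<^sup>2"
      by (metis power_mult_distrib)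
    moreover have "snd E t = q (param y (T t)) * (deriv (param y) (T t))\<^sup>2 * (t ^ (e - 1) * N t)\<^sup>2"
      using r(3) t deriv_g_T[OF r(2) t] by (simp add: g_def power_mult_distrib)
    ultimately have "t\<^sup>2 * snd E t = ((T t)\<^sup>2 * (q (param y (T t)) * (deriv (param y) (T t))\<^sup>2)) * (N t / U t)\<^sup>2"
      by (simp add: algebra_simps)
    then show ?thesis using r(4) t by simp
  qed
  show ?thesis
  proof (rule extends_toI)
    have "(\<lambda>t. h (T t)) analytic_on {0}"
      using analytic_on_compose[OF T_analytic, of h] h(1) T_0 by (simp add: o_def)
    then show "(\<lambda>t. h (T t) * (N t / U t)\<^sup>2) analytic_on {0}"
      using N_analytic U by (auto intro!: analytic_intros)
    show "h (T 0) * (N 0 / U 0)\<^sup>2 = (of_nat e)\<^sup>2 * c"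
      using U(2) h(2) T_0 by (simp add: N_def)
    show "\<forall>\<^sub>F t in at 0. t\<^sup>2 * snd E t = h (T t) * (N t / U t)\<^sup>2"
      by (rule eventually_at_ball[OF r(1)]) (use eq in auto)
  qed
qed

end

text \<open>The exponent difference is \<open>j + 1\<close>. At a cusp \<open>j = - 1\<close> and \<open>v\<close> involves \<open>Ln t\<close>, whence the slit discs.\<close>

locale developed_coordinate = ramified_coordinate +
  fixes v V :: "complex \<Rightarrow> complex" and j :: int
  assumes V: "V analytic_on {0}" "V 0 \<noteq> 0"
    and v: "\<forall>\<^sub>F r in at_right 0. v holomorphic_on (ball 0 r - \<real>\<^sub>\<le>\<^sub>0) \<and>
      (\<forall>t\<in>ball 0 r - \<real>\<^sub>\<le>\<^sub>0. deriv v t = t powi j * V t)"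
begin

text \<open>Half the order of g'/v' = t^(k-1-j) G/V, so that t^\<alpha> times a square root of the
  unit G/V is the solution (g'/v')^(1/2).\<close>

definition \<alpha> :: complex where "\<alpha> = of_int (k - 1 - j) / 2"

lemma half_power_solution:
  obtains K where "K analytic_on {0}" "K 0 \<noteq> 0"
    "\<forall>\<^sub>F r in at_right 0. ratio_of_solutions (ball 0 r - \<real>\<^sub>\<le>\<^sub>0) g v (\<lambda>t. t powr \<alpha> * K t)"
proof -
  define F where "F = (\<lambda>t. G t / V t)"
  have F: "F analytic_on {0}" "F 0 \<noteq> 0"
    unfolding F_def using V G_analytic G_0 by (auto intro!: analytic_intros)
  obtain d l where d: "d > 0" "l holomorphic_on ball 0 d" "\<And>t. t \<in> ball 0 d \<Longrightarrow> F t = exp (l t)"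
    using log_near_nonzero[OF F] by (metis (no_types))
  define K where "K = (\<lambda>t. exp (l t / 2))"
  have K: "K holomorphic_on ball 0 d"
    unfolding K_def using d(2) by (intro holomorphic_intros) auto
  then have "K analytic_on {0}"
    using d(1) by (auto simp: analytic_on_open intro: analytic_on_subset[of _ "ball 0 d"])
  moreover have "K 0 \<noteq> 0" by (simp add: K_def)
  moreover have "\<forall>\<^sub>F r in at_right 0. ratio_of_solutions (ball 0 r - \<real>\<^sub>\<le>\<^sub>0) g v (\<lambda>t. t powr \<alpha> * K t)"
    using small_good v small_nhds[OF eventually_nhds_nonzero[OF V]] eventually_at_right_less[of 0] 
      eventually_at_right_real[OF d(1)]
  proof eventually_elim
    case (elim r)
    let ?D = "ball 0 r - \<real>\<^sub>\<le>\<^sub>0 :: complex set"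
    have sub: "?D \<subseteq> ball 0 r - {0}" "?D \<subseteq> ball 0 d"
      using elim(5) by auto
    show "ratio_of_solutions ?D g v (\<lambda>t. t powr \<alpha> * K t)"
    proof
      show "open ?D" by (rule open_slit_ball)
      show "g holomorphic_on ?D" using g_holomorphic[OF elim(1)] sub(1) by (rule holomorphic_on_subset)
      show "v holomorphic_on ?D" using elim(2) by blast
      have "K holomorphic_on ?D" using K sub(2) by (rule holomorphic_on_subset)
      then show "(\<lambda>t. t powr \<alpha> * K t) holomorphic_on ?D"
        by (intro holomorphic_intros) auto
      fix t assume t: "t \<in> ?D"
      then have t0: "t \<in> ball 0 r - {0}" "t \<noteq> 0" "t \<in> ball 0 d" "V t \<noteq> 0"
        using sub elim(3) by auto
      show "deriv g t \<noteq> 0"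
        using deriv_g[OF elim(1) t0(1)] t0 G_nonzero[OF elim(1), of t] by simp
      have dv: "deriv v t = t powi j * V t" using elim(2) t by blast
      then show "deriv v t \<noteq> 0" using t0 by simp
      have "(K t)\<^sup>2 = F t"
        using d(3)[OF t0(3)] by (simp add: K_def flip: exp_double)
      moreover have "(t powr \<alpha>)\<^sup>2 = t powi (k - 1 - j)"
        using powr_half_int_square[OF t0(2)] by (simp only: \<alpha>_def)
      ultimately have "(t powr \<alpha> * K t)\<^sup>2 * deriv v t = t powi (k - 1 - j) * t powi j * (F t * V t)"
        by (simp add: dv power_mult_distrib)
      also have "t powi (k - 1 - j) * t powi j = t powi (k - 1)"
        using t0 by (simp flip: power_int_add)
      also have "F t * V t = G t" using t0 by (simp add: F_def)
      finally show "(t powr \<alpha> * K t)\<^sup>2 * deriv v t = deriv g t"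
        using deriv_g[OF elim(1) t0(1)] by simp
    qed
  qed
  ultimately show ?thesis by (rule that)
qed

text \<open>This is t^2 ({g;t} - {v;t}) written out by \<open>schwarzian_power_form\<close>. In this
  shape it is analytic at 0 even if v lives only on slit discs, since V is analytic on a full
  one.\<close>

definition F :: "complex \<Rightarrow> complex" where
  "F t = ((of_int (k - 1) + t * deriv G t / G t)\<^sup>2 / 4 + of_int (k - 1) / 2
       - t\<^sup>2 * deriv (\<lambda>t. deriv G t / G t) t / 2) - ((of_int j + t * deriv V t / V t)\<^sup>2 / 4 + of_int j / 2
       - t\<^sup>2 * deriv (\<lambda>t. deriv V t / V t) t / 2)"

lemma F_analytic: "F analytic_on {0}"
proof -
  have lg: "(\<lambda>t. deriv f t / f t) analytic_on {0}" if "f analytic_on {0}" "f 0 \<noteq> 0" for f :: "complex \<Rightarrow> complex"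
    using that by (intro analytic_intros) auto
  show ?thesis
    unfolding F_def[abs_def] using V G_analytic G_0 analytic_deriv[OF lg[OF V]] analytic_deriv[OF lg[OF G_analytic G_0]]
    by (intro analytic_intros) auto
qed

text \<open>The orders k - 1 and j contribute (k^2 - 1)/4 and ((j + 1)^2 - 1)/4, and k^2 = e^2
  removes the distinction between finite and infinite y.\<close>

lemma F_0: "F 0 = ((of_nat e)\<^sup>2 - (of_int (j + 1))\<^sup>2) / 4"
proof -
  have "(of_int k :: complex)\<^sup>2 = of_int ((int e)\<^sup>2)"
    using k_sq by (metis of_int_power)
  then have "(of_int k :: complex)\<^sup>2 = (of_nat e)\<^sup>2" by simp
  moreover have "F 0 = ((of_int k)\<^sup>2 - (of_int (j + 1))\<^sup>2) / 4"
    by (simp add: F_def power2_eq_square field_simps)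
  ultimately show ?thesis by simp
qed

lemma F_eq:
  assumes r: "good r" and D: "open D" "D \<subseteq> ball 0 r - {0}" "t \<in> D"
    and hol: "v holomorphic_on D" "V holomorphic_on D"
    and dv: "\<And>t. t \<in> D \<Longrightarrow> V t \<noteq> 0 \<and> deriv v t = t powi j * V t"
  shows "t\<^sup>2 * (schwarzian g t - schwarzian v t) = F t"
proof -
  have "t\<^sup>2 * schwarzian g t = (of_int (k - 1) + t * deriv G t / G t)\<^sup>2 / 4 + of_int (k - 1) / 2
       - t\<^sup>2 * deriv (\<lambda>t. deriv G t / G t) t / 2"
    using D G_nonzero[OF r] deriv_g[OF r] g_holomorphic[OF r] G_holomorphic[OF r]
    by (intro schwarzian_power_form(2)[of "ball 0 r - {0}"]) (auto elim: holomorphic_on_subset)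
  moreover have "t\<^sup>2 * schwarzian v t = (of_int j + t * deriv V t / V t)\<^sup>2 / 4 + of_int j / 2
       - t\<^sup>2 * deriv (\<lambda>t. deriv V t / V t) t / 2"
    using D hol dv by (intro schwarzian_power_form(2)[of D]) auto
  ultimately show ?thesis by (simp add: F_def right_diff_distrib)
qed

context
  fixes M :: ode and x :: sphere and q :: "complex \<Rightarrow> complex"
  assumes E: "pulled_near0 (local_eqn M x) g q"
    and schw: "\<forall>\<^sub>F t in at 0 within - \<real>\<^sub>\<le>\<^sub>0. q (g t) * (deriv g t)\<^sup>2 = schwarzian g t - schwarzian v t"
begin

lemma small_eqn: "\<forall>\<^sub>F r in at_right 0. \<forall>t\<in>ball 0 r - \<real>\<^sub>\<le>\<^sub>0.
   fst (local_eqn M x) t = - (deriv (deriv g) t / deriv g t) \<and>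
   snd (local_eqn M x) t = schwarzian g t - schwarzian v t"
  using small_slit[OF schw] small_at[OF E[unfolded pulled_near0_def]]
proof eventually_elim
  case (elim r)
  show ?case
  proof
    fix t assume t: "t \<in> ball 0 r - (\<real>\<^sub>\<le>\<^sub>0 :: complex set)"
    then have "t \<in> ball 0 r - {0}" by auto
    from bspec[OF elim(2) this] bspec[OF elim(1) t]
    show "fst (local_eqn M x) t = - (deriv (deriv g) t / deriv g t) \<and>
      snd (local_eqn M x) t = schwarzian g t - schwarzian v t"
      by simp
  qed
qed

text \<open>Every solution is (A + B v) t^\<alpha> K, and here v is analytic on a full disc.\<close>

lemma all_solutions_log_free:
  assumes v0: "v analytic_on {0}" and f: "local_solution M x f"
  shows "log_free f"
proof -
  obtain K where K: "K analytic_on {0}" "\<forall>\<^sub>F r in at_right 0. ratio_of_solutions (ball 0 r - \<real>\<^sub>\<le>\<^sub>0) g v (\<lambda>t. t powr \<alpha> * K t)"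
    using half_power_solution by blast
  obtain d where d: "d > 0" "f holomorphic_on (ball 0 d - \<real>\<^sub>\<le>\<^sub>0)"
     "\<forall>t \<in> ball 0 d - \<real>\<^sub>\<le>\<^sub>0. deriv (deriv f) t
        + fst (local_eqn M x) t * deriv f t + snd (local_eqn M x) t * f t = 0"
    using f unfolding local_solution_def by blast
  obtain r where r: "r > 0" "ratio_of_solutions (ball 0 r - \<real>\<^sub>\<le>\<^sub>0) g v (\<lambda>t. t powr \<alpha> * K t)"
     "r < d" "\<forall>t\<in>ball 0 r - \<real>\<^sub>\<le>\<^sub>0. fst (local_eqn M x) t = - (deriv (deriv g) t / deriv g t) \<and>
        snd (local_eqn M x) t = schwarzian g t - schwarzian v t"
    using eventually_conj[OF K(2) eventually_conj[OF small_eqn eventually_at_right_real[OF d(1)]]]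
    by (rule small_radius) auto
  interpret ratio_of_solutions "ball 0 r - \<real>\<^sub>\<le>\<^sub>0" g v "\<lambda>t. t powr \<alpha> * K t"
    by (rule r(2))
  have sub: "ball 0 r - \<real>\<^sub>\<le>\<^sub>0 \<subseteq> ball 0 d - (\<real>\<^sub>\<le>\<^sub>0 :: complex set)"
    using r(3) by auto
  have "solves f"
    unfolding solves_def
  proof
    fix t assume t: "t \<in> ball 0 r - (\<real>\<^sub>\<le>\<^sub>0 :: complex set)"
    show "deriv (deriv f) t + - (deriv (deriv g) t / deriv g t) * deriv f t
       + (schwarzian g t - schwarzian v t) * f t = 0"
      using bspec[OF d(3) subsetD[OF sub t]] bspec[OF r(4) t] by simp
  qed
  then obtain A B where AB: "\<forall>t\<in>ball 0 r - \<real>\<^sub>\<le>\<^sub>0. f t = (A + B * v t) * (t powr \<alpha> * K t)"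
    using solution_space[OF connected_slit_ball holomorphic_on_subset[OF d(2) sub]] by blast
  have "log_expansion f \<alpha> (\<lambda>t. (A + B * v t) * K t) (\<lambda>t. 0)"
    unfolding log_expansion_def
  proof (intro conjI)
    show "(\<lambda>t. (A + B * v t) * K t) analytic_on {0}"
      using K(1) v0 by (intro analytic_intros)
    show "\<forall>\<^sub>F t in at 0 within - \<real>\<^sub>\<le>\<^sub>0. f t = t powr \<alpha> * ((A + B * v t) * K t + 0 * Ln t)"
      by (rule eventually_slit_ball[OF r(1)]) (simp add: AB)
  qed (rule analytic_on_const)
  then show ?thesis unfolding log_free_def by blast
qed

text \<open>The witness is v f1 = t^\<alpha> (H K + c K Ln t), whose logarithmic coefficient c K has
  no zero near 0.\<close>

lemma solution_with_log:
  assumes H: "H analytic_on {0}" and c: "c \<noteq> 0"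
    and vH: "\<forall>\<^sub>F t in at 0 within - \<real>\<^sub>\<le>\<^sub>0. v t = c * Ln t + H t"
  shows "\<exists>f. local_solution M x f \<and> involves_log f"
proof -
  obtain K where K: "K analytic_on {0}" "K 0 \<noteq> 0" "\<forall>\<^sub>F r in at_right 0. ratio_of_solutions (ball 0 r - \<real>\<^sub>\<le>\<^sub>0) g v (\<lambda>t. t powr \<alpha> * K t)"
    using half_power_solution .
  obtain r where r: "r > 0" "ratio_of_solutions (ball 0 r - \<real>\<^sub>\<le>\<^sub>0) g v (\<lambda>t. t powr \<alpha> * K t)"
     "\<forall>t\<in>ball 0 r - \<real>\<^sub>\<le>\<^sub>0. fst (local_eqn M x) t = - (deriv (deriv g) t / deriv g t) \<and>
        snd (local_eqn M x) t = schwarzian g t - schwarzian v t"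
    using eventually_conj[OF K(3) small_eqn] by (rule small_radius) auto
  interpret ratio_of_solutions "ball 0 r - \<real>\<^sub>\<le>\<^sub>0" g v "\<lambda>t. t powr \<alpha> * K t"
    by (rule r(2))
  let ?f = "\<lambda>t. v t * (t powr \<alpha> * K t)"
  have "?f holomorphic_on (ball 0 r - \<real>\<^sub>\<le>\<^sub>0)"
    using holomorphic_on_mult[OF hol(2,3)] .
  then have "local_solution M x ?f"
    unfolding local_solution_def using r(1,3) solves_v_f1[unfolded solves_def]
    by (intro exI[of _ r] conjI ballI) auto
  moreover have "log_expansion ?f \<alpha> (\<lambda>t. H t * K t) (\<lambda>t. c * K t)"
    unfolding log_expansion_def
  proof (intro conjI)
    show "\<forall>\<^sub>F t in at 0 within - \<real>\<^sub>\<le>\<^sub>0. v t * (t powr \<alpha> * K t) = t powr \<alpha> * (H t * K t + c * K t * Ln t)"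
      using vH by eventually_elim (simp add: algebra_simps)
  qed (use K H in \<open>auto intro!: analytic_intros\<close>)
  moreover have "\<not> (\<forall>\<^sub>F t in at 0. c * K t = 0)"
  proof
    assume "\<forall>\<^sub>F t in at 0. c * K t = 0"
    moreover have "\<forall>\<^sub>F t in at 0. K t \<noteq> 0"
      using eventually_nhds_nonzero[OF K(1,2)] by (auto simp: eventually_at_filter elim: eventually_mono)
    ultimately have "\<forall>\<^sub>F t in at (0::complex). False"
      by eventually_elim (use c in auto)
    then show False by (simp add: trivial_limit_def[symmetric])
  qed
  ultimately show ?thesis
    unfolding involves_log_def by blast
qed

end

end

subsection \<open>Local models of the uniformization\<close>

lemma schwarzian_holomorphic:
  assumes "open D" "w holomorphic_on D" "\<And>x. x \<in> D \<Longrightarrow> deriv w x \<noteq> 0"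
  shows "schwarzian w holomorphic_on D"
proof -
  have "(deriv ^^ n) w holomorphic_on D" for n
    using assms by (intro holomorphic_higher_deriv)
  from this[of 2] this[of 3] show ?thesis
    unfolding schwarzian_def[abs_def] using assms
    by (intro holomorphic_intros) auto
qed

lemma eventually_notin_finite:
  assumes "finite (S :: complex set)"
  shows "\<forall>\<^sub>F x in at a. x \<notin> S"
proof -
  have "open (- (S - {a}))" using assms by (intro open_Compl finite_imp_closed) auto
  then have "\<forall>\<^sub>F x in nhds a. x \<in> - (S - {a})"
    by (rule eventually_nhds_in_open) auto
  then show ?thesis
    unfolding eventually_at_filter by (rule eventually_mono) auto
qed

lemma holomorphic_inverse_exists:
  assumes "f holomorphic_on S" "open S" "inj_on f S"
  shows "\<exists>g. g holomorphic_on f ` S \<and> (\<forall>z\<in>S. deriv f z * deriv g (f z) = 1) \<and> (\<forall>z\<in>S. g (f z) = z)"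
  by (rule holomorphic_has_inverse[OF assms]) auto

section \<open>Sheets of the uniformization and maps preserving its fibres\<close>

locale orbifold =
  fixes Y :: "sphere set" and b :: "sphere \<Rightarrow> enat" and L :: ode and \<pi> :: "complex \<Rightarrow> sphere"
  assumes finite_Y: "finite Y" and b_ge: "\<And>y. y \<in> Y \<Longrightarrow> 2 \<le> b y"
    and unif: "orbifold_uniformization Y b \<pi>"
    and fst_L: "fst L = (\<lambda>x. 0)"
    and snd_L: "\<And>D w x. developing_branch \<pi> D w \<Longrightarrow> x \<in> D \<Longrightarrow> snd L x = - schwarzian w x"
begin

abbreviation weight :: "sphere \<Rightarrow> enat" where "weight \<equiv> orbifold_weight Y b"
abbreviation \<H> :: "complex set" where "\<H> \<equiv> upper_half_plane"

lemma weight_pos: "weight y = enat n \<Longrightarrow> n > 0"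
  using b_ge[of y] by (cases "y \<in> Y") (auto simp: orbifold_weight_def one_enat_def numeral_eq_enat)

lemma weight_1: "y \<notin> Y \<Longrightarrow> weight y = enat 1"
  by (simp add: orbifold_weight_def one_enat_def)

lemma pi_image: "\<pi> ` \<H> = - {y \<in> Y. b y = \<infinity>}"
  using unif unfolding orbifold_uniformization_def by blast

lemma weight_pi:
  assumes "\<tau> \<in> \<H>" obtains n where "weight (\<pi> \<tau>) = enat n"
proof -
  have "\<pi> \<tau> \<in> \<pi> ` \<H>" using assms by (rule imageI)
  then have "\<not> (\<pi> \<tau> \<in> Y \<and> b (\<pi> \<tau>) = \<infinity>)"
    unfolding pi_image by simp
  then have "weight (\<pi> \<tau>) \<noteq> \<infinity>"
    by (simp add: orbifold_weight_def one_enat_def)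
  then show ?thesis using that by (cases "weight (\<pi> \<tau>)") auto
qed

text \<open>One sheet of the local model, with the inverse \<psi> of \<phi> and the fact \<psi>'
  \<noteq> 0 carried along, because branches of the developing map are built from \<psi>.\<close>

definition local_sheet :: "sphere \<Rightarrow> nat \<Rightarrow> real \<Rightarrow> complex set \<Rightarrow> (complex \<Rightarrow> complex) \<Rightarrow> (complex \<Rightarrow> complex) \<Rightarrow> bool" where
  "local_sheet y n r V \<phi> \<psi> \<longleftrightarrow> open V \<and> V \<subseteq> \<H> \<and> \<phi> holomorphic_on V \<and> \<psi> holomorphic_on ball 0 1 \<and>
     (\<forall>\<tau>\<in>V. \<phi> \<tau> \<in> ball 0 1 \<and> \<psi> (\<phi> \<tau>) = \<tau>) \<and> (\<forall>s\<in>ball 0 1. \<psi> s \<in> V \<and> \<phi> (\<psi> s) = s \<and> deriv \<psi> s \<noteq> 0) \<and>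
     (\<forall>\<tau>\<in>V. \<pi> \<tau> = chart y (of_real r * \<phi> \<tau> ^ n))"

lemma local_sheetD:
  assumes "local_sheet y n r V \<phi> \<psi>"
  shows "open V" "V \<subseteq> \<H>" "\<phi> holomorphic_on V" "\<psi> holomorphic_on ball 0 1"
    "\<And>\<tau>. \<tau> \<in> V \<Longrightarrow> \<phi> \<tau> \<in> ball 0 1" "\<And>\<tau>. \<tau> \<in> V \<Longrightarrow> \<psi> (\<phi> \<tau>) = \<tau>"
    "\<And>s. s \<in> ball 0 1 \<Longrightarrow> \<psi> s \<in> V" "\<And>s. s \<in> ball 0 1 \<Longrightarrow> \<phi> (\<psi> s) = s"
    "\<And>s. s \<in> ball 0 1 \<Longrightarrow> deriv \<psi> s \<noteq> 0"
    "\<And>\<tau>. \<tau> \<in> V \<Longrightarrow> \<pi> \<tau> = chart y (of_real r * \<phi> \<tau> ^ n)"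
  using assms unfolding local_sheet_def by blast+

lemma local_sheets:
  assumes "weight y = enat n"
  obtains r \<V> where "r > 0" "\<Union>\<V> = {\<tau> \<in> \<H>. \<pi> \<tau> \<in> chart y ` ball 0 r}" "pairwise disjnt \<V>"
    "\<forall>V\<in>\<V>. \<exists>\<phi> \<psi>. local_sheet y n r V \<phi> \<psi>"
proof -
  obtain r \<V> where r: "r > 0" "\<Union>\<V> = {\<tau> \<in> \<H>. \<pi> \<tau> \<in> chart y ` ball 0 r}" "pairwise disjnt \<V>"
    "\<forall>V\<in>\<V>. open V \<and> (\<exists>\<phi>. \<phi> holomorphic_on V \<and> bij_betw \<phi> V (ball 0 1) \<and>
                (\<forall>\<tau>\<in>V. \<pi> \<tau> = chart y (of_real r * \<phi> \<tau> ^ n)))"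
    using unif[unfolded orbifold_uniformization_def, THEN conjunct2, rule_format, OF assms]
    by (elim exE conjE) rule
  have "\<exists>\<phi> \<psi>. local_sheet y n r V \<phi> \<psi>" if V: "V \<in> \<V>" for V
  proof -
    obtain \<phi> where \<phi>: "open V" "\<phi> holomorphic_on V" "bij_betw \<phi> V (ball 0 1)"
      "\<forall>\<tau>\<in>V. \<pi> \<tau> = chart y (of_real r * \<phi> \<tau> ^ n)"
      using r(4) V by blast
    have inj: "inj_on \<phi> V" and im: "\<phi> ` V = ball 0 1"
      using \<phi>(3) by (auto simp: bij_betw_def)
    obtain \<psi> where \<psi>: "\<psi> holomorphic_on \<phi> ` V" "\<forall>z\<in>V. deriv \<phi> z * deriv \<psi> (\<phi> z) = 1" "\<forall>z\<in>V. \<psi> (\<phi> z) = z"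
      using holomorphic_inverse_exists[OF \<phi>(2,1) inj] by (elim exE conjE) rule
    have 1: "\<psi> s \<in> V \<and> \<phi> (\<psi> s) = s \<and> deriv \<psi> s \<noteq> 0" if s: "s \<in> ball 0 1" for s
    proof -
      have "s \<in> \<phi> ` V" using s im by simp
      then obtain z where z: "z \<in> V" "s = \<phi> z" by (rule imageE)
      then show ?thesis using bspec[OF \<psi>(2) z(1)] bspec[OF \<psi>(3) z(1)] by auto
    qed
    have 2: "V \<subseteq> \<H>" using V r(2) by blast
    have 3: "\<phi> \<tau> \<in> ball 0 1" if "\<tau> \<in> V" for \<tau> using im that by blast
    show ?thesis
      unfolding local_sheet_def using \<phi>(1,2,4) \<psi>(1,3) 1 2 3
      by (intro exI[of _ \<phi>] exI[of _ \<psi>]) (simp add: im)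
  qed
  then show ?thesis using that[OF r(1-3)] by simp
qed

text \<open>With the disc centred at \<pi> \<tau> itself, injectivity of the chart forces \<phi>
  \<tau> to be 0.\<close>

lemma sheet_at:
  assumes "\<tau> \<in> \<H>" "weight (\<pi> \<tau>) = enat n"
  obtains r V \<phi> \<psi> where "r > 0" "local_sheet (\<pi> \<tau>) n r V \<phi> \<psi>" "\<tau> \<in> V" "\<phi> \<tau> = 0"
proof -
  obtain r \<V> where r: "r > 0" "\<Union>\<V> = {\<tau>' \<in> \<H>. \<pi> \<tau>' \<in> chart (\<pi> \<tau>) ` ball 0 r}" "pairwise disjnt \<V>"
    "\<forall>V\<in>\<V>. \<exists>\<phi> \<psi>. local_sheet (\<pi> \<tau>) n r V \<phi> \<psi>"
    using local_sheets[OF assms(2)] .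
  have "\<pi> \<tau> = chart (\<pi> \<tau>) 0" by simp
  then have "\<pi> \<tau> \<in> chart (\<pi> \<tau>) ` ball 0 r" using r(1) by (metis centre_in_ball imageI)
  then have "\<tau> \<in> \<Union>\<V>" unfolding r(2) using assms(1) by simp
  then obtain V where V: "V \<in> \<V>" "\<tau> \<in> V" by blast
  obtain \<phi> \<psi> where s: "local_sheet (\<pi> \<tau>) n r V \<phi> \<psi>" using bspec[OF r(4) V(1)] by auto
  then have "chart (\<pi> \<tau>) (of_real r * \<phi> \<tau> ^ n) = chart (\<pi> \<tau>) 0"
    using local_sheetD(10)[OF s V(2)] by simp
  then have "of_real r * \<phi> \<tau> ^ n = 0" by (rule injD[OF inj_chart])
  then have "\<phi> \<tau> = 0" using r(1) by auto
  then show ?thesis by (rule that[OF r(1) s V(2)])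
qed

lemma sheet_over:
  assumes "weight y = enat n"
  obtains r V \<phi> \<psi> where "r > 0" "local_sheet y n r V \<phi> \<psi>"
proof -
  have "y \<notin> {y \<in> Y. b y = \<infinity>}" using assms by (auto simp: orbifold_weight_def split: if_splits)
  then have "y \<in> \<pi> ` \<H>" unfolding pi_image by simp
  then obtain \<tau> where \<tau>: "\<tau> \<in> \<H>" "\<pi> \<tau> = y" by (elim imageE) auto
  have w: "weight (\<pi> \<tau>) = enat n" using assms by (simp only: \<tau>(2))
  obtain r V \<phi> \<psi> where s: "r > 0" "local_sheet (\<pi> \<tau>) n r V \<phi> \<psi>" "\<tau> \<in> V" "\<phi> \<tau> = 0"
    using sheet_at[OF \<tau>(1) w] .
  from s(2) show ?thesis unfolding \<tau>(2) by (rule that[OF s(1)])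
qed

text \<open>In the local models a fibre preserving map is s \<mapsto> \<zeta> s with \<zeta>^n = 1,
  and this rotation is defined on the whole sheet V, which does not depend on the map. Agreement on
  some smaller open set is enough, since the identity theorem will spread it.\<close>

lemma local_lift:
  assumes p: "p \<in> \<H>"
  obtains V where "open V" "p \<in> V" "V \<subseteq> \<H>"
    "\<forall>C h. open C \<and> connected C \<and> C \<noteq> {} \<and> C \<subseteq> V \<and> h holomorphic_on C \<and> h ` C \<subseteq> \<H> \<and>
      (\<forall>\<tau>\<in>C. \<pi> (h \<tau>) = \<pi> \<tau>) \<longrightarrow>
      (\<exists>\<theta> C'. \<theta> holomorphic_on V \<and> \<theta> ` V \<subseteq> \<H> \<and> (\<forall>\<tau>\<in>V. \<pi> (\<theta> \<tau>) = \<pi> \<tau>) \<and>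
        open C' \<and> C' \<noteq> {} \<and> C' \<subseteq> C \<and> (\<forall>\<tau>\<in>C'. h \<tau> = \<theta> \<tau>))"
proof -
  define y where "y = \<pi> p"
  obtain n where n: "weight y = enat n" unfolding y_def using weight_pi[OF p] .
  have npos: "n > 0" using weight_pos[OF n] .
  obtain r \<V> where r: "r > 0" "\<Union>\<V> = {\<tau> \<in> \<H>. \<pi> \<tau> \<in> chart y ` ball 0 r}" "pairwise disjnt \<V>"
    "\<forall>V\<in>\<V>. \<exists>\<phi> \<psi>. local_sheet y n r V \<phi> \<psi>"
    using local_sheets[OF n] .
  have "y = chart y 0" by simp
  then have "\<pi> p \<in> chart y ` ball 0 r" unfolding y_def[symmetric] using r(1) by (metis centre_in_ball imageI)
  then have "p \<in> \<Union>\<V>" unfolding r(2) using p by simp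
  then obtain V where V: "V \<in> \<V>" "p \<in> V" by blast
  obtain \<phi> \<psi> where s: "local_sheet y n r V \<phi> \<psi>" using bspec[OF r(4) V(1)] by auto
  note sD = local_sheetD[OF s]
  note V' = sD(1,2)
  have lift: "\<exists>\<theta> C'. \<theta> holomorphic_on V \<and> \<theta> ` V \<subseteq> \<H> \<and> (\<forall>\<tau>\<in>V. \<pi> (\<theta> \<tau>) = \<pi> \<tau>) \<and>
        open C' \<and> C' \<noteq> {} \<and> C' \<subseteq> C \<and> (\<forall>\<tau>\<in>C'. h \<tau> = \<theta> \<tau>)"
    if C: "open C" "connected C" "C \<noteq> {}" "C \<subseteq> V" and h: "h holomorphic_on C" "h ` C \<subseteq> \<H>" "\<forall>\<tau>\<in>C. \<pi> (h \<tau>) = \<pi> \<tau>"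
    for C h
  proof -
    have "h ` C \<subseteq> \<Union>\<V>"
    proof
      fix x assume "x \<in> h ` C"
      then obtain \<tau> where \<tau>: "\<tau> \<in> C" "x = h \<tau>" by blast
      then have "\<tau> \<in> \<Union>\<V>" using C(4) V(1) by blast
      then have "\<pi> \<tau> \<in> chart y ` ball 0 r" unfolding r(2) by simp
      then show "x \<in> \<Union>\<V>" unfolding r(2) using \<tau> h(2,3) by auto
    qed
    have conn: "connected (h ` C)"
      using C(2) h(1) by (intro connected_continuous_image holomorphic_on_imp_continuous_on)
    obtain \<tau>0 where \<tau>0: "\<tau>0 \<in> C" using C(3) by auto
    then obtain V2 where V2: "V2 \<in> \<V>" "h \<tau>0 \<in> V2" using \<open>h ` C \<subseteq> \<Union>\<V>\<close> by blast
    have op: "open W" if "W \<in> \<V>" for W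
      using bspec[OF r(4) that] local_sheetD(1) by blast
    \<comment> \<open>The image of C is connected and the sheets are open and disjoint, so it stays
      in one of them.\<close>
    have "h ` C \<subseteq> V2"
    proof (rule ccontr)
      assume "\<not> h ` C \<subseteq> V2"
      moreover have "open V2" "open (\<Union>(\<V> - {V2}))" using op V2 by auto
      moreover have "V2 \<inter> \<Union>(\<V> - {V2}) = {}"
        using r(3) V2(1) by (auto simp: pairwise_def disjnt_def)
      moreover have "h ` C \<subseteq> V2 \<union> \<Union>(\<V> - {V2})" using \<open>h ` C \<subseteq> \<Union>\<V>\<close> by blast
      ultimately show False
        using connectedD[OF conn, of V2 "\<Union>(\<V> - {V2})"] \<tau>0 V2(2) by blast
    qed
    obtain \<phi>2 \<psi>2 where s2: "local_sheet y n r V2 \<phi>2 \<psi>2" using bspec[OF r(4) V2(1)] by auto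
    note s2D = local_sheetD[OF s2]
    have pow: "\<phi>2 (h \<tau>) ^ n = \<phi> \<tau> ^ n" if "\<tau> \<in> C" for \<tau>
    proof -
      have "chart y (of_real r * \<phi>2 (h \<tau>) ^ n) = \<pi> (h \<tau>)"
        using s2D(10)[of "h \<tau>"] \<open>h ` C \<subseteq> V2\<close> that by auto
      also have "\<dots> = \<pi> \<tau>" using h(3) that by blast
      also have "\<dots> = chart y (of_real r * \<phi> \<tau> ^ n)"
        using sD(10)[of \<tau>] C(4) that by auto
      finally have "of_real r * \<phi>2 (h \<tau>) ^ n = of_real r * \<phi> \<tau> ^ n"
        by (rule injD[OF inj_chart])
      then show ?thesis using r(1) by simp
    qed
    have "\<phi> holomorphic_on C" using sD(3) C(4) by (rule holomorphic_on_subset)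
    \<comment> \<open>\<psi> 0 is the only zero of \<phi>; it is removed so that the quotient by
      \<phi> makes sense.\<close>
    have "C - {\<psi> 0} \<noteq> {}"
    proof
      assume "C - {\<psi> 0} = {}"
      then have "C = {\<psi> 0}" using C(3) by blast
      then show False using C(1) not_open_singleton by metis
    qed
    then obtain \<tau>1 where \<tau>1: "\<tau>1 \<in> C - {\<psi> 0}" by blast
    have "open (C - {\<psi> 0})" using C(1) by (intro open_Diff) auto
    then obtain d where d: "d > 0" "ball \<tau>1 d \<subseteq> C - {\<psi> 0}" using openE[OF _ \<tau>1] by auto
    let ?C = "ball \<tau>1 d"
    have nz: "\<phi> \<tau> \<noteq> 0" if "\<tau> \<in> ?C" for \<tau>
    proof
      assume "\<phi> \<tau> = 0"
      moreover have "\<tau> \<in> V" using that d(2) C(4) by blast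
      ultimately have "\<psi> 0 = \<tau>" using sD(6)[of \<tau>] by simp
      then show False using that d(2) by blast
    qed
    \<comment> \<open>A continuous function on a ball with values in the finite set of n-th roots of
      unity is constant.\<close>
    let ?\<zeta> = "\<lambda>\<tau>. \<phi>2 (h \<tau>) / \<phi> \<tau>"
    have hol2: "(\<lambda>\<tau>. \<phi>2 (h \<tau>)) holomorphic_on C"
      using holomorphic_on_compose_gen[OF h(1) s2D(3) \<open>h ` C \<subseteq> V2\<close>] by (simp add: o_def)
    have "?\<zeta> holomorphic_on ?C"
      using hol2 \<open>\<phi> holomorphic_on C\<close> nz d(2)
      by (intro holomorphic_on_divide) (auto intro: holomorphic_on_subset)
    then have "continuous_on ?C ?\<zeta>" by (rule holomorphic_on_imp_continuous_on)
    moreover have "?\<zeta> ` ?C \<subseteq> {z. z ^ n = 1}"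
      using pow nz d(2) by (auto simp: power_divide)
    then have "finite (?\<zeta> ` ?C)"
      using finite_roots_unity[of n, where ?'a=complex] npos by (auto intro: finite_subset)
    ultimately have "?\<zeta> constant_on ?C"
      by (intro continuous_finite_range_constant connected_ball)
    then obtain \<zeta> where \<zeta>: "\<And>\<tau>. \<tau> \<in> ?C \<Longrightarrow> \<phi>2 (h \<tau>) / \<phi> \<tau> = \<zeta>"
      unfolding constant_on_def by auto
    have "\<tau>1 \<in> ?C" using d(1) by simp
    then have "\<zeta> ^ n = 1"
      using \<zeta>[of \<tau>1] \<open>?\<zeta> ` ?C \<subseteq> {z. z ^ n = 1}\<close> by blast
    then have "norm \<zeta> ^ n = 1" by (metis norm_one norm_power)
    then have n\<zeta>: "norm \<zeta> = 1" using npos power_eq_imp_eq_base[of "norm \<zeta>" n 1] by simp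
    define \<theta> where "\<theta> = (\<lambda>\<tau>. \<psi>2 (\<zeta> * \<phi> \<tau>))"
    have in1: "\<zeta> * \<phi> \<tau> \<in> ball 0 1" if "\<tau> \<in> V" for \<tau>
    proof -
      have "\<phi> \<tau> \<in> ball 0 1" using sD(5) that .
      then show ?thesis using n\<zeta> by (simp add: norm_mult)
    qed
    show ?thesis
    proof (intro exI conjI)
      have "(\<lambda>\<tau>. \<zeta> * \<phi> \<tau>) holomorphic_on V"
        using sD(3) by (intro holomorphic_intros)
      then show "\<theta> holomorphic_on V"
        unfolding \<theta>_def using s2D(4) in1
        by (intro holomorphic_on_compose_gen[of _ V \<psi>2 "ball 0 1", unfolded o_def]) auto
      have \<theta>V: "\<theta> \<tau> \<in> V2 \<and> \<phi>2 (\<theta> \<tau>) = \<zeta> * \<phi> \<tau>" if "\<tau> \<in> V" for \<tau>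
        using s2D(7,8)[OF in1[OF that]] unfolding \<theta>_def by simp
      show "\<theta> ` V \<subseteq> \<H>" using \<theta>V s2D(2) by blast
      show "\<forall>\<tau>\<in>V. \<pi> (\<theta> \<tau>) = \<pi> \<tau>"
      proof
        fix \<tau> assume \<tau>: "\<tau> \<in> V"
        have "\<pi> (\<theta> \<tau>) = chart y (of_real r * (\<zeta> * \<phi> \<tau>) ^ n)"
          using \<theta>V[OF \<tau>] s2D(10)[of "\<theta> \<tau>"] by simp
        also have "\<dots> = chart y (of_real r * \<phi> \<tau> ^ n)"
          using \<open>\<zeta> ^ n = 1\<close> by (simp add: power_mult_distrib)
        also have "\<dots> = \<pi> \<tau>" using sD(10)[OF \<tau>] by simp
        finally show "\<pi> (\<theta> \<tau>) = \<pi> \<tau>" .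
      qed
      show "open ?C" "?C \<noteq> {}" "?C \<subseteq> C" using d by auto
      show "\<forall>\<tau>\<in>?C. h \<tau> = \<theta> \<tau>"
      proof
        fix \<tau> assume \<tau>: "\<tau> \<in> ?C"
        have "\<phi>2 (h \<tau>) = \<zeta> * \<phi> \<tau>" using \<zeta>[OF \<tau>] nz[OF \<tau>] by (simp add: field_simps)
        moreover have "h \<tau> \<in> V2" using \<tau> d(2) \<open>h ` C \<subseteq> V2\<close> by blast
        ultimately show "h \<tau> = \<theta> \<tau>" using s2D(6)[of "h \<tau>"] unfolding \<theta>_def by simp
      qed
    qed
  qed
  show ?thesis
    by (intro that[OF V'(1) V(2) V'(2)] allI impI) (elim conjE, rule lift)
qed

text \<open>A Moebius transformation that locally permutes the fibres of \<open>\<pi>\<close> preserves the upper half plane: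
  the set where it does so is closed in the half plane by the identity theorem and the local models.\<close>

lemma deck_moebius:
  assumes det: "a * d - c' * c \<noteq> 0"
    and C0: "open C0" "C0 \<noteq> {}" "C0 \<subseteq> \<H>"
    and M: "\<And>\<tau>. \<tau> \<in> C0 \<Longrightarrow> c * \<tau> + d \<noteq> 0 \<and> (a * \<tau> + c') / (c * \<tau> + d) \<in> \<H> \<and> \<pi> ((a * \<tau> + c') / (c * \<tau> + d)) = \<pi> \<tau>"
    and \<tau>: "\<tau> \<in> \<H>"
  shows "c * \<tau> + d \<noteq> 0" "(a * \<tau> + c') / (c * \<tau> + d) \<in> \<H>"
proof -
  define P where "P \<tau> \<longleftrightarrow> \<tau> \<in> \<H> \<and> c * \<tau> + d \<noteq> 0 \<and> (a * \<tau> + c') / (c * \<tau> + d) \<in> \<H> \<and> \<pi> ((a * \<tau> + c') / (c * \<tau> + d)) = \<pi> \<tau>" for \<tau>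
  define G where "G = interior {\<tau>. P \<tau>}"
  have GP: "P \<tau>" if "\<tau> \<in> G" for \<tau> using that interior_subset unfolding G_def by blast
  have oG: "open G" unfolding G_def by simp
  have GH: "G \<subseteq> \<H>" using GP unfolding P_def by blast
  have "C0 \<subseteq> G" unfolding G_def using C0 M by (intro interior_maximal) (auto simp: P_def)
  have step: "p \<in> G" if p: "p \<in> \<H>" "p \<in> closure G" for p
  proof -
    obtain V where V: "open V" "p \<in> V" "V \<subseteq> \<H>"
      "\<forall>C h. open C \<and> connected C \<and> C \<noteq> {} \<and> C \<subseteq> V \<and> h holomorphic_on C \<and> h ` C \<subseteq> \<H> \<and>
      (\<forall>\<tau>\<in>C. \<pi> (h \<tau>) = \<pi> \<tau>) \<longrightarrow>
      (\<exists>\<theta> C'. \<theta> holomorphic_on V \<and> \<theta> ` V \<subseteq> \<H> \<and> (\<forall>\<tau>\<in>V. \<pi> (\<theta> \<tau>) = \<pi> \<tau>) \<and>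
        open C' \<and> C' \<noteq> {} \<and> C' \<subseteq> C \<and> (\<forall>\<tau>\<in>C'. h \<tau> = \<theta> \<tau>))"
      using local_lift[OF p(1)] .
    obtain \<epsilon> where \<epsilon>: "\<epsilon> > 0" "ball p \<epsilon> \<subseteq> V" using openE[OF V(1,2)] .
    have "ball p \<epsilon> \<inter> G \<noteq> {}"
      using p(2) \<epsilon>(1) open_Int_closure_eq_empty[of "ball p \<epsilon>" G] centre_in_ball[of p \<epsilon>]
      by (metis IntI empty_iff open_ball)
    then obtain \<tau>1 where \<tau>1: "\<tau>1 \<in> ball p \<epsilon> \<inter> G" by blast
    have "open (ball p \<epsilon> \<inter> G)" using oG by auto
    then obtain \<delta> where \<delta>: "\<delta> > 0" "ball \<tau>1 \<delta> \<subseteq> ball p \<epsilon> \<inter> G" using openE[OF _ \<tau>1] by auto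
    let ?h = "\<lambda>\<tau>. (a * \<tau> + c') / (c * \<tau> + d)"
    have Pb: "P \<tau>" if "\<tau> \<in> ball \<tau>1 \<delta>" for \<tau> using that \<delta>(2) GP by blast
    have "?h holomorphic_on ball \<tau>1 \<delta>"
      using Pb unfolding P_def by (intro holomorphic_intros) auto
    moreover have "?h ` ball \<tau>1 \<delta> \<subseteq> \<H>" "\<forall>\<tau>\<in>ball \<tau>1 \<delta>. \<pi> (?h \<tau>) = \<pi> \<tau>"
      using Pb unfolding P_def by auto
    moreover have "ball \<tau>1 \<delta> \<subseteq> V" "ball \<tau>1 \<delta> \<noteq> {}" using \<delta> \<epsilon>(2) by auto
    ultimately obtain \<theta> C' where \<theta>: "\<theta> holomorphic_on V" "\<theta> ` V \<subseteq> \<H>" "\<forall>\<tau>\<in>V. \<pi> (\<theta> \<tau>) = \<pi> \<tau>"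
       "open C'" "C' \<noteq> {}" "C' \<subseteq> ball \<tau>1 \<delta>" "\<forall>\<tau>\<in>C'. ?h \<tau> = \<theta> \<tau>"
      using spec[OF spec[OF V(4), of "ball \<tau>1 \<delta>"], of ?h] by auto
    \<comment> \<open>Stated without denominators, because c \<tau> + d is not yet known to be
      nonzero on the whole ball.\<close>
    have eq: "a * \<tau> + c' = \<theta> \<tau> * (c * \<tau> + d)" if \<tau>: "\<tau> \<in> ball p \<epsilon>" for \<tau>
    proof (rule analytic_continuation_open[of C' "ball p \<epsilon>" "\<lambda>\<tau>. a * \<tau> + c'" "\<lambda>\<tau>. \<theta> \<tau> * (c * \<tau> + d)"])
      show "(\<lambda>\<tau>. a * \<tau> + c') holomorphic_on ball p \<epsilon>"
        by (intro holomorphic_intros)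
      show "(\<lambda>\<tau>. \<theta> \<tau> * (c * \<tau> + d)) holomorphic_on ball p \<epsilon>"
        using \<theta>(1) \<epsilon>(2) by (intro holomorphic_intros) (auto intro: holomorphic_on_subset)
      show "C' \<subseteq> ball p \<epsilon>" using \<theta>(6) \<delta>(2) by blast
      show "a * z + c' = \<theta> z * (c * z + d)" if "z \<in> C'" for z
      proof -
        have "c * z + d \<noteq> 0" using that \<theta>(6) Pb unfolding P_def by auto
        moreover have "?h z = \<theta> z" using that \<theta>(7) by auto
        ultimately show ?thesis by (simp add: field_simps)
      qed
    qed (use \<theta>(4,5) \<tau> in auto)
    have "P \<tau>" if \<tau>: "\<tau> \<in> ball p \<epsilon>" for \<tau>
    proof -
      \<comment> \<open>A zero of the denominator would be a zero of the numerator as well, which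
        the determinant excludes.\<close>
      have nz: "c * \<tau> + d \<noteq> 0"
      proof
        assume 0: "c * \<tau> + d = 0"
        then have 1: "a * \<tau> + c' = 0" using eq[OF \<tau>] by simp
        have "a * d - c' * c = a * (c * \<tau> + d) - c * (a * \<tau> + c')" by (simp add: algebra_simps)
        then show False using det by (simp only: 0 1 mult_zero_right diff_self)
      qed
      have "?h \<tau> = \<theta> \<tau>" using eq[OF \<tau>] nz by simp
      moreover have "\<tau> \<in> V" using \<tau> \<epsilon>(2) by blast
      ultimately show ?thesis
        unfolding P_def using nz \<theta>(2,3) V(3) by auto
    qed
    then have "ball p \<epsilon> \<subseteq> G" unfolding G_def by (intro interior_maximal) auto
    then show "p \<in> G" using \<epsilon>(1) by auto
  qed
  have "connected \<H>" using convex_halfspace_Im_gt convex_connected by blast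
  moreover have "openin (top_of_set \<H>) G" using oG GH by (simp add: open_subset)
  moreover have "closedin (top_of_set \<H>) G"
  proof -
    have "G = \<H> \<inter> closure G" using step GH closure_subset by blast
    then show ?thesis by (metis closed_closure closedin_closed)
  qed
  moreover have "G \<noteq> {}" using \<open>C0 \<subseteq> G\<close> C0(2) by blast
  ultimately have "G = \<H>" unfolding connected_clopen by blast
  then have "P \<tau>" using \<tau> GP by blast
  then show "c * \<tau> + d \<noteq> 0" "(a * \<tau> + c') / (c * \<tau> + d) \<in> \<H>" unfolding P_def by auto
qed

text \<open>L is tied only to branches over plane domains, whereas v is a lift along g and may be
  multivalued as a function of x. Near s0 the map g is injective, so v o g^(-1) is a genuine branch
  there, and \<open>schwarzian_compose\<close> applies.\<close>

lemma eqn_pullback_branch: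
  assumes S: "open S" "s0 \<in> S" and g: "g holomorphic_on S" "deriv g s0 \<noteq> 0"
    and v: "v holomorphic_on S" "deriv v s0 \<noteq> 0" "v ` S \<subseteq> \<H>"
    and lift: "\<And>s. s \<in> S \<Longrightarrow> \<pi> (v s) = Fin (g s)"
  shows "snd L (g s0) * (deriv g s0)\<^sup>2 = schwarzian g s0 - schwarzian v s0"
proof -
  obtain r where r: "r > 0" "ball s0 r \<subseteq> S" "inj_on g (ball s0 r)"
    using has_complex_derivative_locally_injective[OF g(1) S(2,1) g(2)] .
  let ?B = "ball s0 r"
  have gB: "g holomorphic_on ?B" "v holomorphic_on ?B" using g(1) v(1) r(2) by (auto intro: holomorphic_on_subset)
  have s0: "s0 \<in> ?B" using r(1) by simp
  obtain \<sigma> where \<sigma>: "\<sigma> holomorphic_on g ` ?B" "\<And>z. z \<in> ?B \<Longrightarrow> \<sigma> (g z) = z"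
    using holomorphic_inverse_exists[OF gB(1) open_ball r(3)] by (elim exE conjE) simp
  have oB: "open (g ` ?B)" using open_mapping_thm3[OF gB(1) open_ball r(3)] .
  define w where "w = (\<lambda>x. v (\<sigma> x))"
  have \<sigma>B: "\<sigma> ` (g ` ?B) \<subseteq> ?B" using \<sigma>(2) by auto
  have hw: "w holomorphic_on g ` ?B"
    unfolding w_def using holomorphic_on_compose_gen[OF \<sigma>(1) gB(2) \<sigma>B] by (simp add: o_def)
  have wg: "w (g s) = v s" if "s \<in> ?B" for s using \<sigma>(2)[OF that] by (simp add: w_def)
  have "developing_branch \<pi> (g ` ?B) w"
    unfolding developing_branch_def
  proof (intro conjI ballI)
    have "w ` g ` ?B = v ` ?B" using wg by (simp add: image_image)
    also have "\<dots> \<subseteq> \<H>" using v(3) r(2) by (meson image_mono order_trans)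
    finally show "w ` g ` ?B \<subseteq> \<H>" .
    show "\<pi> (w x) = Fin x" if x: "x \<in> g ` ?B" for x
    proof -
      from x obtain s where "s \<in> ?B" "x = g s" by (rule imageE)
      then show ?thesis using wg[of s] lift[of s] r(2) by auto
    qed
  qed (use oB hw in auto)
  then have q: "snd L (g s0) = - schwarzian w (g s0)"
    using snd_L s0 by blast
  have "deriv v s0 = deriv (\<lambda>s. w (g s)) s0"
    using wg r(1) by (intro deriv_cong_ev refl) (auto simp: eventually_nhds intro!: exI[of _ ?B])
  also have "\<dots> = deriv w (g s0) * deriv g s0"
    using s0 by (intro DERIV_imp_deriv DERIV_chain2 holomorphic_derivI[OF hw oB] holomorphic_derivI[OF gB(1) open_ball]) auto
  finally have "deriv w (g s0) \<noteq> 0" using v(2) by auto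
  then have "schwarzian (\<lambda>x. w (g x)) s0 = schwarzian w (g s0) * (deriv g s0)\<^sup>2 + schwarzian g s0"
    using schwarzian_compose[OF open_ball gB(1) s0 g(2) oB hw] by simp
  moreover have "schwarzian (\<lambda>x. w (g x)) s0 = schwarzian v s0"
    using wg s0 by (intro schwarzian_cong[of ?B]) auto
  ultimately show ?thesis unfolding q by (simp add: algebra_simps)
qed

end

section \<open>Development and exponents over points of finite weight\<close>

context orbifold
begin

text \<open>With e = m n one has t^e U = r (t^m h)^n, where h is an n-th root of U/r. Hence v =
  \<psi>(t^m h) lifts g through a sheet and is single valued, and v' has order m - 1.\<close>

lemma finite_point_development:
  assumes w: "weight y = enat n" and U: "ramified_coordinate e U" and dvd: "n dvd e"
  shows "\<exists>v V. developed_coordinate e U v V (int (e div n) - 1) \<and> v analytic_on {0} \<and>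
    (\<forall>\<^sub>F t in at 0. deriv v t = t powi (int (e div n) - 1) * V t) \<and>
    (\<forall>\<^sub>F t in at 0. snd L (ramified_coordinate.g y e U t) * (deriv (ramified_coordinate.g y e U) t)\<^sup>2
       = schwarzian (ramified_coordinate.g y e U) t - schwarzian v t)"
proof -
  interpret R: ramified_coordinate y e U by (rule U)
  define m where "m = e div n"
  have n: "n > 0" using weight_pos[OF w] .
  have e: "e = m * n" using dvd by (simp add: m_def)
  have m: "m > 0" using R.e e by (cases m) auto
  obtain r V0 \<phi> \<psi> where r: "r > 0" and s: "local_sheet y n r V0 \<phi> \<psi>" using sheet_over[OF w] .
  note sD = local_sheetD[OF s]
  have "(\<lambda>t. U t / of_real r) analytic_on {0}" "U 0 / of_real r \<noteq> 0"
    using R.U r by (auto intro!: analytic_intros)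
  then obtain d l where d: "d > 0" "(\<lambda>t. U t / of_real r) holomorphic_on ball 0 d" "l holomorphic_on ball 0 d"
     "\<And>t. t \<in> ball 0 d \<Longrightarrow> U t / of_real r = exp (l t)"
    by (rule log_near_nonzero) blast
  define h where "h = (\<lambda>t. exp (l t / of_nat n))"
  have hh: "h holomorphic_on ball 0 d"
    unfolding h_def using d(3) n by (intro holomorphic_intros) auto
  have hU: "of_real r * h t ^ n = U t" if "t \<in> ball 0 d" for t
  proof -
    have "h t ^ n = exp (of_nat n * (l t / of_nat n))"
      unfolding h_def by (rule exp_of_nat_mult[symmetric])
    also have "\<dots> = U t / of_real r" using n d(4)[OF that] by simp
    finally show ?thesis using r by simp
  qed
  have "h analytic_on {0}"
    using analytic_at_0I[OF hh d(1)] .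
  \<comment> \<open>The lifted coordinate t^m h has again the form t^m times a unit, so the same
    locale supplies its derivative.\<close>
  then interpret P: ramified_coordinate y m h
    by unfold_locales (auto simp: h_def m)
  have evP: "\<forall>\<^sub>F t in nhds 0. norm (P.T t) < 1"
  proof -
    have "(P.T \<longlongrightarrow> 0) (nhds 0)"
      using tendsto_nhds_analytic[OF P.T_analytic] P.T_0 by simp
    then show ?thesis using tendstoD[of P.T 0 "nhds 0" 1] by simp
  qed
  define v where "v = (\<lambda>t. \<psi> (P.T t))"
  define V where "V = (\<lambda>t. deriv \<psi> (P.T t) * P.N t)"
  have small: "\<forall>\<^sub>F r in at_right 0. v holomorphic_on ball 0 r \<and> V holomorphic_on ball 0 r \<and>
     (\<forall>t\<in>ball 0 r. deriv v t = t powi (int m - 1) * V t) \<and> (\<forall>t\<in>ball 0 r. V t \<noteq> 0) \<and> R.good r \<and>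
     (\<forall>t\<in>ball 0 r. v t \<in> \<H> \<and> \<pi> (v t) = chart y (R.T t))"
    using P.small_good R.small_good small_nhds[OF evP] eventually_at_right_real[OF d(1)]
  proof eventually_elim
    case (elim x)
    have T1: "P.T ` ball 0 x \<subseteq> ball 0 1" using elim(3) by auto
    have hd: "deriv \<psi> holomorphic_on ball 0 1" using sD(4) by (intro holomorphic_deriv) auto
    have v: "v holomorphic_on ball 0 x"
      unfolding v_def using holomorphic_on_compose_gen[OF P.T_holomorphic[OF elim(1)] sD(4) T1] by (simp add: o_def)
    have dV: "(\<lambda>t. deriv \<psi> (P.T t)) holomorphic_on ball 0 x"
      using holomorphic_on_compose_gen[OF P.T_holomorphic[OF elim(1)] hd T1] by (simp add: o_def)
    have V: "V holomorphic_on ball 0 x"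
      unfolding V_def using dV P.N_holomorphic[OF elim(1)] by (intro holomorphic_intros)
    have "deriv v t = t powi (int m - 1) * V t \<and> V t \<noteq> 0 \<and> v t \<in> \<H> \<and> \<pi> (v t) = chart y (R.T t)"
      if t: "t \<in> ball 0 x" for t
    proof -
      have Tt: "P.T t \<in> ball 0 1" using bspec[OF elim(3) t] by simp
      have "(v has_field_derivative deriv \<psi> (P.T t) * (t ^ (m - 1) * P.N t)) (at t)"
        unfolding v_def
        by (rule DERIV_chain2[OF holomorphic_derivI[OF sD(4) open_ball Tt] P.deriv_T[OF elim(1) t]])
      moreover have "t powi (int m - 1) = t ^ (m - 1)"
        using m by (simp add: power_int_def nat_diff_distrib)
      ultimately have 1: "deriv v t = t powi (int m - 1) * V t"
        by (simp add: DERIV_imp_deriv V_def)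
      have 2: "V t \<noteq> 0" using sD(9)[OF Tt] elim(1) t by (simp add: V_def P.good_def)
      have 3: "v t \<in> V0" "\<phi> (v t) = P.T t" using sD(7,8)[OF Tt] by (simp_all add: v_def)
      have "t \<in> ball 0 d" using t elim(4) by auto
      then have "of_real r * P.T t ^ n = R.T t"
      proof -
        have "t ^ e = (t ^ m) ^ n" by (simp add: e power_mult)
        then show ?thesis
          using hU[OF \<open>t \<in> ball 0 d\<close>] unfolding P.T_def R.T_def by (simp add: power_mult_distrib algebra_simps)
      qed
      then have "\<pi> (v t) = chart y (R.T t)" using sD(10)[OF 3(1)] 3(2) by simp
      then show ?thesis using 1 2 3 sD(2) by blast
    qed
    then show ?case using v V elim(2) by blast
  qed
  then obtain r0 where r0: "r0 > 0" "v holomorphic_on ball 0 r0 \<and> V holomorphic_on ball 0 r0 \<and>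
     (\<forall>t\<in>ball 0 r0. deriv v t = t powi (int m - 1) * V t) \<and> (\<forall>t\<in>ball 0 r0. V t \<noteq> 0) \<and> R.good r0 \<and>
     (\<forall>t\<in>ball 0 r0. v t \<in> \<H> \<and> \<pi> (v t) = chart y (R.T t))"
    by (rule small_radius)
  have an: "f analytic_on {0}" if "f holomorphic_on ball 0 r0" for f :: "complex \<Rightarrow> complex"
    using analytic_at_0I[OF that r0(1)] .
  have "developed_coordinate e U v V (int m - 1)"
  proof unfold_locales
    show "V analytic_on {0}" using an r0(2) by blast
    show "V 0 \<noteq> 0" using r0 by simp
    show "\<forall>\<^sub>F r in at_right 0. v holomorphic_on ball 0 r - \<real>\<^sub>\<le>\<^sub>0 \<and> (\<forall>t\<in>ball 0 r - \<real>\<^sub>\<le>\<^sub>0. deriv v t = t powi (int m - 1) * V t)"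
      using small by (rule eventually_mono) (auto intro: holomorphic_on_subset)
  qed
  moreover have "v analytic_on {0}" using an r0(2) by blast
  moreover have "\<forall>\<^sub>F t in at 0. deriv v t = t powi (int m - 1) * V t"
    by (rule eventually_at_ball[OF r0(1)]) (use r0(2) in auto)
  moreover have "\<forall>\<^sub>F t in at 0. snd L (R.g t) * (deriv R.g t)\<^sup>2 = schwarzian R.g t - schwarzian v t"
  proof (rule eventually_at_ball[OF r0(1)])
    fix t :: complex assume t: "t \<in> ball 0 r0 - {0}"
    have good: "R.good r0" using r0(2) by blast
    show "snd L (R.g t) * (deriv R.g t)\<^sup>2 = schwarzian R.g t - schwarzian v t"
    proof (rule eqn_pullback_branch[of "ball 0 r0 - {0}"])
      show "deriv R.g t \<noteq> 0" using R.deriv_g[OF good t] R.G_nonzero[OF good, of t] t by simp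
      show "R.g holomorphic_on ball 0 r0 - {0}" using R.g_holomorphic[OF good] .
      show "deriv v t \<noteq> 0" using r0(2) t by auto
      show "v holomorphic_on ball 0 r0 - {0}" using r0(2) by (auto intro: holomorphic_on_subset)
      show "v ` (ball 0 r0 - {0}) \<subseteq> \<H>" using r0(2) by blast
      show "\<pi> (v x) = Fin (R.g x)" if "x \<in> ball 0 r0 - {0}" for x
        using r0(2) that chart_nonzero[OF R.T_nonzero[OF good that]] by (simp add: R.g_def)
    qed (use t in auto)
  qed
  ultimately show ?thesis unfolding m_def by blast
qed

text \<open>Over a point of weight 1 the rescaled \<psi> is an unramified branch on a full disc, and
  the coefficient is minus its Schwarzian.\<close>

lemma snd_L_analytic: "snd L analytic_on {x. Fin x \<notin> Y}"
  unfolding analytic_on_def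
proof
  fix x assume "x \<in> {x. Fin x \<notin> Y}"
  then have w: "weight (Fin x) = enat 1" by (simp add: weight_1)
  obtain r V0 \<phi> \<psi> where r: "r > 0" and s: "local_sheet (Fin x) 1 r V0 \<phi> \<psi>" using sheet_over[OF w] .
  note sD = local_sheetD[OF s]
  define w where "w = (\<lambda>z. \<psi> ((z - x) / of_real r))"
  have in1: "(z - x) / of_real r \<in> ball 0 1" if "z \<in> ball x r" for z
    using that r by (simp add: dist_norm norm_divide norm_minus_commute)
  have w: "w holomorphic_on ball x r"
    unfolding w_def using sD(4) in1 r
    by (intro holomorphic_on_compose_gen[of _ "ball x r" \<psi> "ball 0 1", unfolded o_def] holomorphic_intros) auto
  have dw: "deriv w z \<noteq> 0" if "z \<in> ball x r" for z
  proof -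
    have "(w has_field_derivative deriv \<psi> ((z - x) / of_real r) * (1 / of_real r)) (at z)"
      unfolding w_def using in1[OF that] r
      by (intro DERIV_chain2 holomorphic_derivI[OF sD(4) open_ball]) (auto intro!: derivative_eq_intros)
    then show ?thesis using sD(9)[OF in1[OF that]] r by (simp add: DERIV_imp_deriv)
  qed
  have "developing_branch \<pi> (ball x r) w"
    unfolding developing_branch_def
  proof (intro conjI ballI)
    show "w ` ball x r \<subseteq> \<H>"
    proof (rule image_subsetI)
      fix z assume "z \<in> ball x r"
      from sD(7)[OF in1[OF this]] sD(2) show "w z \<in> \<H>" unfolding w_def by blast
    qed
    show "\<pi> (w z) = Fin z" if "z \<in> ball x r" for z
      using sD(7,8)[OF in1[OF that]] sD(10)[of "w z"] r by (simp add: w_def)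
  qed (use w in auto)
  then have "snd L z = - schwarzian w z" if "z \<in> ball x r" for z
    using snd_L that by blast
  moreover have "(\<lambda>z. - schwarzian w z) holomorphic_on ball x r"
    using schwarzian_holomorphic[OF open_ball w dw] by (intro holomorphic_intros)
  ultimately have "snd L holomorphic_on ball x r"
    by (metis (no_types, lifting) holomorphic_transform)
  then show "\<exists>e>0. snd L holomorphic_on ball x e" using r by blast
qed

text \<open>Equals x^2 times the coefficient of u in the equation L written in the coordinate at y;
  its limit at 0 fixes the exponent difference of L at y.\<close>

definition local_potential :: "sphere \<Rightarrow> complex \<Rightarrow> complex" where
  "local_potential y x = x\<^sup>2 * (snd L (param y x) * (deriv (param y) x)\<^sup>2)"

lemma eventually_param_notin_Y: "\<forall>\<^sub>F x in at 0. Fin (param y x) \<notin> Y"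
proof -
  have "finite (chart y -` Y)" using finite_Y inj_chart by (rule finite_vimageI)
  from eventually_notin_finite[OF this, of 0]
  have "\<forall>\<^sub>F x in at 0. x \<notin> chart y -` Y \<and> x \<noteq> 0"
    by (intro eventually_conj) (auto simp: eventually_at_filter)
  then show ?thesis by (rule eventually_mono) (auto simp: chart_nonzero)
qed

lemma small_local_potential: "\<forall>\<^sub>F r in at_right 0. local_potential y holomorphic_on ball 0 r - {0}"
  using small_at[OF eventually_param_notin_Y]
proof (rule eventually_mono)
  fix r assume r: "\<forall>x\<in>ball 0 r - {0}. Fin (param y x) \<notin> Y"
  have p: "param y holomorphic_on ball 0 r - {0}" by (rule holomorphic_param)
  have "(\<lambda>x. snd L (param y x)) holomorphic_on ball 0 r - {0}"
    using holomorphic_on_compose_gen[OF p analytic_imp_holomorphic[OF snd_L_analytic]] r by (auto simp: o_def)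
  then show "local_potential y holomorphic_on ball 0 r - {0}"
    unfolding local_potential_def[abs_def] using p by (intro holomorphic_intros) auto
qed

text \<open>As \<open>Y\<close> is finite, 0 is an isolated singularity, so the existence of a limit
  already gives an analytic extension.\<close>

lemma extends_to_local_potential:
  assumes "(local_potential y \<longlongrightarrow> c) (at 0)"
  shows "extends_to (local_potential y) c"
proof -
  obtain r where r: "r > 0" "local_potential y holomorphic_on ball 0 r - {0}"
    using small_local_potential by (rule small_radius)
  from removable_singularity[OF r(2) open_ball assms]
  have "(\<lambda>x. if x = 0 then c else local_potential y x) holomorphic_on ball 0 r" .
  then have "(\<lambda>x. if x = 0 then c else local_potential y x) analytic_on {0}"
    using r(1) by (rule analytic_at_0I)
  then show ?thesis
    by (rule extends_toI) (auto simp: eventually_at_filter)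
qed

text \<open>For e = n and U = 1 one has j = 0, hence F 0 = (n^2 - 1)/4; the substitution x = t^n
  brings in the factor n^2, which is divided out.\<close>

lemma finite_point_potential:
  assumes w: "weight y = enat n"
  shows "extends_to (local_potential y) ((1 - 1 / (of_nat n)\<^sup>2) / 4)"
proof (rule extends_to_local_potential)
  have n: "n > 0" using weight_pos[OF w] .
  interpret R: ramified_coordinate y n "\<lambda>_. 1"
    using n by unfold_locales auto
  obtain v V where dc: "developed_coordinate n (\<lambda>_. 1) v V 0" and va: "v analytic_on {0}" and
    dv: "\<forall>\<^sub>F t in at 0. deriv v t = t powi 0 * V t" and
    ev: "\<forall>\<^sub>F t in at 0. snd L (R.g t) * (deriv R.g t)\<^sup>2 = schwarzian R.g t - schwarzian v t"
    using finite_point_development[OF w R.ramified_coordinate_axioms] n by auto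
  interpret D: developed_coordinate y n "\<lambda>_. 1" v V 0 by (rule dc)
  have "(D.F \<longlongrightarrow> D.F 0) (at 0)"
    using analytic_at_imp_isCont[OF D.F_analytic] isCont_def by blast
  moreover have "D.F 0 = ((of_nat n)\<^sup>2 - 1) / 4"
    using D.F_0 by simp
  moreover obtain r where r: "r > 0" "R.good r" "\<forall>t\<in>ball 0 r - {0}. deriv v t = t powi 0 * V t" "v holomorphic_on ball 0 r" "V holomorphic_on ball 0 r"
      "\<forall>t\<in>ball 0 r. V t \<noteq> 0"
      "\<forall>t\<in>ball 0 r - {0}. snd L (R.g t) * (deriv R.g t)\<^sup>2 = schwarzian R.g t - schwarzian v t"
    using eventually_conj[OF R.small_good eventually_conj[OF small_at[OF dv] eventually_conj[OF small_holomorphic[OF va]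
      eventually_conj[OF small_holomorphic[OF D.V(1)] eventually_conj[OF small_nhds[OF eventually_nhds_nonzero[OF D.V]] small_at[OF ev]]]]]]
    by (rule small_radius) (elim conjE, rule)
  have pot: "local_potential y (t ^ n) = D.F t / (of_nat n)\<^sup>2" if t: "t \<in> ball 0 r - {0}" for t
  proof -
    have t0: "t \<in> ball 0 r - {0}" "t \<noteq> 0" using t by auto
    have "t\<^sup>2 * (schwarzian R.g t - schwarzian v t) = D.F t"
      using t r(3,6) holomorphic_on_subset[OF r(4), of "ball 0 r - {0}"] holomorphic_on_subset[OF r(5), of "ball 0 r - {0}"]
      by (intro D.F_eq[OF r(2), of "ball 0 r - {0}"]) auto
    then have 1: "t\<^sup>2 * (snd L (R.g t) * (deriv R.g t)\<^sup>2) = D.F t"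
      using bspec[OF r(7) t0(1)] by simp
    have N: "R.N t = of_nat n" by (simp add: R.N_def)
    have "deriv R.g t = deriv (param y) (t ^ n) * (t ^ (n - 1) * of_nat n)"
      using R.deriv_g_T[OF r(2) t0(1)] by (simp add: N R.T_def)
    moreover have "t * (t ^ (n - 1) * of_nat n) = t ^ n * of_nat n" using n by (simp add: power_eq_if)
    ultimately have 2: "t * deriv R.g t = deriv (param y) (t ^ n) * (t ^ n * of_nat n)"
      by (metis mult.left_commute)
    have "t\<^sup>2 * (snd L (R.g t) * (deriv R.g t)\<^sup>2) = snd L (R.g t) * (t * deriv R.g t)\<^sup>2"
      by (simp add: power_mult_distrib algebra_simps)
    also have "\<dots> = local_potential y (t ^ n) * (of_nat n)\<^sup>2"
      unfolding 2 by (simp add: local_potential_def R.g_def R.T_def power_mult_distrib algebra_simps)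
    finally show ?thesis using 1 n by simp
  qed
  ultimately have lim: "((\<lambda>t. D.F t / (of_nat n)\<^sup>2) \<longlongrightarrow> (((of_nat n)\<^sup>2 - 1) / 4) / (of_nat n)\<^sup>2) (at 0)"
    by (intro tendsto_divide) (use n in auto)
  have c: "(((of_nat n)\<^sup>2 - 1) / 4) / (of_nat n)\<^sup>2 = (1 - 1 / (of_nat n)\<^sup>2) / (4::complex)"
    using n by (simp add: field_simps)
  show "(local_potential y \<longlongrightarrow> (1 - 1 / (of_nat n)\<^sup>2) / 4) (at 0)"
  proof (rule tendstoI)
    fix \<epsilon> :: real assume "\<epsilon> > 0"
    then have "\<forall>\<^sub>F t in at 0. dist (D.F t / (of_nat n)\<^sup>2) ((1 - 1 / (of_nat n)\<^sup>2) / 4) < \<epsilon>"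
      using tendstoD[OF lim] unfolding c by blast
    then obtain \<delta> where \<delta>: "\<delta> > 0" "\<forall>t\<in>ball 0 \<delta> - {0}. dist (D.F t / (of_nat n)\<^sup>2) ((1 - 1 / (of_nat n)\<^sup>2) / 4) < \<epsilon>"
      by (rule small_radius[OF small_at])
    define \<rho> where "\<rho> = min \<delta> r"
    have \<rho>: "\<rho> > 0" using \<delta>(1) r(1) by (simp add: \<rho>_def)
    show "\<forall>\<^sub>F x in at 0. dist (local_potential y x) ((1 - 1 / (of_nat n)\<^sup>2) / 4) < \<epsilon>"
    proof (rule eventually_at_ball[of "\<rho> ^ n"])
      fix x :: complex assume x: "x \<in> ball 0 (\<rho> ^ n) - {0}"
      \<comment> \<open>Every small x is the n-th power of a small t, so the limit along t^n is the
        limit in x.\<close>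
      define t where "t = exp (Ln x / of_nat n)"
      have tn: "t ^ n = x"
        using n x by (simp add: t_def flip: exp_of_nat_mult)
      have "norm t ^ n < \<rho> ^ n" using x tn by (simp flip: norm_power)
      then have "norm t < \<rho>" using \<rho> power_less_imp_less_base by fastforce
      moreover have "t \<noteq> 0" by (simp add: t_def)
      ultimately have t: "t \<in> ball 0 r - {0}" "t \<in> ball 0 \<delta> - {0}"
        by (auto simp: \<rho>_def)
      show "dist (local_potential y x) ((1 - 1 / (of_nat n)\<^sup>2) / 4) < \<epsilon>"
        using \<delta>(2) t(2) pot[OF t(1)] by (simp add: tn)
    qed (use \<rho> in simp)
  qed
qed

end

subsection \<open>Functions on a left half plane with monodromy\<close>

abbreviation left_half_plane :: "real \<Rightarrow> complex set" where
  "left_half_plane c \<equiv> {s. Re s < c}"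

abbreviation period :: complex where "period \<equiv> 2 * of_real pi * \<i>"

lemma exp_period [simp]: "exp (s + period) = exp s"
  by (simp add: exp_add)

lemma open_left: "open (left_half_plane c)"
  by (rule open_halfspace_Re_lt)

lemma exp_in_ball: "exp s \<in> ball 0 (exp c) \<longleftrightarrow> s \<in> left_half_plane c"
  by simp

lemma Ln_left:
  assumes "T \<in> ball 0 (exp c) - {0}"
  shows "exp (Ln T) = T" "Ln T \<in> left_half_plane c"
proof -
  show T: "exp (Ln T) = T" using assms by simp
  show "Ln T \<in> left_half_plane c" unfolding exp_in_ball[symmetric] T using assms by simp
qed

lemma periodic_int:
  assumes "\<And>s. s \<in> left_half_plane c \<Longrightarrow> F (s + period) = F s" "s \<in> left_half_plane c"
  shows "F (s + of_int n * period) = F s"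
proof -
  have nat: "F (s + of_nat n * period) = F s" if "s \<in> left_half_plane c" for n s
  proof (induction n)
    case (Suc n)
    have "s + of_nat n * period \<in> left_half_plane c" using that by simp
    from assms(1)[OF this] Suc show ?case by (simp add: algebra_simps)
  qed simp
  show ?thesis
  proof (cases "n \<ge> 0")
    case True
    then show ?thesis using nat[OF assms(2), of "nat n"] by simp
  next
    case False
    have "s + of_int n * period \<in> left_half_plane c" using assms(2) by simp
    from nat[OF this, of "nat (- n)"] False show ?thesis by simp
  qed
qed

text \<open>The descended function is F o Ln: periodicity makes the jump of \<open>Ln\<close>
  invisible, and near each point \<open>Ln\<close> may be exchanged for a holomorphic
  logarithm.\<close>

lemma periodic_descends:
  assumes F: "F holomorphic_on left_half_plane c"
    and per: "\<And>s. s \<in> left_half_plane c \<Longrightarrow> F (s + period) = F s"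
  shows "\<exists>h. h holomorphic_on ball 0 (exp c) - {0} \<and> (\<forall>s\<in>left_half_plane c. F s = h (exp s))"
proof -
  define h where "h = (\<lambda>T. F (Ln T))"
  have hF: "h T = F s" if T: "exp s = T" and s: "s \<in> left_half_plane c" for s T
  proof -
    have "T \<noteq> 0" using T by auto
    then have "exp (Ln T) = exp s" using T by simp
    then obtain n :: int where "Ln T = s + (of_int (2 * n) * pi) * \<i>" unfolding exp_eq by blast
    then have "Ln T = s + of_int n * period" by (simp add: algebra_simps)
    then show ?thesis using periodic_int[of c F, OF per s, of n] by (simp add: h_def)
  qed
  have "h holomorphic_on ball 0 (exp c) - {0}"
  proof (rule analytic_imp_holomorphic, unfold analytic_on_def, rule ballI)
    fix T0 :: complex assume T0: "T0 \<in> ball 0 (exp c) - {0}"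
    have "open (ball 0 (exp c) - {0} :: complex set)" by auto
    then obtain e where e: "e > 0" "ball T0 e \<subseteq> ball 0 (exp c) - {0}"
      using openE[OF _ T0] by auto
    have ball: "(\<lambda>T. T) holomorphic_on ball T0 e" "contractible (ball T0 e)" "\<And>T. T \<in> ball T0 e \<Longrightarrow> T \<noteq> 0"
      using subsetD[OF e(2)] by (auto simp: convex_imp_contractible simp del: mem_ball)
    have "\<exists>l. l holomorphic_on ball T0 e \<and> (\<forall>T\<in>ball T0 e. exp (l T) = T)"
    proof (rule contractible_imp_holomorphic_log[OF ball])
      fix l assume "l holomorphic_on ball T0 e" "\<And>T. T \<in> ball T0 e \<Longrightarrow> T = exp (l T)"
      then show ?thesis by (intro exI[of _ l] conjI ballI) simp_all
    qed
    then obtain l where l: "l holomorphic_on ball T0 e" "\<And>T. T \<in> ball T0 e \<Longrightarrow> exp (l T) = T"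
      by auto
    have lc: "l T \<in> left_half_plane c" if "T \<in> ball T0 e" for T
      using l(2)[OF that] e(2) that exp_in_ball[of "l T" c] by (metis Diff_iff subsetD)
    have "(\<lambda>T. F (l T)) holomorphic_on ball T0 e"
      using holomorphic_on_compose_gen[OF l(1) F] lc by (auto simp: o_def image_subset_iff)
    moreover have "h T = F (l T)" if "T \<in> ball T0 e" for T
      using hF[OF l(2)[OF that] lc[OF that]] .
    ultimately have "h holomorphic_on ball T0 e"
      using holomorphic_cong[OF refl, of "ball T0 e" h "\<lambda>T. F (l T)"] by blast
    then show "\<exists>e>0. h holomorphic_on ball T0 e" using e(1) by blast
  qed
  then show ?thesis using hF by (intro exI[of _ h]) auto
qed

lemma bounded_periodic_extends:
  assumes F: "F holomorphic_on left_half_plane c"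
    and per: "\<And>s. s \<in> left_half_plane c \<Longrightarrow> F (s + period) = F s"
    and bd: "\<And>s. s \<in> left_half_plane c \<Longrightarrow> norm (F s) \<le> B"
  shows "\<exists>h. h holomorphic_on ball 0 (exp c) \<and> (\<forall>s\<in>left_half_plane c. F s = h (exp s))"
proof -
  obtain h where h: "h holomorphic_on ball 0 (exp c) - {0}" "\<forall>s\<in>left_half_plane c. F s = h (exp s)"
    using periodic_descends[OF F per] by blast
  have "norm (h T) \<le> B" if "T \<in> ball 0 (exp c) - {0}" for T
  proof -
    from bd[OF Ln_left(2)[OF that]] bspec[OF h(2) Ln_left(2)[OF that]] Ln_left(1)[OF that] show ?thesis by simp
  qed
  then have "\<forall>\<^sub>F T in at 0. norm (h T) \<le> B"
    by (intro eventually_at_ball[of "exp c"]) auto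
  moreover have "0 \<in> interior (ball 0 (exp c) :: complex set)" by simp
  ultimately obtain g where g: "g holomorphic_on ball 0 (exp c)" "\<forall>T\<in>ball 0 (exp c) - {0}. g T = h T"
    using holomorphic_on_extend_bounded[OF h(1)] by blast
  have "F s = g (exp s)" if "s \<in> left_half_plane c" for s
    using bspec[OF h(2) that] bspec[OF g(2), of "exp s"] exp_in_ball[of s c] that by simp
  then show ?thesis using g(1) by blast
qed

lemma connected_left: "connected (left_half_plane c)"
  using convex_halfspace_Re_lt convex_connected by blast

text \<open>exp \<Lambda> is periodic and bounded, so it descends to a holomorphic h on the full
  disc that can vanish only at 0. If h = T^n u with u 0 \<noteq> 0, then \<Lambda> is n s + log
  u(exp s) up to a constant, and the increment over one period gives \<epsilon> = n. The half plane
  shrinks to where u has a logarithm.\<close>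

lemma exp_type_periodic:
  fixes \<epsilon> :: int
  assumes \<Lambda>: "\<Lambda> holomorphic_on left_half_plane c"
    and per: "\<And>s. s \<in> left_half_plane c \<Longrightarrow> \<Lambda> (s + period) = \<Lambda> s + of_int \<epsilon> * period"
    and bd: "\<And>s. s \<in> left_half_plane c \<Longrightarrow> Re (\<Lambda> s) \<le> B"
  shows "\<epsilon> \<ge> 0 \<and> (\<exists>c'\<le>c. \<exists>l. l holomorphic_on ball 0 (exp c') \<and>
           (\<forall>s\<in>left_half_plane c'. \<Lambda> s = of_int \<epsilon> * s + l (exp s)))"
proof -
  define E where "E = (\<lambda>s. exp (\<Lambda> s))"
  have hE: "E holomorphic_on left_half_plane c" unfolding E_def using \<Lambda> by (intro holomorphic_intros)
  have pE: "E (s + period) = E s" if "s \<in> left_half_plane c" for s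
  proof -
    have "exp (of_int \<epsilon> * period) = 1"
      using exp_integer_2pi[of "of_int \<epsilon>"] by (simp add: algebra_simps)
    then show ?thesis by (simp add: E_def per[OF that] exp_add)
  qed
  have bE: "norm (E s) \<le> exp B" if "s \<in> left_half_plane c" for s
    using bd[OF that] by (simp add: E_def)
  obtain h where h: "h holomorphic_on ball 0 (exp c)" "\<forall>s\<in>left_half_plane c. E s = h (exp s)"
    using bounded_periodic_extends[OF hE pE bE] by blast
  have hnz: "h T \<noteq> 0" if "T \<in> ball 0 (exp c) - {0}" for T
  proof -
    from bspec[OF h(2) Ln_left(2)[OF that]] Ln_left(1)[OF that] show ?thesis by (auto simp: E_def)
  qed
  have "\<exists>n u r. r > 0 \<and> r \<le> exp c \<and> u holomorphic_on ball 0 r \<and> u 0 \<noteq> 0 \<and> (\<forall>T\<in>ball 0 r. h T = T ^ n * u T)"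
  proof (cases "h 0 = 0")
    case False
    then show ?thesis using h(1) by (intro exI[of _ 0] exI[of _ h] exI[of _ "exp c"]) auto
  next
    case True
    have nc: "\<not> h constant_on ball 0 (exp c)"
    proof
      assume "h constant_on ball 0 (exp c)"
      then obtain k where k: "\<And>T. T \<in> ball 0 (exp c) \<Longrightarrow> h T = k" unfolding constant_on_def by auto
      have "of_real (exp c / 2) \<in> ball 0 (exp c) - {0 :: complex}"
        by (simp add: norm_divide)
      with hnz k k[of 0] True show False by (metis Diff_iff centre_in_ball exp_gt_zero)
    qed
    show ?thesis
    proof (rule holomorphic_factor_zero_nonconstant[OF h(1) open_ball connected_ball _ True nc])
      fix g r n
      assume *: "0 < (n::nat)" "0 < r" "ball 0 r \<subseteq> ball (0::complex) (exp c)" "g holomorphic_on ball 0 r"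
       "\<And>w. w \<in> ball 0 r \<Longrightarrow> h w = (w - 0) ^ n * g w" "\<And>w. w \<in> ball 0 r \<Longrightarrow> g w \<noteq> 0"
      have "r \<le> exp c" using *(2,3) by (simp add: ball_subset_ball_iff)
      moreover have "g 0 \<noteq> 0" using *(2,6) by simp
      moreover have "\<forall>T\<in>ball 0 r. h T = T ^ n * g T" using *(5) by simp
      ultimately show ?thesis using *(2,4) by blast
    qed simp
  qed
  then obtain n u r where u: "r > 0" "r \<le> exp c" "u holomorphic_on ball 0 r" "u 0 \<noteq> 0" "\<forall>T\<in>ball 0 r. h T = T ^ n * u T"
    by blast
  have "u analytic_on {0}"
    using analytic_at_0I[OF u(3,1)] .
  then obtain d l where d: "d > 0" "u holomorphic_on ball 0 d" "l holomorphic_on ball 0 d" "\<And>t. t \<in> ball 0 d \<Longrightarrow> u t = exp (l t)"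
    using u(4) by (rule log_near_nonzero) blast
  define c' where "c' = ln (min d r)"
  have ec': "exp c' = min d r" using d(1) u(1) by (simp add: c'_def)
  have "exp c' \<le> exp c" unfolding ec' using u(2) by linarith
  then have c': "c' \<le> c" by simp
  define D where "D = (\<lambda>s. \<Lambda> s - of_nat n * s - l (exp s))"
  have in': "exp s \<in> ball 0 d" "exp s \<in> ball 0 r" "s \<in> left_half_plane c" if "s \<in> left_half_plane c'" for s
    using that exp_in_ball[of s c'] c' unfolding ec' by auto
  have hD: "D holomorphic_on left_half_plane c'"
    unfolding D_def using c' in' d(3)
    by (intro holomorphic_intros holomorphic_on_compose_gen[of exp _ l "ball 0 d", unfolded o_def])
       (auto intro: holomorphic_on_subset[OF \<Lambda>])
  have expD: "exp (D s) = 1" if s: "s \<in> left_half_plane c'" for s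
  proof -
    have "exp (\<Lambda> s) = exp s ^ n * exp (l (exp s))"
      using bspec[OF h(2) in'(3)[OF s]] bspec[OF u(5) in'(2)[OF s]] d(4)[OF in'(1)[OF s]] by (simp add: E_def)
    then show ?thesis by (simp add: D_def exp_diff exp_of_nat_mult)
  qed
  have "(D has_field_derivative 0) (at s)" if s: "s \<in> left_half_plane c'" for s
  proof -
    have dD: "(D has_field_derivative deriv D s) (at s)"
      using holomorphic_derivI[OF hD open_left s] .
    have "((\<lambda>s. exp (D s)) has_field_derivative exp (D s) * deriv D s) (at s)"
      by (rule DERIV_chain2[OF DERIV_exp dD])
    moreover have "((\<lambda>s. exp (D s)) has_field_derivative 0) (at s)"
      by (rule has_field_derivative_transform_within_open[OF DERIV_const open_left s]) (use expD in auto)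
    ultimately have "exp (D s) * deriv D s = 0" by (rule DERIV_unique)
    then show ?thesis using dD by simp
  qed
  then have "D constant_on left_half_plane c'"
    by (intro has_field_derivative_0_imp_constant_on connected_left open_left)
  then obtain k where k: "\<And>s. s \<in> left_half_plane c' \<Longrightarrow> D s = k" unfolding constant_on_def by auto
  define s0 where "s0 = (of_real (c' - 1) :: complex)"
  have s0: "s0 \<in> left_half_plane c'" "s0 + period \<in> left_half_plane c'" by (auto simp: s0_def)
  \<comment> \<open>D is constant, so the surplus of \<epsilon> - n periods must vanish.\<close>
  have "D (s0 + period) = D s0 + (of_int \<epsilon> - of_nat n) * period"
    unfolding D_def per[OF in'(3)[OF s0(1)]] exp_period by (simp add: algebra_simps)
  then have "(of_int \<epsilon> - of_nat n) * period = 0" using k[OF s0(1)] k[OF s0(2)] by simp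
  then have "of_int \<epsilon> = (of_nat n :: complex)" by simp
  then have \<epsilon>: "\<epsilon> = int n" by (metis of_int_eq_iff of_int_of_nat_eq)
  have "\<Lambda> s = of_int \<epsilon> * s + (l (exp s) + k)" if "s \<in> left_half_plane c'" for s
    using k[OF that] by (simp add: D_def \<epsilon> algebra_simps)
  moreover have "(\<lambda>T. l T + k) holomorphic_on ball 0 (exp c')"
    using d(3) unfolding ec' by (intro holomorphic_intros) (auto intro: holomorphic_on_subset)
  ultimately show ?thesis using \<epsilon> c' by (intro conjI exI[of _ c'] exI[of _ "\<lambda>T. l T + k"]) auto
qed

lemma filterlim_exp_at_bot: "filterlim (\<lambda>x. exp (of_real x) :: complex) (nhds 0) at_bot"
proof -
  have "((\<lambda>x. complex_of_real (exp x)) \<longlongrightarrow> of_real 0) at_bot"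
    by (intro tendsto_intros exp_at_bot)
  then show ?thesis by (simp add: exp_of_real)
qed

text \<open>If \<mu> = exp(2 pi i \<theta>) with 0 \<le> \<theta> < 1, then K is exp(\<theta> s)
  times a holomorphic function k of exp s. The limit is 0 for \<theta> > 0 and k 0 for \<theta> =
  0.\<close>

lemma rotation_limit:
  assumes K: "K holomorphic_on left_half_plane c" and \<mu>: "norm \<mu> = 1"
    and per: "\<And>s. s \<in> left_half_plane c \<Longrightarrow> K (s + period) = \<mu> * K s"
    and bd: "\<And>s. s \<in> left_half_plane c \<Longrightarrow> norm (K s) < 1"
  shows "\<exists>\<kappa>. norm \<kappa> < 1 \<and> ((\<lambda>x. K (of_real x)) \<longlongrightarrow> \<kappa>) at_bot"
proof -
  define \<theta> where "\<theta> = Arg2pi \<mu> / (2 * pi)"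
  have \<theta>: "0 \<le> \<theta>" "\<theta> < 1" using Arg2pi[of \<mu>] by (auto simp: \<theta>_def field_simps)
  have \<mu>e: "\<mu> = exp (of_real \<theta> * period)"
    using Arg2pi[of \<mu>] \<mu> by (simp add: is_Arg_def \<theta>_def mult.commute)
  \<comment> \<open>Both exp(-\<theta> s) and exp((1 - \<theta>) s) cancel the multiplier, but only
    the latter stays bounded for every \<theta> in [0, 1). The surplus factor exp s is divided out
    again through h 0 = 0.\<close>
  define F where "F = (\<lambda>s. K s * exp (of_real (1 - \<theta>) * s))"
  have hF: "F holomorphic_on left_half_plane c" unfolding F_def using K by (intro holomorphic_intros)
  have pF: "F (s + period) = F s" if "s \<in> left_half_plane c" for s
  proof -
    have "F (s + period) = \<mu> * K s * (exp (of_real (1 - \<theta>) * s) * (exp period / exp (of_real \<theta> * period)))"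
      unfolding F_def per[OF that] by (simp add: ring_distribs exp_add exp_diff)
    also have "\<dots> = F s" by (simp add: F_def \<mu>e)
    finally show ?thesis .
  qed
  have nF: "norm (F s) \<le> exp ((1 - \<theta>) * Re s)" if "s \<in> left_half_plane c" for s
    using bd[OF that] by (simp add: F_def norm_mult mult_left_le_one_le)
  have bF: "norm (F s) \<le> exp ((1 - \<theta>) * c)" if "s \<in> left_half_plane c" for s
  proof -
    have "(1 - \<theta>) * Re s \<le> (1 - \<theta>) * c" using that \<theta> by (intro mult_left_mono) auto
    then show ?thesis using nF[OF that] by (meson exp_le_cancel_iff order_trans)
  qed
  obtain h where h: "h holomorphic_on ball 0 (exp c)" "\<forall>s\<in>left_half_plane c. F s = h (exp s)"
    using bounded_periodic_extends[OF hF pF bF] by blast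
  have hcont: "(h \<longlongrightarrow> h 0) (nhds 0)"
    using tendsto_nhds_analytic[OF analytic_at_0I[OF h(1)]] by simp
  have evc: "\<forall>\<^sub>F x in at_bot. of_real x \<in> left_half_plane c"
    using eventually_gt_at_bot[of c] by (auto elim: eventually_mono)
  have "((\<lambda>x. F (of_real x)) \<longlongrightarrow> h 0) at_bot"
  proof -
    have "((\<lambda>x. h (exp (of_real x))) \<longlongrightarrow> h 0) at_bot"
      using hcont filterlim_exp_at_bot by (rule filterlim_compose)
    moreover have "\<forall>\<^sub>F x in at_bot. h (exp (of_real x)) = F (of_real x)"
      using evc by (rule eventually_mono) (use h(2) in auto)
    ultimately show ?thesis by (rule Lim_transform_eventually)
  qed
  moreover have "((\<lambda>x. F (of_real x)) \<longlongrightarrow> 0) at_bot"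
  proof (rule Lim_null_comparison)
    show "\<forall>\<^sub>F x in at_bot. norm (F (of_real x)) \<le> exp ((1 - \<theta>) * x)"
      using evc
    proof (rule eventually_mono)
      fix x assume "complex_of_real x \<in> left_half_plane c"
      from nF[OF this] show "norm (F (of_real x)) \<le> exp ((1 - \<theta>) * x)" by simp
    qed
    show "((\<lambda>x. exp ((1 - \<theta>) * x)) \<longlongrightarrow> 0) at_bot"
      using \<theta> by real_asymp
  qed
  ultimately have h0: "h 0 = 0" using tendsto_unique[OF trivial_limit_at_bot_linorder] by blast
  obtain k where k: "k holomorphic_on ball 0 (exp c)" "\<And>z. norm z < exp c \<Longrightarrow> h z = z * k z"
    using Schwarz3[OF h(1) h0] by metis
  have Kk: "K s = exp (of_real \<theta> * s) * k (exp s)" if s: "s \<in> left_half_plane c" for s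
  proof -
    have "K s * exp (of_real (1 - \<theta>) * s) = exp s * k (exp s)"
      using bspec[OF h(2) s] k(2)[of "exp s"] s by (simp add: F_def)
    then have "K s * exp (of_real (1 - \<theta>) * s) = (exp (of_real \<theta> * s) * k (exp s)) * exp (of_real (1 - \<theta>) * s)"
      by (simp add: algebra_simps flip: exp_add)
    then show ?thesis by simp
  qed
  have kcont: "(k \<longlongrightarrow> k 0) (nhds 0)"
    using tendsto_nhds_analytic[OF analytic_at_0I[OF k(1)]] by simp
  have klim: "((\<lambda>x. k (exp (of_real x))) \<longlongrightarrow> k 0) at_bot"
    using kcont filterlim_exp_at_bot by (rule filterlim_compose)
  show ?thesis
  proof (cases "\<theta> = 0")
    case False
    then have \<theta>0: "\<theta> > 0" using \<theta> by simp
    have "((\<lambda>x. exp (\<theta> * x)) \<longlongrightarrow> 0) at_bot" using \<theta>0 by real_asymp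
    then have "((\<lambda>x. of_real (exp (\<theta> * x)) * k (exp (of_real x))) \<longlongrightarrow> of_real 0 * k 0) at_bot"
      by (intro tendsto_intros klim)
    moreover have "\<forall>\<^sub>F x in at_bot. of_real (exp (\<theta> * x)) * k (exp (of_real x)) = K (of_real x)"
      using evc by (rule eventually_mono) (simp add: Kk flip: exp_of_real)
    ultimately have "((\<lambda>x. K (of_real x)) \<longlongrightarrow> of_real 0 * k 0) at_bot"
      by (rule Lim_transform_eventually)
    then show ?thesis by (intro exI[of _ 0]) simp
  next
    case True
    have "\<forall>\<^sub>F x in at_bot. k (exp (of_real x)) = K (of_real x)"
      using evc by (rule eventually_mono) (simp add: Kk True)
    with klim have lim: "((\<lambda>x. K (of_real x)) \<longlongrightarrow> k 0) at_bot"
      by (rule Lim_transform_eventually)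
    have k1: "norm (k T) < 1" if "T \<in> ball 0 (exp c) - {0}" for T
    proof -
      from bd[OF Ln_left(2)[OF that]] Kk[OF Ln_left(2)[OF that]] Ln_left(1)[OF that]
      show ?thesis by (simp add: True)
    qed
    \<comment> \<open>Off the centre the modulus is below 1, so a value of modulus at least 1 at the
      centre would be an interior maximum.\<close>
    have "norm (k 0) < 1"
    proof (rule ccontr)
      assume n: "\<not> norm (k 0) < 1"
      then have "k constant_on ball 0 (exp c)"
        using k1 by (intro maximum_modulus_principle[OF k(1) open_ball connected_ball open_ball order_refl, of 0]) force+
      then obtain q where q: "\<And>T. T \<in> ball 0 (exp c) \<Longrightarrow> k T = q" unfolding constant_on_def by auto
      have "of_real (exp c / 2) \<in> ball 0 (exp c) - {0 :: complex}"
        by (simp add: norm_divide)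
      from k1[OF this] q[of 0] q[of "of_real (exp c / 2)"] this n show False by simp
    qed
    then show ?thesis using lim by blast
  qed
qed

text \<open>For a translation a suitable multiple of V is itself the required logarithm. For
  \<alpha> \<noteq> 1 the hypotheses are contradictory, by the growth of a multiple of log(V - x) at
  the fixed point x.\<close>

lemma affine_monodromy:
  fixes \<alpha> \<beta> :: real
  assumes V: "V holomorphic_on left_half_plane c" "\<And>s. s \<in> left_half_plane c \<Longrightarrow> 0 < Im (V s)"
    and per: "\<And>s. s \<in> left_half_plane c \<Longrightarrow> V (s + period) = of_real \<alpha> * V s + of_real \<beta>"
    and \<alpha>: "\<alpha> > 0" and nid: "\<alpha> \<noteq> 1 \<or> \<beta> \<noteq> 0"
  shows "\<exists>c'\<le>c. \<exists>l \<kappa>. \<kappa> \<noteq> 0 \<and> l holomorphic_on ball 0 (exp c') \<and> (\<forall>s\<in>left_half_plane c'. \<kappa> * V s = s + l (exp s))"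
proof (cases "\<alpha> = 1")
  case True
  then have \<beta>: "\<beta> \<noteq> 0" using nid by simp
  define \<epsilon> :: int where "\<epsilon> = (if \<beta> > 0 then 1 else - 1)"
  \<comment> \<open>Scaling by the modulus of \<beta> gives Re \<Lambda> \<le> 0 for either sign.
    The sign moves into \<epsilon>, and \<open>exp_type_periodic\<close> leaves only \<epsilon> =
    1.\<close>
  define \<Lambda> where "\<Lambda> = (\<lambda>s. period / of_real \<bar>\<beta>\<bar> * V s)"
  have "\<Lambda> holomorphic_on left_half_plane c" unfolding \<Lambda>_def using V(1) by (intro holomorphic_intros)
  moreover have "\<Lambda> (s + period) = \<Lambda> s + of_int \<epsilon> * period" if "s \<in> left_half_plane c" for s
    using \<beta> unfolding \<Lambda>_def per[OF that] by (auto simp: True \<epsilon>_def field_simps)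
  moreover have "Re (\<Lambda> s) \<le> 0" if "s \<in> left_half_plane c" for s
  proof -
    have "Re (\<Lambda> s) = - (2 * pi / \<bar>\<beta>\<bar>) * Im (V s)"
      by (simp add: \<Lambda>_def Re_divide_of_real Im_divide_of_real)
    then show ?thesis using V(2)[OF that] by simp
  qed
  ultimately have *: "\<epsilon> \<ge> 0" "\<exists>c'\<le>c. \<exists>l. l holomorphic_on ball 0 (exp c') \<and>
           (\<forall>s\<in>left_half_plane c'. \<Lambda> s = of_int \<epsilon> * s + l (exp s))"
    using exp_type_periodic[of \<Lambda> c \<epsilon> 0] by auto
  then have "\<epsilon> = 1" by (auto simp: \<epsilon>_def split: if_splits)
  moreover have "period / of_real \<bar>\<beta>\<bar> \<noteq> 0" using \<beta> by simp
  moreover obtain c' l where "c' \<le> c" "l holomorphic_on ball 0 (exp c')" "\<forall>s\<in>left_half_plane c'. \<Lambda> s = of_int \<epsilon> * s + l (exp s)"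
    using *(2) by blast
  ultimately show ?thesis unfolding \<Lambda>_def
    by (intro exI[of _ c'] conjI exI[of _ l] exI[of _ "period / of_real \<bar>\<beta>\<bar>"]) simp_all
next
  case False
  \<comment> \<open>The real fixed point of z \<mapsto> \<alpha> z + \<beta>.\<close>
  define x where "x = \<beta> / (1 - \<alpha>)"
  have "x * (1 - \<alpha>) = \<beta>" using False by (simp add: x_def)
  then have x: "\<beta> = x - \<alpha> * x" by (simp add: algebra_simps)
  define \<Lambda> where "\<Lambda> = (\<lambda>s. period / of_real (ln \<alpha>) * Ln (V s - of_real x))"
  have ln: "ln \<alpha> \<noteq> 0" using False \<alpha> by simp
  have im: "0 < Im (V s - of_real x)" if "s \<in> left_half_plane c" for s
    using V(2)[OF that] by simp
  have np: "V s - of_real x \<notin> \<real>\<^sub>\<le>\<^sub>0" "V s - of_real x \<noteq> 0" if "s \<in> left_half_plane c" for s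
    using im[OF that] by (auto simp: complex_nonpos_Reals_iff simp del: minus_complex.sel)
  have h: "\<Lambda> holomorphic_on left_half_plane c"
    unfolding \<Lambda>_def using V(1) np by (intro holomorphic_intros)
  have p: "\<Lambda> (s + period) = \<Lambda> s + of_int 1 * period" if "s \<in> left_half_plane c" for s
  proof -
    have "V (s + period) - of_real x = of_real \<alpha> * (V s - of_real x)"
      unfolding per[OF that] x by (simp add: algebra_simps)
    then have "Ln (V (s + period) - of_real x) = of_real (ln \<alpha>) + Ln (V s - of_real x)"
      using Ln_times_of_real[OF \<alpha> np(2)[OF that]] Ln_of_real[OF \<alpha>] by simp
    then show ?thesis using ln by (simp add: \<Lambda>_def field_simps)
  qed
  \<comment> \<open>The imaginary part of \<open>Ln\<close> lies between -pi and pi, so Re \<Lambda>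
    is bounded on both sides. The lower bound will contradict \<Lambda> = s + l(exp s) as s tends to
    minus infinity.\<close>
  have re: "\<bar>Re (\<Lambda> s)\<bar> \<le> 2 * pi / \<bar>ln \<alpha>\<bar> * pi" if "s \<in> left_half_plane c" for s
  proof -
    have "Re (\<Lambda> s) = - (2 * pi / ln \<alpha>) * Im (Ln (V s - of_real x))"
      by (simp add: \<Lambda>_def Re_divide_of_real Im_divide_of_real)
    then have "\<bar>Re (\<Lambda> s)\<bar> = 2 * pi / \<bar>ln \<alpha>\<bar> * \<bar>Im (Ln (V s - of_real x))\<bar>"
      by (simp add: abs_mult)
    also have "\<dots> \<le> 2 * pi / \<bar>ln \<alpha>\<bar> * pi"
      using mpi_less_Im_Ln[OF np(2)[OF that]] Im_Ln_le_pi[OF np(2)[OF that]]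
      by (intro mult_left_mono) auto
    finally show ?thesis .
  qed
  obtain c' l where l: "c' \<le> c" "l holomorphic_on ball 0 (exp c')" "\<forall>s\<in>left_half_plane c'. \<Lambda> s = of_int 1 * s + l (exp s)"
    using exp_type_periodic[of \<Lambda> c 1 "2 * pi / \<bar>ln \<alpha>\<bar> * pi", OF h p] abs_le_D1[OF re] by blast
  have "(l \<longlongrightarrow> l 0) (nhds 0)"
    using tendsto_nhds_analytic[OF analytic_at_0I[OF l(2)]] by simp
  then have "((\<lambda>x. l (exp (of_real x))) \<longlongrightarrow> l 0) at_bot"
    using filterlim_exp_at_bot by (rule filterlim_compose)
  then have "((\<lambda>x. Re (l (exp (of_real x)))) \<longlongrightarrow> Re (l 0)) at_bot"
    by (intro tendsto_intros)
  then have "\<forall>\<^sub>F x in at_bot. Re (l (exp (of_real x))) < Re (l 0) + 1"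
    by (rule order_tendstoD(2)) simp
  then have "\<forall>\<^sub>F x in at_bot. Re (l (exp (of_real x))) + x < - (2 * pi / \<bar>ln \<alpha>\<bar> * pi)"
    using eventually_gt_at_bot[of "- (2 * pi / \<bar>ln \<alpha>\<bar> * pi) - (Re (l 0) + 1)"]
    by eventually_elim linarith
  moreover have "\<forall>\<^sub>F x in at_bot. x < c'" by (rule eventually_gt_at_bot)
  ultimately have "\<forall>\<^sub>F x::real in at_bot. False"
  proof eventually_elim
    case (elim x)
    have "complex_of_real x \<in> left_half_plane c'" "complex_of_real x \<in> left_half_plane c" using elim(2) l(1) by auto
    from bspec[OF l(3) this(1)] re[OF this(2)] elim(1) show False by simp
  qed
  then show ?thesis by simp
qed

text \<open>The sign of the discriminant of the fixed point equation decides between a conjugate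
  pair of fixed points, which gives a rotation in the Cayley coordinate, and a real one, which z
  \<mapsto> -1/(z - x) moves to infinity. The entries are complex at first; both half plane
  hypotheses serve to show that their ratios are real.\<close>

lemma real_moebius_classification:
  fixes a b c d :: complex
  assumes det: "a * d - b * c \<noteq> 0"
    and M: "\<And>z. 0 < Im z \<Longrightarrow> c * z + d \<noteq> 0 \<and> 0 < Im ((a * z + b) / (c * z + d))"
    and Minv: "\<And>z. 0 < Im z \<Longrightarrow> 0 < Im ((d * z - b) / (- c * z + a))"
  shows "(\<exists>p \<mu>. 0 < Im p \<and> norm \<mu> = 1 \<and>
      (\<forall>z. 0 < Im z \<longrightarrow> ((a * z + b) / (c * z + d) - p) / ((a * z + b) / (c * z + d) - cnj p) = \<mu> * ((z - p) / (z - cnj p)))) \<or>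
    (\<exists>\<alpha> \<beta> :: real. \<alpha> > 0 \<and> (\<alpha> \<noteq> 1 \<or> \<beta> \<noteq> 0) \<and>
      ((\<forall>z. 0 < Im z \<longrightarrow> (a * z + b) / (c * z + d) = of_real \<alpha> * z + of_real \<beta>) \<or>
       (\<exists>x::real. \<forall>z. 0 < Im z \<longrightarrow> - 1 / ((a * z + b) / (c * z + d) - of_real x) = of_real \<alpha> * (- 1 / (z - of_real x)) + of_real \<beta>)))"
    (is "?ell \<or> ?aff")
proof -
  \<comment> \<open>Im \<ge> 0 holds by continuity from above, and Im > 0 is impossible because the
    inverse would send that point to the real number x.\<close>
  have real: "Im ((a * of_real x + b) / (c * of_real x + d)) = 0" if nz: "c * of_real x + d \<noteq> 0" for x :: real
  proof -
    let ?w = "(a * of_real x + b) / (c * of_real x + d)"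
    have "((\<lambda>\<epsilon>. Im ((a * (of_real x + \<i> * of_real \<epsilon>) + b) / (c * (of_real x + \<i> * of_real \<epsilon>) + d))) \<longlongrightarrow>
        Im ((a * (of_real x + \<i> * of_real 0) + b) / (c * (of_real x + \<i> * of_real 0) + d))) (at_right 0)"
      using nz by (intro tendsto_intros) auto
    moreover have "\<forall>\<^sub>F \<epsilon> in at_right (0::real). 0 \<le> Im ((a * (of_real x + \<i> * of_real \<epsilon>) + b) / (c * (of_real x + \<i> * of_real \<epsilon>) + d))"
      using eventually_at_right_less[of "0::real"]
    proof (rule eventually_mono)
      fix \<epsilon> :: real assume "0 < \<epsilon>"
      then have "0 < Im (of_real x + \<i> * of_real \<epsilon>)" by simp
      from M[OF this] show "0 \<le> Im ((a * (of_real x + \<i> * of_real \<epsilon>) + b) / (c * (of_real x + \<i> * of_real \<epsilon>) + d))"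
        by (meson less_imp_le)
    qed
    ultimately have "0 \<le> Im ?w"
      using tendsto_lowerbound[OF _ _ trivial_limit_at_right_real] by fastforce
    moreover have "\<not> 0 < Im ?w"
    proof
      assume pos: "0 < Im ?w"
      have 1: "d * ?w - b = (a * d - b * c) * of_real x / (c * of_real x + d)"
        using nz by (simp add: field_simps)
      have 2: "- c * ?w + a = (a * d - b * c) / (c * of_real x + d)"
        using nz by (simp add: field_simps)
      have "(d * ?w - b) / (- c * ?w + a) = of_real x"
        unfolding 1 2 using nz det by simp
      with Minv[OF pos] show False by simp
    qed
    ultimately show ?thesis by simp
  qed
  have realE: "\<exists>r. z = of_real r" if "Im z = 0" for z
    using that by (intro exI[of _ "Re z"]) (simp add: complex_eq_iff)
  show ?thesis
  proof (cases "c = 0")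
    case True
    then have d: "d \<noteq> 0" using det by auto
    obtain \<beta> where \<beta>: "b / d = of_real \<beta>" using realE[OF real[of 0]] d True by auto
    obtain r where r: "(a + b) / d = of_real r" using realE[OF real[of 1]] d True by auto
    define \<alpha> where "\<alpha> = r - \<beta>"
    have \<alpha>: "a / d = of_real \<alpha>" using r \<beta> by (simp add: \<alpha>_def add_divide_distrib algebra_simps)
    have Mz: "(a * z + b) / (c * z + d) = of_real \<alpha> * z + of_real \<beta>" for z
      unfolding \<alpha>[symmetric] \<beta>[symmetric] using d by (simp add: True field_simps)
    have "\<alpha> > 0" using M[of \<i>] unfolding Mz by simp
    show ?thesis
    proof (cases "\<alpha> \<noteq> 1 \<or> \<beta> \<noteq> 0")
      case True
      then show ?thesis using Mz \<open>\<alpha> > 0\<close> by blast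
    next
      case False
      then have "(a * z + b) / (c * z + d) = z" for z using Mz by simp
      \<comment> \<open>The identity counts as the rotation about \<open>\<i>\<close> with
        multiplier 1.\<close>
      then show ?thesis by (intro disjI1 exI[of _ \<i>] exI[of _ 1]) simp
    qed
  next
    case False
    define k where "k = (b * c - a * d) / c\<^sup>2"
    have k: "k \<noteq> 0" using det False by (simp add: k_def)
    have form: "(a * z + b) / (c * z + d) = a / c + k / (z + d / c)" if "c * z + d \<noteq> 0" for z
    proof -
      have "z + d / c = (c * z + d) / c" using False by (simp add: add_divide_distrib)
      then have "k / (z + d / c) = (b * c - a * d) / (c * (c * z + d))"
        using False by (simp add: k_def power2_eq_square)
      moreover have "a / c = a * (c * z + d) / (c * (c * z + d))" using that by simp
      ultimately have "a / c + k / (z + d / c) = (c * (a * z + b)) / (c * (c * z + d))"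
        by (simp add: add_divide_distrib[symmetric] algebra_simps)
      then show ?thesis using False by simp
    qed
    have evnz: "\<forall>\<^sub>F x in at_top. c * of_real x + d \<noteq> 0"
      using eventually_gt_at_top[of "Re (- d / c)"]
    proof (rule eventually_mono)
      fix x assume "Re (- d / c) < x"
      then have "of_real x \<noteq> - d / c" by (metis Re_complex_of_real less_irrefl)
      then show "c * of_real x + d \<noteq> 0" using False by (simp add: field_simps add_eq_0_iff)
    qed
    \<comment> \<open>a/c is real as the limit at infinity of values that are real on the real
      axis.\<close>
    have "filterlim (\<lambda>x. d / c + complex_of_real x) at_infinity at_top"
      by (intro tendsto_add_filterlim_at_infinity[OF tendsto_const] filterlim_of_real_at_infinity)
    then have "((\<lambda>x. a / c + k / (d / c + of_real x)) \<longlongrightarrow> a / c + 0) at_top"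
      by (intro tendsto_intros tendsto_divide_0[OF tendsto_const])
    then have "((\<lambda>x. Im (a / c + k / (d / c + of_real x))) \<longlongrightarrow> Im (a / c + 0)) at_top"
      by (rule tendsto_Im)
    moreover have "\<forall>\<^sub>F x in at_top. Im (a / c + k / (d / c + of_real x)) = 0"
      using evnz by (rule eventually_mono) (use real form in \<open>simp add: add.commute\<close>)
    ultimately have "Im (a / c) = 0"
      using tendsto_eventually tendsto_unique[OF trivial_limit_at_top_linorder] by fastforce
    then obtain A where A: "a / c = of_real A" using realE by blast
    \<comment> \<open>This reciprocal is affine in x and real for all large real x, so its slope 1/k
      is real, and then so is d/c.\<close>
    have inv: "Im ((of_real x + d / c) / k) = 0" if "c * of_real x + d \<noteq> 0" for x :: real
    proof -
      have "Im (k / (of_real x + d / c)) = 0" using real[OF that] form[OF that] A by simp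
      then obtain r where "k / (of_real x + d / c) = of_real r" using realE by blast
      then have "(of_real x + d / c) / k = of_real (1 / r)"
        by (metis inverse_divide inverse_eq_divide of_real_inverse)
      then show ?thesis by simp
    qed
    obtain x1 where x1: "\<And>x. x \<ge> x1 \<Longrightarrow> c * of_real x + d \<noteq> 0"
      using evnz unfolding eventually_at_top_linorder by blast
    have "Im (1 / k) = Im ((of_real (x1 + 1) + d / c) / k) - Im ((of_real x1 + d / c) / k)"
      by (simp add: add_divide_distrib)
    then have "Im (1 / k) = 0" using inv[OF x1[of "x1 + 1"]] inv[OF x1[of x1]] by simp
    then obtain r where "1 / k = of_real r" using realE by blast
    then obtain K where K: "k = of_real K" by (metis inverse_eq_divide inverse_inverse_eq of_real_inverse)
    have "K \<noteq> 0" using k K by auto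
    have "Im ((of_real x1 + d / c) / k) = Im (d / c) / K" by (simp add: K Im_divide_of_real)
    then have "Im (d / c) = 0" using inv[OF x1[of x1]] \<open>K \<noteq> 0\<close> by simp
    then obtain D where D: "d / c = of_real D" using realE by blast
    define B where "B = K + A * D"
    have Mz: "(a * z + b) / (c * z + d) = (of_real A * z + of_real B) / (z + of_real D)" and zD: "z + of_real D \<noteq> 0"
      if "0 < Im z" for z
    proof -
      show "z + of_real D \<noteq> 0" using that by (auto simp: complex_eq_iff)
      then show "(a * z + b) / (c * z + d) = (of_real A * z + of_real B) / (z + of_real D)"
        using form[of z] M[OF that] unfolding A D K by (simp add: B_def field_simps)
    qed
    \<comment> \<open>Discriminant of the fixed point equation q^2 = (A - D) q + B.\<close>
    define \<Delta> where "\<Delta> = (A - D)\<^sup>2 + 4 * B"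
    have fixp: "(of_real A * z + of_real B) / (z + of_real D) - q = (of_real A - q) * (z - q) / (z + of_real D)"
      if "q * q = (of_real A - of_real D) * q + of_real B" "0 < Im z" for q z
    proof -
      have "of_real A * z + of_real B - q * (z + of_real D) = (of_real A - q) * (z - q)"
        using that(1) by (simp add: algebra_simps)
      then show ?thesis using zD[OF that(2)] by (simp add: divide_simps)
    qed
    show ?thesis
    proof (cases "\<Delta> < 0")
      case True
      define p where "p = Complex ((A - D) / 2) (sqrt (- \<Delta>) / 2)"
      have imp: "Im p > 0" using True by (simp add: p_def)
      have "sqrt (- \<Delta>) * sqrt (- \<Delta>) = - \<Delta>" using True by simp
      then have pq: "p * p = (of_real A - of_real D) * p + of_real B"
        by (simp add: p_def complex_eq_iff \<Delta>_def power2_eq_square field_simps)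
      then have "cnj (p * p) = cnj ((of_real A - of_real D) * p + of_real B)" by simp
      then have pq': "cnj p * cnj p = (of_real A - of_real D) * cnj p + of_real B" by simp
      \<comment> \<open>Dividing \<open>fixp\<close> for p by \<open>fixp\<close> for the conjugate
        of p cancels z + D and leaves this multiplier.\<close>
      define \<mu> where "\<mu> = (of_real A - p) / (of_real A - cnj p)"
      have nzA: "of_real A - p \<noteq> 0" "of_real A - cnj p \<noteq> 0" using imp by (auto simp: complex_eq_iff)
      have "of_real A - cnj p = cnj (of_real A - p)" by simp
      then have "norm \<mu> = 1" using nzA(1) unfolding \<mu>_def by (simp only: norm_divide complex_mod_cnj) simp
      moreover have "((a * z + b) / (c * z + d) - p) / ((a * z + b) / (c * z + d) - cnj p) = \<mu> * ((z - p) / (z - cnj p))"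
        if z: "0 < Im z" for z
        unfolding Mz[OF z] fixp[OF pq z] fixp[OF pq' z] using zD[OF z] by (simp add: \<mu>_def)
      ultimately show ?thesis using imp by blast
    next
      case False
      define x where "x = ((A - D) + sqrt \<Delta>) / 2"
      have "sqrt \<Delta> * sqrt \<Delta> = \<Delta>" using False by simp
      then have xx: "x * x = (A - D) * x + B"
        by (simp add: x_def \<Delta>_def power2_eq_square field_simps)
      then have xq: "of_real x * of_real x = (of_real A - of_real D) * of_real x + (of_real B :: complex)"
        by (metis of_real_add of_real_diff of_real_mult)
      have Ax: "A - x \<noteq> 0"
      proof
        assume "A - x = 0"
        then have "(of_real A * \<i> + of_real B) / (\<i> + of_real D) = of_real x"
          using fixp[OF xq, of \<i>] by simp
        then show False using M[of \<i>] Mz[of \<i>] by simp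
      qed
      \<comment> \<open>Obtained by writing z + D = (z - x) + (x + D) in -(z + D)/((A - x)(z - x)).
        As \<beta> is never 0, the affine map is not the identity.\<close>
      define \<alpha> where "\<alpha> = (x + D) / (A - x)"
      define \<beta> where "\<beta> = - 1 / (A - x)"
      have eq: "- 1 / ((a * z + b) / (c * z + d) - of_real x) = of_real \<alpha> * (- 1 / (z - of_real x)) + of_real \<beta>"
        if z: "0 < Im z" for z
      proof -
        have zx: "z - of_real x \<noteq> 0" using z by (auto simp: complex_eq_iff)
        have Ax': "of_real A - of_real x \<noteq> (0::complex)" using Ax by (metis of_real_diff of_real_eq_0_iff)
        have alg: "- 1 / (p * u / w) = (w - u) / p * (- 1 / u) + - 1 / p"
          if "p \<noteq> 0" "u \<noteq> 0" "w \<noteq> 0" for p u w :: complex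
          using that by (simp add: field_simps)
        have wu: "(z + of_real D) - (z - of_real x) = of_real x + of_real D" by simp
        show ?thesis unfolding Mz[OF z] fixp[OF xq z] alg[OF Ax' zx zD[OF z]] wu
          by (simp add: \<alpha>_def \<beta>_def)
      qed
      have imneg: "Im (- 1 / (z - of_real x)) > 0" if "0 < Im z" for z
      proof -
        have "Im (- 1 / (z - of_real x)) = Im z / ((Re z - x)\<^sup>2 + (Im z)\<^sup>2)"
          by (simp add: Im_divide)
        also have "\<dots> > 0" using that by (intro divide_pos_pos add_nonneg_pos) auto
        finally show ?thesis .
      qed
      have "0 < Im ((a * \<i> + b) / (c * \<i> + d))" using M[of \<i>] by simp
      moreover have "Im (of_real \<alpha> * w + of_real \<beta>) = \<alpha> * Im w" for w by simp
      moreover have "0 < Im \<i>" by simp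
      ultimately have "0 < \<alpha> * Im (- 1 / (\<i> - of_real x))"
        using imneg[of "(a * \<i> + b) / (c * \<i> + d)"] eq[of \<i>] by metis
      moreover have "0 < Im (- 1 / (\<i> - of_real x))" using imneg[of \<i>] by simp
      ultimately have "\<alpha> > 0" by (metis zero_less_mult_pos2)
      moreover have "\<beta> \<noteq> 0" using Ax by (simp add: \<beta>_def)
      ultimately show ?thesis using eq by blast
    qed
  qed
qed

lemma cayley_norm:
  assumes "0 < Im p" "0 < Im z"
  shows "z - cnj p \<noteq> 0" "norm ((z - p) / (z - cnj p)) < 1"
proof -
  show nz: "z - cnj p \<noteq> 0" using assms by (auto simp: complex_eq_iff)
  have "(norm (z - p))\<^sup>2 = (norm (z - cnj p))\<^sup>2 - 4 * Im z * Im p"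
    unfolding cmod_power2 by (simp add: power2_eq_square algebra_simps)
  also have "\<dots> < (norm (z - cnj p))\<^sup>2" using assms by simp
  finally have "norm (z - p) < norm (z - cnj p)" by (rule power2_less_imp_less) simp
  then show "norm ((z - p) / (z - cnj p)) < 1" using nz by (simp add: norm_divide)
qed

text \<open>In the elliptic case the Cayley transform of W is bounded with a unitary multiplier, so
  W converges inside the half plane, which \<open>nconv\<close> forbids. In the other case W, or
  -1/(W - x) for a real fixed point x, has affine monodromy.\<close>

lemma monodromy_log:
  assumes W: "W holomorphic_on left_half_plane c0" "\<And>s. s \<in> left_half_plane c0 \<Longrightarrow> 0 < Im (W s)"
    and det: "a * d - b * c \<noteq> 0"
    and M: "\<And>z. 0 < Im z \<Longrightarrow> c * z + d \<noteq> 0 \<and> 0 < Im ((a * z + b) / (c * z + d))"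
    and Minv: "\<And>z. 0 < Im z \<Longrightarrow> 0 < Im ((d * z - b) / (- c * z + a))"
    and per: "\<And>s. s \<in> left_half_plane c0 \<Longrightarrow> W (s + period) = (a * W s + b) / (c * W s + d)"
    and nconv: "\<And>w. 0 < Im w \<Longrightarrow> \<not> ((\<lambda>x. W (of_real x)) \<longlongrightarrow> w) at_bot"
  shows "\<exists>c1\<le>c0. \<exists>a' b' c' d' l. a' * d' - b' * c' \<noteq> 0 \<and> l holomorphic_on ball 0 (exp c1) \<and>
    (\<forall>s\<in>left_half_plane c1. c' * W s + d' \<noteq> 0 \<and> (a' * W s + b') / (c' * W s + d') = s + l (exp s))"
proof -
  have noell: "\<not> (0 < Im p \<and> norm \<mu> = 1 \<and>
      (\<forall>z. 0 < Im z \<longrightarrow> ((a * z + b) / (c * z + d) - p) / ((a * z + b) / (c * z + d) - cnj p) = \<mu> * ((z - p) / (z - cnj p))))" for p \<mu>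
  proof (rule notI, elim conjE)
    assume p: "0 < Im p" "norm \<mu> = 1" and *: "\<forall>z. 0 < Im z \<longrightarrow> ((a * z + b) / (c * z + d) - p) / ((a * z + b) / (c * z + d) - cnj p) = \<mu> * ((z - p) / (z - cnj p))"
    define K where "K = (\<lambda>s. (W s - p) / (W s - cnj p))"
    have "K holomorphic_on left_half_plane c0"
      unfolding K_def using W cayley_norm(1)[OF p(1)] by (intro holomorphic_intros) auto
    moreover have "K (s + period) = \<mu> * K s" if "s \<in> left_half_plane c0" for s
      unfolding K_def per[OF that] using * W(2)[OF that] by blast
    moreover have "norm (K s) < 1" if "s \<in> left_half_plane c0" for s
      unfolding K_def using cayley_norm(2)[OF p(1) W(2)[OF that]] .
    ultimately obtain \<kappa> where \<kappa>: "norm \<kappa> < 1" "((\<lambda>x. K (of_real x)) \<longlongrightarrow> \<kappa>) at_bot"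
      using rotation_limit[OF _ p(2), of K c0] by blast
    have \<kappa>1: "1 - \<kappa> \<noteq> 0" using \<kappa>(1) by auto
    \<comment> \<open>The inverse Cayley transform turns the limit of K into a limit of W.\<close>
    have "((\<lambda>x. (p - cnj p * K (of_real x)) / (1 - K (of_real x))) \<longlongrightarrow> (p - cnj p * \<kappa>) / (1 - \<kappa>)) at_bot"
      using \<kappa>(2) \<kappa>1 by (intro tendsto_intros)
    moreover have "\<forall>\<^sub>F x in at_bot. (p - cnj p * K (of_real x)) / (1 - K (of_real x)) = W (of_real x)"
      using eventually_gt_at_bot[of c0]
    proof (rule eventually_mono)
      fix x assume "x < c0"
      then have x: "of_real x \<in> left_half_plane c0" by simp
      have nz: "W (of_real x) - cnj p \<noteq> 0" using cayley_norm(1)[OF p(1) W(2)[OF x]] .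
      have pp: "p - cnj p \<noteq> 0" using p(1) by (auto simp: complex_eq_iff)
      have 1: "1 - K (of_real x) = (p - cnj p) / (W (of_real x) - cnj p)"
        using nz by (simp add: K_def field_simps)
      have 2: "p - cnj p * K (of_real x) = (p - cnj p) * W (of_real x) / (W (of_real x) - cnj p)"
        using nz by (simp add: K_def field_simps)
      show "(p - cnj p * K (of_real x)) / (1 - K (of_real x)) = W (of_real x)"
        unfolding 1 2 using nz pp by simp
    qed
    ultimately have lim: "((\<lambda>x. W (of_real x)) \<longlongrightarrow> (p - cnj p * \<kappa>) / (1 - \<kappa>)) at_bot"
      by (rule Lim_transform_eventually)
    \<comment> \<open>This limit is an interior point of the half plane because \<kappa> lies
      strictly inside the unit disc.\<close>
    have "Im ((p - cnj p * \<kappa>) / (1 - \<kappa>)) = Im p * (1 - (norm \<kappa>)\<^sup>2) / (norm (1 - \<kappa>))\<^sup>2"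
      unfolding Im_divide cmod_power2 by (simp add: power2_eq_square algebra_simps)
    moreover have "(norm \<kappa>)\<^sup>2 < 1" using \<kappa>(1) by (simp add: power2_eq_1_iff abs_square_less_1)
    ultimately have "0 < Im ((p - cnj p * \<kappa>) / (1 - \<kappa>))" using p(1) \<kappa>1 by simp
    with nconv lim show False by blast
  qed
  obtain \<alpha> \<beta> :: real where ab: "\<alpha> > 0" "\<alpha> \<noteq> 1 \<or> \<beta> \<noteq> 0" and
    cs: "(\<forall>z. 0 < Im z \<longrightarrow> (a * z + b) / (c * z + d) = of_real \<alpha> * z + of_real \<beta>) \<or>
       (\<exists>x::real. \<forall>z. 0 < Im z \<longrightarrow> - 1 / ((a * z + b) / (c * z + d) - of_real x) = of_real \<alpha> * (- 1 / (z - of_real x)) + of_real \<beta>)"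
    using real_moebius_classification[OF det M Minv] noell by metis
  from cs show ?thesis
  proof (elim disjE exE)
    assume *: "\<forall>z. 0 < Im z \<longrightarrow> (a * z + b) / (c * z + d) = of_real \<alpha> * z + of_real \<beta>"
    have per': "W (s + period) = of_real \<alpha> * W s + of_real \<beta>" if "s \<in> left_half_plane c0" for s
      using * W(2)[OF that] per[OF that] by simp
    obtain c1 l \<kappa> where c1: "c1 \<le> c0" "\<kappa> \<noteq> 0" "l holomorphic_on ball 0 (exp c1)" "\<forall>s\<in>left_half_plane c1. \<kappa> * W s = s + l (exp s)"
      using affine_monodromy[OF W per' ab] by blast
    then show ?thesis
      by (intro exI[of _ c1] conjI exI[of _ \<kappa>] exI[of _ 0] exI[of _ 0] exI[of _ 1] exI[of _ l]) auto
  next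
    fix x :: real
    assume *: "\<forall>z. 0 < Im z \<longrightarrow> - 1 / ((a * z + b) / (c * z + d) - of_real x) = of_real \<alpha> * (- 1 / (z - of_real x)) + of_real \<beta>"
    define V where "V = (\<lambda>s. - 1 / (W s - of_real x))"
    have nz: "W s - of_real x \<noteq> 0" if "s \<in> left_half_plane c0" for s
      using W(2)[OF that] by (auto simp: complex_eq_iff)
    have V: "V holomorphic_on left_half_plane c0" unfolding V_def using W(1) nz by (intro holomorphic_intros)
    have V2: "0 < Im (V s)" if "s \<in> left_half_plane c0" for s
    proof -
      have "Im (V s) = Im (W s) / ((Re (W s) - x)\<^sup>2 + (Im (W s))\<^sup>2)"
        by (simp add: V_def Im_divide)
      also have "\<dots> > 0" using W(2)[OF that] by (intro divide_pos_pos add_nonneg_pos) auto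
      finally show ?thesis .
    qed
    have per': "V (s + period) = of_real \<alpha> * V s + of_real \<beta>" if "s \<in> left_half_plane c0" for s
      using * W(2)[OF that] unfolding V_def per[OF that] by blast
    obtain c1 l \<kappa> where c1: "c1 \<le> c0" "\<kappa> \<noteq> 0" "l holomorphic_on ball 0 (exp c1)" "\<forall>s\<in>left_half_plane c1. \<kappa> * V s = s + l (exp s)"
      using affine_monodromy[OF V V2 per' ab] by blast
    have "1 * W s + - of_real x \<noteq> 0 \<and> (0 * W s + - \<kappa>) / (1 * W s + - of_real x) = s + l (exp s)" if "s \<in> left_half_plane c1" for s
    proof -
      have "s \<in> left_half_plane c0" using that c1(1) by auto
      then show ?thesis using nz[of s] bspec[OF c1(4) that] by (simp add: V_def)
    qed
    then show ?thesis using c1(1-3)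
      by (intro exI[of _ c1] conjI exI[of _ 0] exI[of _ "- \<kappa>"] exI[of _ 1] exI[of _ "- of_real x"] exI[of _ l] ballI) auto
  qed
qed

subsection \<open>Cusps\<close>

text \<open>Hausdorff property of the sphere, expressed in the charts. In the mixed case the bound
  1/(|a| + 1) keeps a + t below |a| + 1 in modulus and 1/t' above it.\<close>

lemma chart_separated:
  assumes "y \<noteq> y'"
  shows "\<exists>\<epsilon>>0. \<forall>t t'. norm t < \<epsilon> \<longrightarrow> norm t' < \<epsilon> \<longrightarrow> chart y t \<noteq> chart y' t'"
proof -
  have inf: "\<exists>\<epsilon>>0. \<forall>t t'. norm t < \<epsilon> \<longrightarrow> norm t' < \<epsilon> \<longrightarrow> chart (Fin a) t \<noteq> chart Infty t'" for a
  proof (intro exI[of _ "1 / (norm a + 1)"] conjI allI impI notI)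
    show "0 < 1 / (norm a + 1)" by (simp add: add_nonneg_pos)
    fix t t' :: complex
    assume t: "norm t < 1 / (norm a + 1)" "norm t' < 1 / (norm a + 1)" "chart (Fin a) t = chart Infty t'"
    then have t': "t' \<noteq> 0" "a + t = 1 / t'" by (auto split: if_splits)
    have "1 / (norm a + 1) \<le> 1" by (subst divide_le_eq_1_pos) (auto simp: add_nonneg_pos)
    then have "norm (a + t) < norm a + 1" using t(1) norm_triangle_ineq[of a t] by linarith
    moreover have "norm (1 / t') > norm a + 1"
    proof -
      have "0 < norm a + 1" by (simp add: add_nonneg_pos)
      then have "norm t' * (norm a + 1) < 1" using t(2) by (simp only: pos_less_divide_eq)
      moreover have "0 < norm t'" using t'(1) by simp
      ultimately have "norm a + 1 < 1 / norm t'" by (simp only: pos_less_divide_eq mult.commute)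
      then show ?thesis by (simp add: norm_divide)
    qed
    ultimately show False using t'(2) by simp
  qed
  show ?thesis
  proof (cases y; cases y')
    fix a a' assume y: "y = Fin a" "y' = Fin a'"
    then have "0 < norm (a - a') / 2" using assms by simp
    moreover have "a + t \<noteq> a' + t'" if "norm t < norm (a - a') / 2" "norm t' < norm (a - a') / 2" for t t'
    proof
      assume "a + t = a' + t'"
      then have "a - a' = t' - t" by (simp add: algebra_simps)
      then have "norm (a - a') \<le> norm t' + norm t" using norm_triangle_ineq4[of t' t] by simp
      then show False using that by linarith
    qed
    ultimately show ?thesis unfolding y by (intro exI[of _ "norm (a - a') / 2"]) auto
  next
    fix a assume y: "y = Fin a" "y' = Infty"
    show ?thesis unfolding y by (rule inf)
  next
    fix a assume y: "y = Infty" "y' = Fin a"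
    obtain \<epsilon> where "\<epsilon> > 0" "\<forall>t t'. norm t < \<epsilon> \<longrightarrow> norm t' < \<epsilon> \<longrightarrow> chart (Fin a) t \<noteq> chart Infty t'"
      using inf[of a] by blast
    then show ?thesis unfolding y by (intro exI[of _ \<epsilon>]) metis
  qed (use assms in simp)
qed

section \<open>The covering away from the marked points and its lifts at a cusp\<close>

context orbifold
begin

text \<open>\<pi> as a map into the plane, where covering space theory applies; the value at
  \<open>Infty\<close> is a dummy that \<open>preimage\<close> excludes.\<close>

definition \<pi>_fin :: "complex \<Rightarrow> complex" where
  "\<pi>_fin \<tau> = (case \<pi> \<tau> of Fin x \<Rightarrow> x | Infty \<Rightarrow> 0)"

definition preimage :: "complex set \<Rightarrow> complex set" where
  "preimage B = {\<tau> \<in> \<H>. \<exists>x\<in>B. \<pi> \<tau> = Fin x}"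

lemma preimage_pi: "\<tau> \<in> preimage B \<Longrightarrow> \<pi> \<tau> = Fin (\<pi>_fin \<tau>) \<and> \<pi>_fin \<tau> \<in> B \<and> \<tau> \<in> \<H>"
  by (auto simp: preimage_def \<pi>_fin_def)

lemma sheet_pi_fin:
  assumes "local_sheet (Fin x) 1 r V \<phi> \<psi>" "\<tau> \<in> V"
  shows "\<pi> \<tau> = Fin (x + of_real r * \<phi> \<tau>)" "\<pi>_fin \<tau> = x + of_real r * \<phi> \<tau>"
proof -
  show "\<pi> \<tau> = Fin (x + of_real r * \<phi> \<tau>)" using local_sheetD(10)[OF assms] by simp
  then show "\<pi>_fin \<tau> = x + of_real r * \<phi> \<tau>" by (simp add: \<pi>_fin_def)
qed

context
  fixes B :: "complex set"
  assumes B: "open B" "\<And>x. x \<in> B \<Longrightarrow> Fin x \<notin> Y"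
begin

lemma preimage_nbhd:
  assumes \<tau>: "\<tau> \<in> preimage B"
  obtains N where "open N" "\<tau> \<in> N" "N \<subseteq> preimage B" "\<pi>_fin holomorphic_on N"
proof -
  note p = preimage_pi[OF \<tau>]
  have w: "weight (\<pi> \<tau>) = enat 1" using p B(2) weight_1 by simp
  have "\<tau> \<in> \<H>" using p by blast
  then obtain r V \<phi> \<psi> where s: "r > 0" "local_sheet (\<pi> \<tau>) 1 r V \<phi> \<psi>" "\<tau> \<in> V" "\<phi> \<tau> = 0"
    using sheet_at[OF _ w] by blast
  have s2: "local_sheet (Fin (\<pi>_fin \<tau>)) 1 r V \<phi> \<psi>" using s(2) p by simp
  note sD = local_sheetD[OF s2]
  let ?f = "\<lambda>\<tau>'. \<pi>_fin \<tau> + of_real r * \<phi> \<tau>'"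
  have f: "?f holomorphic_on V" using sD(3) by (intro holomorphic_intros)
  then have "open (V \<inter> ?f -` B)"
    using sD(1) B(1) by (intro continuous_open_preimage holomorphic_on_imp_continuous_on)
  moreover have "\<tau> \<in> V \<inter> ?f -` B" using s p by simp
  moreover have "V \<inter> ?f -` B \<subseteq> preimage B"
    using sD(2) sheet_pi_fin(1)[OF s2] by (auto simp: preimage_def)
  moreover have "\<pi>_fin holomorphic_on V \<inter> ?f -` B"
  proof (rule holomorphic_transform)
    show "?f holomorphic_on V \<inter> ?f -` B" using f by (rule holomorphic_on_subset) auto
  qed (use sheet_pi_fin(2)[OF s2] in auto)
  ultimately show ?thesis by (rule that)
qed

lemma open_preimage: "open (preimage B)"
proof (subst open_subopen, rule ballI)
  fix \<tau> assume "\<tau> \<in> preimage B"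
  then show "\<exists>T. open T \<and> \<tau> \<in> T \<and> T \<subseteq> preimage B"
    by (rule preimage_nbhd) blast
qed

lemma holomorphic_pi_fin: "\<pi>_fin holomorphic_on preimage B"
proof (rule analytic_imp_holomorphic, unfold analytic_on_def, rule ballI)
  fix \<tau> assume "\<tau> \<in> preimage B"
  then obtain N where N: "open N" "\<tau> \<in> N" "N \<subseteq> preimage B" "\<pi>_fin holomorphic_on N"
    by (rule preimage_nbhd)
  obtain e where "e > 0" "ball \<tau> e \<subseteq> N" using openE[OF N(1,2)] by auto
  then show "\<exists>e>0. \<pi>_fin holomorphic_on ball \<tau> e" using N(4) holomorphic_on_subset by blast
qed

text \<open>All points of B have weight 1, so the branched covering restricts to an honest one. The
  sheets are cut down to \<open>preimage B\<close>, since a disc of the local model need not lie in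
  B.\<close>

lemma covering_pi_fin: "covering_space (preimage B) \<pi>_fin B"
  unfolding covering_space_def
proof (intro conjI ballI)
  show "continuous_on (preimage B) \<pi>_fin"
    using holomorphic_pi_fin by (rule holomorphic_on_imp_continuous_on)
  show "\<pi>_fin ` preimage B = B"
  proof
    show "\<pi>_fin ` preimage B \<subseteq> B" using preimage_pi by blast
    show "B \<subseteq> \<pi>_fin ` preimage B"
    proof
      fix x assume x: "x \<in> B"
      then have "Fin x \<in> \<pi> ` \<H>" unfolding pi_image using B(2) by simp
      then obtain \<tau> where "\<tau> \<in> \<H>" "\<pi> \<tau> = Fin x" by (elim imageE) simp
      then have "\<tau> \<in> preimage B" "\<pi>_fin \<tau> = x" using x by (auto simp: preimage_def \<pi>_fin_def)
      then show "x \<in> \<pi>_fin ` preimage B" by blast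
    qed
  qed
  fix x assume x: "x \<in> B"
  then have w: "weight (Fin x) = enat 1" using B(2) weight_1 by simp
  obtain r \<V> where r: "r > 0" "\<Union>\<V> = {\<tau> \<in> \<H>. \<pi> \<tau> \<in> chart (Fin x) ` ball 0 r}" "pairwise disjnt \<V>"
    "\<forall>V\<in>\<V>. \<exists>\<phi> \<psi>. local_sheet (Fin x) 1 r V \<phi> \<psi>"
    using local_sheets[OF w] .
  let ?T = "B \<inter> ball x r"
  let ?v = "(\<lambda>V. V \<inter> preimage B) ` \<V>"
  have in\<V>: "\<tau> \<in> \<Union>\<V> \<longleftrightarrow> \<pi>_fin \<tau> \<in> ball x r" if \<tau>: "\<tau> \<in> preimage B" for \<tau>
  proof -
    have "chart (Fin x) ` ball 0 r = Fin ` ((+) x ` ball 0 r)" unfolding image_image by (rule image_cong) simp_all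
    also have "\<dots> = Fin ` ball x r" by (simp only: image_add_ball add_0_left add_0_right)
    finally have "\<pi> \<tau> \<in> chart (Fin x) ` ball 0 r \<longleftrightarrow> \<pi>_fin \<tau> \<in> ball x r"
      using preimage_pi[OF \<tau>] by auto
    then show ?thesis unfolding r(2) using preimage_pi[OF \<tau>] by simp
  qed
  show "\<exists>T. x \<in> T \<and> openin (top_of_set B) T \<and> (\<exists>v. \<Union>v = preimage B \<inter> \<pi>_fin -` T \<and>
      (\<forall>u\<in>v. openin (top_of_set (preimage B)) u) \<and> pairwise disjnt v \<and> (\<forall>u\<in>v. \<exists>q. homeomorphism u T \<pi>_fin q))"
  proof (intro exI[of _ ?T] conjI exI[of _ ?v] ballI)
    show "x \<in> ?T" using x r(1) by simp
    show "openin (top_of_set B) ?T" by (simp add: openin_open_Int)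
    show "\<Union>?v = preimage B \<inter> \<pi>_fin -` ?T"
      using in\<V> preimage_pi by blast
    show "openin (top_of_set (preimage B)) u" if u: "u \<in> ?v" for u
    proof -
      obtain V where V: "V \<in> \<V>" "u = V \<inter> preimage B" using u by (rule imageE)
      then have "open V" using bspec[OF r(4) V(1)] local_sheetD(1) by blast
      then show ?thesis unfolding V(2) by (metis Int_commute openin_open_Int)
    qed
    show "pairwise disjnt ?v"
    proof (rule pairwise_imageI)
      fix V V' assume V: "V \<in> \<V>" "V' \<in> \<V>" "V \<noteq> V'"
      then have "disjnt V V'" using r(3) by (auto simp: pairwise_def)
      then show "disjnt (V \<inter> preimage B) (V' \<inter> preimage B)" by (auto simp: disjnt_def)
    qed
    show "\<exists>q. homeomorphism u ?T \<pi>_fin q" if u: "u \<in> ?v" for u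
    proof -
      obtain V where V: "V \<in> \<V>" "u = V \<inter> preimage B" using u by (rule imageE)
      obtain \<phi> \<psi> where s: "local_sheet (Fin x) 1 r V \<phi> \<psi>" using bspec[OF r(4) V(1)] by auto
      note sD = local_sheetD[OF s] and sp = sheet_pi_fin[OF s]
      define q where "q = (\<lambda>x'. \<psi> ((x' - x) / of_real r))"
      have in1: "(x' - x) / of_real r \<in> ball 0 1" if "x' \<in> ball x r" for x'
        using that r(1) by (simp add: dist_norm norm_divide norm_minus_commute)
      have q: "q x' \<in> V" "\<pi>_fin (q x') = x'" "q x' \<in> preimage B" if x': "x' \<in> ?T" for x'
      proof -
        have b: "x' \<in> ball x r" using x' by simp
        show qV: "q x' \<in> V" using sD(7)[OF in1[OF b]] by (simp add: q_def)
        have "\<phi> (q x') = (x' - x) / of_real r" using sD(8)[OF in1[OF b]] by (simp add: q_def)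
        then have "x + of_real r * \<phi> (q x') = x'" using r(1) by simp
        then show "\<pi>_fin (q x') = x'" "q x' \<in> preimage B"
          using sp[OF qV] qV sD(2) x' by (auto simp: preimage_def)
      qed
      have qp: "q (\<pi>_fin \<tau>) = \<tau>" if "\<tau> \<in> V" for \<tau>
        using sp(2)[OF that] sD(6)[OF that] r(1) by (simp add: q_def)
      have pT: "\<pi>_fin \<tau> \<in> ?T" if "\<tau> \<in> u" for \<tau>
        using that in\<V>[of \<tau>] preimage_pi[of \<tau> B] V by blast
      have cq: "continuous_on ?T q"
      proof -
        have "q holomorphic_on ball x r"
          unfolding q_def using sD(4) in1 r
          by (intro holomorphic_on_compose_gen[of _ "ball x r" \<psi> "ball 0 1", unfolded o_def] holomorphic_intros) auto
        then show ?thesis by (intro holomorphic_on_imp_continuous_on) (auto intro: holomorphic_on_subset)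
      qed
      have cp: "continuous_on u \<pi>_fin"
        using holomorphic_on_imp_continuous_on[OF holomorphic_pi_fin] by (rule continuous_on_subset) (simp add: V(2))
      have "homeomorphism u ?T \<pi>_fin q"
      proof (rule homeomorphismI[OF cp cq])
        show "\<pi>_fin ` u \<subseteq> ?T" using pT by blast
        show "q ` ?T \<subseteq> u" using q(1,3) V(2) by blast
        show "q (\<pi>_fin \<tau>) = \<tau>" if "\<tau> \<in> u" for \<tau> using qp that V(2) by blast
        show "\<pi>_fin (q x') = x'" if "x' \<in> ?T" for x' using q(2)[OF that] .
      qed
      then show ?thesis by blast
    qed
  qed
qed

end

text \<open>exp parametrises the punctured disc by a simply connected half plane, so the covering
  lifts. The derivative of W cannot vanish, because \<pi> o W is \<open>param y\<close> o exp, whose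
  derivative has no zero.\<close>

lemma cusp_lift:
  shows "\<exists>c W. W holomorphic_on left_half_plane c \<and> (\<forall>s\<in>left_half_plane c. Im (W s) > 0 \<and> deriv W s \<noteq> 0 \<and>
    \<pi> (W s) = Fin (param y (exp s)) \<and> Fin (param y (exp s)) \<notin> Y)"
proof -
  obtain \<rho> where \<rho>: "\<rho> > 0" "\<forall>x\<in>ball 0 \<rho> - {0}. Fin (param y x) \<notin> Y"
    using small_at[OF eventually_param_notin_Y] by (rule small_radius)
  define c where "c = ln \<rho>"
  have ec: "exp c = \<rho>" using \<rho>(1) by (simp add: c_def)
  define B where "B = param y ` (ball 0 \<rho> - {0})"
  have oB: "open B" unfolding B_def
    by (rule open_mapping_thm3[OF holomorphic_param _ inj_on_param]) auto
  have BY: "Fin x \<notin> Y" if "x \<in> B" for x using that \<rho>(2) by (auto simp: B_def)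
  define f where "f = (\<lambda>s. param y (exp s))"
  have ein: "exp s \<in> ball 0 \<rho> - {0}" if "s \<in> left_half_plane c" for s
    using that exp_in_ball[of s c] by (simp add: ec)
  have f: "f holomorphic_on left_half_plane c" "f \<in> left_half_plane c \<rightarrow> B"
    unfolding f_def using ein by (auto intro!: holomorphic_intros simp: B_def simp del: mem_ball)
  have sc: "simply_connected (left_half_plane c)" "locally path_connected (left_half_plane c)"
    using convex_imp_simply_connected convex_halfspace_Re_lt open_imp_locally_path_connected open_left by auto
  have "\<exists>W. W holomorphic_on left_half_plane c \<and> W \<in> left_half_plane c \<rightarrow> preimage B \<and>
      (\<forall>s\<in>left_half_plane c. \<pi>_fin (W s) = f s)"
    by (rule covering_space_lift_holomorphic[OF covering_pi_fin[OF oB BY] open_preimage[OF oB BY] holomorphic_pi_fin[OF oB BY] f sc]) auto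
  then obtain W where W: "W holomorphic_on left_half_plane c" "W \<in> left_half_plane c \<rightarrow> preimage B"
      "\<And>s. s \<in> left_half_plane c \<Longrightarrow> \<pi>_fin (W s) = f s"
    by auto
  have "Im (W s) > 0 \<and> deriv W s \<noteq> 0 \<and> \<pi> (W s) = Fin (param y (exp s)) \<and> Fin (param y (exp s)) \<notin> Y"
    if s: "s \<in> left_half_plane c" for s
  proof -
    have Ws: "W s \<in> preimage B" using W(2) s by (rule funcset_mem)
    note p = preimage_pi[OF Ws]
    have "(W has_field_derivative deriv W s) (at s)"
      using holomorphic_derivI[OF W(1) open_left s] .
    moreover have "(\<pi>_fin has_field_derivative deriv \<pi>_fin (W s)) (at (W s))"
      using holomorphic_derivI[OF holomorphic_pi_fin[OF oB BY] open_preimage[OF oB BY] Ws] .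
    ultimately have "((\<lambda>s. \<pi>_fin (W s)) has_field_derivative deriv \<pi>_fin (W s) * deriv W s) (at s)"
      by (intro DERIV_chain2)
    then have "(f has_field_derivative deriv \<pi>_fin (W s) * deriv W s) (at s)"
      by (rule has_field_derivative_transform_within_open[OF _ open_left s]) (use W(3) in auto)
    moreover have "(f has_field_derivative deriv (param y) (exp s) * exp s) (at s)"
      unfolding f_def by (rule deriv_param_compose[OF DERIV_exp]) simp
    ultimately have "deriv \<pi>_fin (W s) * deriv W s = deriv (param y) (exp s) * exp s"
      by (rule DERIV_unique)
    moreover have "deriv (param y) (exp s) * exp s \<noteq> 0" using deriv_param_nonzero[of "exp s" y] by simp
    ultimately have "deriv W s \<noteq> 0" by auto
    then show ?thesis using p W(3)[OF s] BY by (simp add: f_def)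
  qed
  then show ?thesis using W(1) by blast
qed

text \<open>W(x) lies over points that tend to y, so a limit in the half plane would lie over y by
  continuity and separation, but y is omitted by \<pi>.\<close>

lemma cusp_not_attained:
  assumes y: "y \<in> Y" "b y = \<infinity>" and W: "\<And>s. s \<in> left_half_plane c \<Longrightarrow> \<pi> (W s) = Fin (param y (exp s))"
    and w: "0 < Im w" and lim: "((\<lambda>x. W (of_real x)) \<longlongrightarrow> w) at_bot"
  shows False
proof -
  have wH: "w \<in> \<H>" using w by simp
  then have "\<pi> w \<in> \<pi> ` \<H>" by (rule imageI)
  then have "\<pi> w \<noteq> y" unfolding pi_image using y by auto
  then obtain \<epsilon> where \<epsilon>: "\<epsilon> > 0" "\<forall>t t'. norm t < \<epsilon> \<longrightarrow> norm t' < \<epsilon> \<longrightarrow> chart (\<pi> w) t \<noteq> chart y t'"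
    using chart_separated by blast
  obtain n where n: "weight (\<pi> w) = enat n" using weight_pi[OF wH] .
  obtain r V \<phi> \<psi> where s: "r > 0" "local_sheet (\<pi> w) n r V \<phi> \<psi>" "w \<in> V" "\<phi> w = 0"
    using sheet_at[OF wH n] .
  note sD = local_sheetD[OF s(2)]
  have "isCont \<phi> w"
    using sD(1,3) s(3) continuous_on_eq_continuous_at holomorphic_on_imp_continuous_on by blast
  then have "((\<lambda>x. of_real r * \<phi> (W (of_real x)) ^ n) \<longlongrightarrow> of_real r * \<phi> w ^ n) at_bot"
    using lim by (intro tendsto_intros isCont_tendsto_compose[of _ \<phi>])
  then have "((\<lambda>x. of_real r * \<phi> (W (of_real x)) ^ n) \<longlongrightarrow> 0) at_bot"
    using s(4) weight_pos[OF n] by (simp add: zero_power)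
  then have 1: "\<forall>\<^sub>F x in at_bot. norm (of_real r * \<phi> (W (of_real x)) ^ n) < \<epsilon>"
    using \<epsilon>(1) tendstoD[of _ "0::complex"] by fastforce
  have 2: "\<forall>\<^sub>F x in at_bot. norm (exp (complex_of_real x)) < \<epsilon>"
    using tendstoD[OF filterlim_exp_at_bot \<epsilon>(1)] by simp
  have 3: "\<forall>\<^sub>F x in at_bot. W (of_real x) \<in> V"
    using topological_tendstoD[OF lim sD(1) s(3)] .
  have "\<forall>\<^sub>F x::real in at_bot. False"
    using 1 2 3 eventually_gt_at_bot[of c]
  proof eventually_elim
    case (elim x)
    have "\<pi> (W (of_real x)) = chart (\<pi> w) (of_real r * \<phi> (W (of_real x)) ^ n)"
      using sD(10)[OF elim(3)] .
    moreover have "\<pi> (W (of_real x)) = chart y (exp (of_real x))"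
      using W[of "of_real x"] elim(4) by (simp add: chart_nonzero del: chart.simps)
    ultimately show False using \<epsilon>(2) elim(1,2) by metis
  qed
  then show False by simp
qed

text \<open>W and its translate lift the same map \<open>param y\<close> o exp, so L prescribes the
  same Schwarzian for both. The resulting transformation preserves fibres on the image of W, and its
  inverse does so on the image of the translate; \<open>deck_moebius\<close> extends both to the
  half plane.\<close>

lemma cusp_monodromy:
  assumes W: "W holomorphic_on left_half_plane c0" "\<forall>s\<in>left_half_plane c0. Im (W s) > 0 \<and> deriv W s \<noteq> 0 \<and>
    \<pi> (W s) = Fin (param y (exp s)) \<and> Fin (param y (exp s)) \<notin> Y"
  shows "\<exists>a b c d. a * d - b * c \<noteq> 0 \<and>
    (\<forall>z. 0 < Im z \<longrightarrow> c * z + d \<noteq> 0 \<and> 0 < Im ((a * z + b) / (c * z + d))) \<and>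
    (\<forall>z. 0 < Im z \<longrightarrow> 0 < Im ((d * z - b) / (- c * z + a))) \<and>
    (\<forall>s\<in>left_half_plane c0. W (s + period) = (a * W s + b) / (c * W s + d))"
proof -
  let ?S = "left_half_plane c0"
  define f where "f = (\<lambda>s. param y (exp s))"
  define W2 where "W2 = (\<lambda>s. W (s + period))"
  have f: "f holomorphic_on ?S" unfolding f_def by (intro holomorphic_intros) auto
  have fd: "deriv f s \<noteq> 0" for s
  proof -
    have "(f has_field_derivative deriv (param y) (exp s) * exp s) (at s)"
      unfolding f_def by (rule deriv_param_compose[OF DERIV_exp]) simp
    then show ?thesis using deriv_param_nonzero[of "exp s" y] by (simp add: DERIV_imp_deriv)
  qed
  have shift: "s + period \<in> ?S" if "s \<in> ?S" for s using that by simp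
  have W2: "W2 holomorphic_on ?S"
  proof -
    have "(\<lambda>s. s + period) holomorphic_on ?S" by (intro holomorphic_intros)
    moreover have "(\<lambda>s. s + period) ` ?S \<subseteq> ?S" using shift by blast
    ultimately show ?thesis
      unfolding W2_def using holomorphic_on_compose_gen[OF _ W(1), of "\<lambda>s. s + period" ?S] by (simp add: o_def)
  qed
  have dW2: "deriv W2 s \<noteq> 0" if s: "s \<in> ?S" for s
  proof -
    have "(W has_field_derivative deriv W (s + period)) (at (s + period))"
      using holomorphic_derivI[OF W(1) open_left shift[OF s]] .
    then have "(W2 has_field_derivative deriv W (s + period)) (at s)"
      unfolding W2_def by (simp only: DERIV_shift)
    then show ?thesis using bspec[OF W(2) shift[OF s]] by (simp add: DERIV_imp_deriv)
  qed
  have liftW: "\<pi> (W s) = Fin (f s)" "W s \<in> \<H>" if "s \<in> ?S" for s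
    using bspec[OF W(2) that] by (simp_all add: f_def)
  have liftW2: "\<pi> (W2 s) = Fin (f s)" "W2 s \<in> \<H>" if "s \<in> ?S" for s
    using bspec[OF W(2) shift[OF that]] unfolding exp_period by (simp_all add: f_def W2_def)
  have eq: "schwarzian W s = schwarzian W2 s" if s: "s \<in> ?S" for s
  proof -
    have "snd L (f s) * (deriv f s)\<^sup>2 = schwarzian f s - schwarzian W s"
      using bspec[OF W(2) s] liftW by (intro eqn_pullback_branch[OF open_left s f fd W(1)]) auto
    moreover have "snd L (f s) * (deriv f s)\<^sup>2 = schwarzian f s - schwarzian W2 s"
      using dW2[OF s] liftW2 by (intro eqn_pullback_branch[OF open_left s f fd W2]) auto
    ultimately show ?thesis by simp
  qed
  have ne: "?S \<noteq> {}"
  proof -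
    have "of_real (c0 - 1) \<in> ?S" by simp
    then show ?thesis by blast
  qed
  then obtain s0 where s0: "s0 \<in> ?S" by blast
  have dW: "deriv W s \<noteq> 0" if "s \<in> ?S" for s using bspec[OF W(2) that] by blast
  show ?thesis
  proof (rule eq_schwarzian_imp_moebius[OF open_left convex_halfspace_Re_lt ne W(1) dW W2 dW2 eq])
    fix a b' c d
    assume det: "a * d - b' * c \<noteq> 0" and nz: "\<And>z. z \<in> ?S \<Longrightarrow> c * W z + d \<noteq> 0"
      and M: "\<And>z. z \<in> ?S \<Longrightarrow> W2 z = (a * W z + b') / (c * W z + d)"
    \<comment> \<open>Nonvanishing derivatives give balls with open images, the starting sets for
      \<open>deck_moebius\<close>.\<close>
    obtain r where r: "r > 0" "ball s0 r \<subseteq> ?S" "inj_on W (ball s0 r)"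
      using has_complex_derivative_locally_injective[OF W(1) s0 open_left dW[OF s0]] .
    obtain r2 where r2: "r2 > 0" "ball s0 r2 \<subseteq> ?S" "inj_on W2 (ball s0 r2)"
      using has_complex_derivative_locally_injective[OF W2 s0 open_left dW2[OF s0]] .
    have o1: "open (W ` ball s0 r)"
      by (rule open_mapping_thm3[OF _ open_ball r(3)]) (use W(1) r(2) in \<open>auto intro: holomorphic_on_subset\<close>)
    have o2: "open (W2 ` ball s0 r2)"
      by (rule open_mapping_thm3[OF _ open_ball r2(3)]) (use W2 r2(2) in \<open>auto intro: holomorphic_on_subset\<close>)
    have A: "c * \<tau> + d \<noteq> 0 \<and> (a * \<tau> + b') / (c * \<tau> + d) \<in> \<H> \<and> \<pi> ((a * \<tau> + b') / (c * \<tau> + d)) = \<pi> \<tau>"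
      if \<tau>: "\<tau> \<in> W ` ball s0 r" for \<tau>
    proof -
      from \<tau> obtain s where s: "\<tau> = W s" "s \<in> ball s0 r" by (rule imageE)
      then have sS: "s \<in> ?S" using r(2) by blast
      show ?thesis unfolding s(1) M[OF sS, symmetric]
        using nz[OF sS] liftW[OF sS] liftW2[OF sS] by simp
    qed
    have Bi: "- c * \<tau> + a \<noteq> 0 \<and> (d * \<tau> + - b') / (- c * \<tau> + a) \<in> \<H> \<and> \<pi> ((d * \<tau> + - b') / (- c * \<tau> + a)) = \<pi> \<tau>"
      if \<tau>: "\<tau> \<in> W2 ` ball s0 r2" for \<tau>
    proof -
      from \<tau> obtain s where s: "\<tau> = W2 s" "s \<in> ball s0 r2" by (rule imageE)
      then have sS: "s \<in> ?S" using r2(2) by blast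
      have 1: "- c * \<tau> + a = (a * d - b' * c) / (c * W s + d)"
        unfolding s(1) M[OF sS] using nz[OF sS] by (simp add: field_simps)
      have 2: "d * \<tau> + - b' = (a * d - b' * c) * W s / (c * W s + d)"
        unfolding s(1) M[OF sS] using nz[OF sS] by (simp add: field_simps)
      have 3: "(d * \<tau> + - b') / (- c * \<tau> + a) = W s"
        unfolding 1 2 using nz[OF sS] det by simp
      have "- c * \<tau> + a \<noteq> 0" unfolding 1 using nz[OF sS] det by simp
      then show ?thesis unfolding 3 using liftW[OF sS] liftW2[OF sS] s(1) by simp
    qed
    have n1: "W ` ball s0 r \<noteq> {}" "W ` ball s0 r \<subseteq> \<H>" using r(1,2) liftW(2) by auto
    have n2: "W2 ` ball s0 r2 \<noteq> {}" "W2 ` ball s0 r2 \<subseteq> \<H>" using r2(1,2) liftW2(2) by auto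
    \<comment> \<open>The inverse has the entries d, -b, -c, a and the same determinant.\<close>
    have det2: "d * a - (- b') * (- c) \<noteq> 0" using det by (simp add: mult.commute)
    have m1: "c * z + d \<noteq> 0 \<and> 0 < Im ((a * z + b') / (c * z + d))" if "0 < Im z" for z
      using deck_moebius[OF det o1 n1 A, of z] that by simp
    have m2: "0 < Im ((d * z - b') / (- c * z + a))" if "0 < Im z" for z
      using deck_moebius(2)[OF det2 o2 n2 Bi, of z] that by simp
    have "\<forall>s\<in>?S. W (s + period) = (a * W s + b') / (c * W s + d)"
      using M by (simp add: W2_def)
    then show ?thesis using det m1 m2 by blast
  qed
qed

text \<open>With S = e Ln t + log U one has exp S = t^e U, and the Moebius transform of W that
  equals s + l(exp s) becomes e Ln t + H at s = S. This v may leave the half plane, but it has the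
  Schwarzian of the lift W o S.\<close>

lemma cusp_development:
  assumes y: "y \<in> Y" "b y = \<infinity>" and U: "ramified_coordinate e U"
  shows "\<exists>v V H. developed_coordinate e U v V (- 1) \<and> H analytic_on {0} \<and>
    (\<forall>t. v t = of_nat e * Ln t + H t) \<and>
    (\<forall>\<^sub>F r in at_right 0. v holomorphic_on (ball 0 r - \<real>\<^sub>\<le>\<^sub>0) \<and> V holomorphic_on ball 0 r) \<and>
    (\<forall>\<^sub>F t in at 0 within - \<real>\<^sub>\<le>\<^sub>0. snd L (ramified_coordinate.g y e U t) * (deriv (ramified_coordinate.g y e U) t)\<^sup>2
       = schwarzian (ramified_coordinate.g y e U) t - schwarzian v t)"
proof -
  interpret R: ramified_coordinate y e U by (rule U)
  obtain c0 W where W: "W holomorphic_on left_half_plane c0" "\<forall>s\<in>left_half_plane c0. Im (W s) > 0 \<and> deriv W s \<noteq> 0 \<and>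
    \<pi> (W s) = Fin (param y (exp s)) \<and> Fin (param y (exp s)) \<notin> Y"
    using cusp_lift by blast
  have nconv: "\<not> ((\<lambda>x. W (of_real x)) \<longlongrightarrow> w) at_bot" if "0 < Im w" for w
    using cusp_not_attained[OF y _ that, of c0 W] W(2) by blast
  obtain ma mb mc md where m: "ma * md - mb * mc \<noteq> 0"
    "\<forall>z. 0 < Im z \<longrightarrow> mc * z + md \<noteq> 0 \<and> 0 < Im ((ma * z + mb) / (mc * z + md))"
    "\<forall>z. 0 < Im z \<longrightarrow> 0 < Im ((md * z - mb) / (- mc * z + ma))"
    "\<forall>s\<in>left_half_plane c0. W (s + period) = (ma * W s + mb) / (mc * W s + md)"
    using cusp_monodromy[OF W] by (elim exE conjE) rule
  have "\<exists>c1\<le>c0. \<exists>a' b' c' d' l. a' * d' - b' * c' \<noteq> 0 \<and> l holomorphic_on ball 0 (exp c1) \<and>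
    (\<forall>s\<in>left_half_plane c1. c' * W s + d' \<noteq> 0 \<and> (a' * W s + b') / (c' * W s + d') = s + l (exp s))"
    using W(2) m(2,3,4) by (intro monodromy_log[OF W(1) _ m(1) _ _ _ nconv]) auto
  then obtain c1 a' b' c' d' l where c1: "c1 \<le> c0" and det: "a' * d' - b' * c' \<noteq> 0" and
    l: "l holomorphic_on ball 0 (exp c1)" and
    N: "\<forall>s\<in>left_half_plane c1. c' * W s + d' \<noteq> 0 \<and> (a' * W s + b') / (c' * W s + d') = s + l (exp s)"
    by blast
  obtain d lu where d: "d > 0" "U holomorphic_on ball 0 d" "lu holomorphic_on ball 0 d" "\<And>t. t \<in> ball 0 d \<Longrightarrow> U t = exp (lu t)"
    using R.U by (rule log_near_nonzero) blast
  define H where "H = (\<lambda>t. lu t + l (R.T t))"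
  define v where "v = (\<lambda>t. of_nat e * Ln t + H t)"
  \<comment> \<open>From t v' = e + t H': the order j is -1 and V 0 = e.\<close>
  define V where "V = (\<lambda>t. of_nat e + t * deriv H t)"
  have H: "H analytic_on {0}"
  proof -
    have "l analytic_on {R.T 0}" using analytic_at_0I[OF l] R.T_0 by simp
    then have "(\<lambda>t. l (R.T t)) analytic_on {0}"
      using analytic_on_compose[OF R.T_analytic, of l] by (simp add: o_def)
    then show ?thesis unfolding H_def using analytic_at_0I[OF d(3,1)] by (intro analytic_intros)
  qed
  have V: "V analytic_on {0}" "V 0 \<noteq> 0" unfolding V_def using H R.e by (auto intro!: analytic_intros)
  have dv: "(v has_field_derivative t powi (- 1) * V t) (at t)" if "t \<notin> \<real>\<^sub>\<le>\<^sub>0" "H holomorphic_on ball 0 r" "t \<in> ball 0 r" for t r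
  proof -
    have "t \<noteq> 0" using that(1) by auto
    have "(v has_field_derivative of_nat e * inverse t + deriv H t) (at t)"
      unfolding v_def
      by (intro DERIV_add DERIV_cmult has_field_derivative_Ln that(1) holomorphic_derivI[OF that(2) open_ball that(3)])
    moreover have "of_nat e * inverse t + deriv H t = t powi (- 1) * V t"
      using \<open>t \<noteq> 0\<close> by (simp add: V_def field_simps power_int_minus)
    ultimately show ?thesis by simp
  qed
  have hv: "v holomorphic_on (ball 0 r - \<real>\<^sub>\<le>\<^sub>0)" if "H holomorphic_on ball 0 r" for r
    unfolding v_def using that by (intro holomorphic_intros) (auto intro: holomorphic_on_subset)
  have smallv: "\<forall>\<^sub>F r in at_right 0. v holomorphic_on (ball 0 r - \<real>\<^sub>\<le>\<^sub>0) \<and>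
      (\<forall>t\<in>ball 0 r - \<real>\<^sub>\<le>\<^sub>0. deriv v t = t powi (- 1) * V t)"
    using small_holomorphic[OF H]
  proof (rule eventually_mono)
    fix r assume h: "H holomorphic_on ball 0 r"
    show "v holomorphic_on (ball 0 r - \<real>\<^sub>\<le>\<^sub>0) \<and> (\<forall>t\<in>ball 0 r - \<real>\<^sub>\<le>\<^sub>0. deriv v t = t powi (- 1) * V t)"
      using hv[OF h] DERIV_imp_deriv[OF dv[OF _ h]] by auto
  qed
  have dc: "developed_coordinate e U v V (- 1)"
    by unfold_locales (use V smallv in auto)
  have evT: "\<forall>\<^sub>F t in nhds 0. norm (R.T t) < exp c1"
    using tendstoD[OF tendsto_nhds_analytic[OF R.T_analytic], of "exp c1"] by (simp add: R.T_0)
  have "\<forall>\<^sub>F t in at 0 within - \<real>\<^sub>\<le>\<^sub>0. snd L (R.g t) * (deriv R.g t)\<^sup>2 = schwarzian R.g t - schwarzian v t"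
  proof -
    obtain r where r: "r > 0" "H holomorphic_on ball 0 r" "R.good r" "\<forall>t\<in>ball 0 r. norm (R.T t) < exp c1"
       "r < d" "V holomorphic_on ball 0 r" "\<forall>t\<in>ball 0 r. V t \<noteq> 0"
      using eventually_conj[OF small_holomorphic[OF H] eventually_conj[OF R.small_good eventually_conj[OF small_nhds[OF evT]
        eventually_conj[OF eventually_at_right_real[OF d(1)] eventually_conj[OF small_holomorphic[OF V(1)] small_nhds[OF eventually_nhds_nonzero[OF V]]]]]]]
      by (rule small_radius) auto
    let ?D = "ball 0 r - \<real>\<^sub>\<le>\<^sub>0 :: complex set"
    have sub: "?D \<subseteq> ball 0 r - {0}" by auto
    define S where "S = (\<lambda>t. of_nat e * Ln t + lu t)"
    have hS: "S holomorphic_on ?D"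
      unfolding S_def using d(3) r(5) by (intro holomorphic_intros) (auto elim!: holomorphic_on_subset)
    have expS: "exp (S t) = R.T t" if t: "t \<in> ?D" for t
    proof -
      have "t \<noteq> 0" using t by auto
      moreover have "U t = exp (lu t)" using d(4)[of t] t r(5) by auto
      ultimately show ?thesis by (simp add: S_def R.T_def exp_add exp_of_nat_mult)
    qed
    have Sin: "S t \<in> left_half_plane c1" if t: "t \<in> ?D" for t
      unfolding exp_in_ball[symmetric] expS[OF t] using r(4) t by simp
    define v0 where "v0 = (\<lambda>t. W (S t))"
    have hv0: "v0 holomorphic_on ?D"
      unfolding v0_def using holomorphic_on_compose_gen[OF hS, of W "left_half_plane c0"] W(1) Sin c1
      by (force simp: o_def image_subset_iff)
    have vN: "c' * v0 t + d' \<noteq> 0" "v t = (a' * v0 t + b') / (c' * v0 t + d')" if t: "t \<in> ?D" for t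
      using bspec[OF N Sin[OF t]] expS[OF t] by (simp_all add: v0_def v_def H_def S_def)
    \<comment> \<open>v is a Moebius transform of v0, so a zero of v0' would be one of v' =
      V/t.\<close>
    have dv0: "deriv v0 t \<noteq> 0" if t: "t \<in> ?D" for t
    proof
      assume "deriv v0 t = 0"
      then have "(v0 has_field_derivative 0) (at t)"
        using holomorphic_derivI[OF hv0 open_slit_ball t] by simp
      then have "((\<lambda>t. (a' * v0 t + b') / (c' * v0 t + d')) has_field_derivative 0) (at t)"
        using vN(1)[OF t] by (auto intro!: derivative_eq_intros)
      then have "(v has_field_derivative 0) (at t)"
        by (rule has_field_derivative_transform_within_open[OF _ open_slit_ball t]) (use vN(2) in auto)
      then have "t powi (- 1) * V t = 0"
        using DERIV_unique dv[OF _ r(2), of t] t by blast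
      then show False using r(7) t by auto
    qed
    show ?thesis
    proof (rule eventually_slit_ball[OF r(1)])
      fix t :: complex assume t: "t \<in> ?D"
      have S0: "S s \<in> left_half_plane c0" if "s \<in> ?D" for s using Sin[OF that] c1 by simp
      have lift: "\<pi> (v0 s) = Fin (R.g s)" "v0 s \<in> \<H>" if s: "s \<in> ?D" for s
        using bspec[OF W(2) S0[OF s]] expS[OF s] by (simp_all add: v0_def R.g_def)
      have "snd L (R.g t) * (deriv R.g t)\<^sup>2 = schwarzian R.g t - schwarzian v0 t"
      proof (rule eqn_pullback_branch[OF open_slit_ball t])
        show "R.g holomorphic_on ?D" using R.g_holomorphic[OF r(3)] sub by (rule holomorphic_on_subset)
        have t0: "t \<in> ball 0 r - {0}" using sub t by blast
        show "deriv R.g t \<noteq> 0" using R.deriv_g[OF r(3) t0] R.G_nonzero[OF r(3), of t] t0 by simp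
        show "v0 ` ?D \<subseteq> \<H>" using lift(2) by blast
      qed (use hv0 dv0[OF t] lift in auto)
      also have "schwarzian v0 t = schwarzian (\<lambda>t. (a' * v0 t + b') / (c' * v0 t + d')) t"
        using schwarzian_moebius[OF open_slit_ball hv0 t dv0[OF t] det vN(1)] by simp
      also have "\<dots> = schwarzian v t"
        using vN(2) by (intro schwarzian_cong[OF open_slit_ball t]) auto
      finally show "snd L (R.g t) * (deriv R.g t)\<^sup>2 = schwarzian R.g t - schwarzian v t" .
    qed
  qed
  moreover have "\<forall>\<^sub>F r in at_right 0. v holomorphic_on (ball 0 r - \<real>\<^sub>\<le>\<^sub>0) \<and> V holomorphic_on ball 0 r"
    using smallv small_holomorphic[OF V(1)] by eventually_elim auto
  ultimately show ?thesis using dc H by (intro exI[of _ v] exI[of _ V] exI[of _ H]) (simp add: v_def)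
qed

end

section \<open>Exponents and singularities of L and of its pullback\<close>

context orbifold
begin

text \<open>For e = 1 and j = -1 the value F 0 is 1/4. The comparison with F holds at first on a
  slit disc only, because v contains Ln; both sides are single valued, so analytic continuation
  carries it to the punctured disc.\<close>

lemma cusp_potential:
  assumes y: "y \<in> Y" "b y = \<infinity>"
  shows "extends_to (local_potential y) (1 / 4)"
proof -
  interpret R: ramified_coordinate y 1 "\<lambda>_. 1"
    by unfold_locales auto
  obtain v V H where dc: "developed_coordinate 1 (\<lambda>_. 1) v V (- 1)" and
    hol: "\<forall>\<^sub>F r in at_right 0. v holomorphic_on (ball 0 r - \<real>\<^sub>\<le>\<^sub>0) \<and> V holomorphic_on ball 0 r" and
    ev: "\<forall>\<^sub>F t in at 0 within - \<real>\<^sub>\<le>\<^sub>0. snd L (R.g t) * (deriv R.g t)\<^sup>2 = schwarzian R.g t - schwarzian v t"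
    using cusp_development[OF y R.ramified_coordinate_axioms] by blast
  interpret D: developed_coordinate y 1 "\<lambda>_. 1" v V "- 1" by (rule dc)
  have g: "R.g = param y" by (rule ext) (unfold R.g_def R.T_def, simp)
  obtain r where r: "r > 0" "local_potential y holomorphic_on ball 0 r - {0}" "R.good r"
     "v holomorphic_on (ball 0 r - \<real>\<^sub>\<le>\<^sub>0) \<and> V holomorphic_on ball 0 r" "\<forall>t\<in>ball 0 r. V t \<noteq> 0"
     "v holomorphic_on (ball 0 r - \<real>\<^sub>\<le>\<^sub>0) \<and> (\<forall>t\<in>ball 0 r - \<real>\<^sub>\<le>\<^sub>0. deriv v t = t powi (- 1) * V t)"
     "\<forall>t\<in>ball 0 r - \<real>\<^sub>\<le>\<^sub>0. snd L (R.g t) * (deriv R.g t)\<^sup>2 = schwarzian R.g t - schwarzian v t"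
     "D.F holomorphic_on ball 0 r"
    using eventually_conj[OF small_local_potential[of y] eventually_conj[OF R.small_good eventually_conj[OF hol
      eventually_conj[OF small_nhds[OF eventually_nhds_nonzero[OF D.V]] eventually_conj[OF D.v
      eventually_conj[OF small_slit[OF ev] small_holomorphic[OF D.F_analytic]]]]]]]
    by (rule small_radius) (elim conjE, rule, assumption+, rule conjI, assumption+, rule conjI, assumption+)
  let ?D = "ball 0 r - \<real>\<^sub>\<le>\<^sub>0 :: complex set"
  have sub: "?D \<subseteq> ball 0 r - {0}" by auto
  have slit: "local_potential y t = D.F t" if t: "t \<in> ?D" for t
  proof -
    have "local_potential y t = t\<^sup>2 * (schwarzian R.g t - schwarzian v t)"
      using bspec[OF r(7) t] unfolding local_potential_def g by simp
    also have "\<dots> = D.F t"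
    proof (rule D.F_eq[OF r(3) open_slit_ball sub t])
      show "v holomorphic_on ?D" using r(4) by blast
      show "V holomorphic_on ?D" using r(4) by (auto intro: holomorphic_on_subset)
      show "V s \<noteq> 0 \<and> deriv v s = s powi (- 1) * V s" if "s \<in> ?D" for s using r(5,6) that by auto
    qed
    finally show ?thesis .
  qed
  have "local_potential y t = D.F t" if t: "t \<in> ball 0 r - {0}" for t
  proof (rule analytic_continuation_open[of ?D "ball 0 r - {0}" "local_potential y" D.F])
    show "open ?D" by (rule open_slit_ball)
    have "of_real (r / 2) \<in> ?D" using r(1) by (auto simp: complex_nonpos_Reals_iff)
    then show "?D \<noteq> {}" by blast
    show "connected (ball 0 r - {0 :: complex})" by (intro connected_open_delete) auto
    show "D.F holomorphic_on ball 0 r - {0}" using r(8) by (rule holomorphic_on_subset) auto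
  qed (use sub r(2) slit t in auto)
  then have "\<forall>\<^sub>F t in at 0. local_potential y t = D.F t"
    by (intro eventually_at_ball[OF r(1)]) auto
  moreover have "D.F 0 = 1 / 4" using D.F_0 by simp
  ultimately show ?thesis using D.F_analytic by (intro extends_toI)
qed

text \<open>The exponent difference of \<open>L\<close> at \<open>y\<close>.\<close>

definition \<delta> :: "sphere \<Rightarrow> complex" where
  "\<delta> y = (case weight y of enat n \<Rightarrow> 1 / of_nat n | \<infinity> \<Rightarrow> 0)"

lemma \<delta>_finite: "weight y = enat n \<Longrightarrow> \<delta> y = 1 / of_nat n"
  by (simp add: \<delta>_def)

lemma \<delta>_infinite: "y \<in> Y \<Longrightarrow> b y = \<infinity> \<Longrightarrow> \<delta> y = 0"
  by (simp add: \<delta>_def orbifold_weight_def)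

lemma local_potential: "extends_to (local_potential y) ((1 - (\<delta> y)\<^sup>2) / 4)"
proof (cases "weight y")
  case (enat n)
  then show ?thesis using finite_point_potential[OF enat] by (simp add: \<delta>_finite power_divide)
next
  case infinity
  then have "y \<in> Y" "b y = \<infinity>" by (auto simp: orbifold_weight_def one_enat_def split: if_splits)
  then show ?thesis using cusp_potential[of y] by (simp add: \<delta>_infinite)
qed

text \<open>e^2 (1 - \<delta>^2)/4 is rewritten with k^2 = e^2 into the shape in which the exponents
  are (k + e \<delta>)/2 and (k - e \<delta>)/2.\<close>

lemma pulled_regular:
  assumes U: "ramified_coordinate e U"
    and E: "pulled_near0 (local_eqn M x) (ramified_coordinate.g y e U) (snd L)"
  shows "regular_local_data M x (1 - of_int (orient y * int e))
    (((of_int (orient y * int e))\<^sup>2 - (of_nat e * \<delta> y)\<^sup>2) / 4)"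
proof -
  interpret R: ramified_coordinate y e U by (rule U)
  have k: "R.k = orient y * int e" by (rule R.k_def)
  have "extends_to (\<lambda>t. t\<^sup>2 * snd (local_eqn M x) t) ((of_nat e)\<^sup>2 * ((1 - (\<delta> y)\<^sup>2) / 4))"
    using R.extends_to_q[OF E] local_potential[of y] unfolding local_potential_def[abs_def] by blast
  moreover have "(of_nat e)\<^sup>2 * ((1 - (\<delta> y)\<^sup>2) / 4) = ((of_int (orient y * int e))\<^sup>2 - (of_nat e * \<delta> y)\<^sup>2) / (4 :: complex)"
  proof -
    have "(of_int R.k :: complex)\<^sup>2 = of_int ((int e)\<^sup>2)" using R.k_sq by (metis of_int_power)
    then have "(of_int (orient y * int e) :: complex)\<^sup>2 = (of_nat e)\<^sup>2" unfolding k by simp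
    then show ?thesis by (simp only:) (simp add: power_mult_distrib right_diff_distrib)
  qed
  ultimately show ?thesis
    using R.extends_to_p[OF E] unfolding k by unfold_locales simp_all
qed

lemma regular_L: "regular_local_data L y (1 - of_int (orient y)) ((1 - (\<delta> y)\<^sup>2) / 4)"
proof -
  interpret R: ramified_coordinate y 1 "\<lambda>_. 1" by unfold_locales auto
  have g: "R.g = param y" by (rule ext) (unfold R.g_def R.T_def, simp)
  have "(of_int (orient y) :: complex)\<^sup>2 = 1" by (auto simp: orient_def split: sphere.splits)
  then show ?thesis
    using pulled_regular[OF R.ramified_coordinate_axioms, of L y y, unfolded g, OF pulled_near0_local_eqn[OF fst_L]]
    by simp
qed

text \<open>At infinity t p tends to 2, whatever the weight. At a finite point of \<open>Y\<close>
  the number \<delta> is 0 or 1/n with n \<ge> 2, so the double pole persists.\<close>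

lemma regular_singular_L:
  assumes "y \<in> Y \<or> y = Infty"
  shows "regular_singular_point L y"
proof -
  interpret D: regular_local_data L y "1 - of_int (orient y)" "(1 - (\<delta> y)\<^sup>2) / 4" by (rule regular_L)
  show ?thesis
  proof (rule D.singular_if_nonzero)
    show "1 - of_int (orient y) \<noteq> (0::complex) \<or> (1 - (\<delta> y)\<^sup>2) / 4 \<noteq> 0"
    proof (cases "y = Infty")
      case True
      then show ?thesis by (simp add: orient_def)
    next
      case False
      then have y: "y \<in> Y" using assms by blast
      show ?thesis
      proof (cases "b y")
        case (enat n)
        then have n: "n \<ge> 2" using b_ge[OF y] by (simp add: numeral_eq_enat)
        have d: "\<delta> y = 1 / of_nat n" using enat y by (simp add: \<delta>_def orbifold_weight_def)
        have "(of_nat n :: complex)\<^sup>2 \<noteq> 1"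
        proof
          assume "(of_nat n :: complex)\<^sup>2 = 1"
          then have "(of_nat (n\<^sup>2) :: complex) = of_nat 1" by simp
          then have "n\<^sup>2 = 1" by (simp only: of_nat_eq_iff)
          then show False using n by (simp add: power2_eq_square)
        qed
        then show ?thesis using n by (simp add: d power_divide)
      next
        case infinity
        then show ?thesis using y by (simp add: \<delta>_infinite)
      qed
    qed
  qed
qed

text \<open>For e = 1 over a finite point k is 1, so g' is the unit G and neither coefficient
  acquires a pole.\<close>

lemma unramified_nonsingular:
  assumes U: "ramified_coordinate 1 U" and y: "y = Fin a"
    and E: "pulled_near0 (local_eqn M x) (ramified_coordinate.g y 1 U) (snd L)"
    and ns: "\<not> singular_point L y"
  shows "\<not> singular_point M x"
proof -
  interpret R: ramified_coordinate y 1 U by (rule U)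
  have k: "R.k = 1" unfolding R.k_def by (simp add: y orient_def)
  obtain h where h: "h analytic_on {0}" "\<forall>\<^sub>F t in at 0. snd (local_eqn L y) t = h t"
    using ns unfolding singular_point_def extends_analytically_def by blast
  have dp: "deriv (param (Fin a)) t = 1" for t
  proof -
    have "param (Fin a) = (\<lambda>t. a + t)" by auto
    then show ?thesis by (auto intro!: DERIV_imp_deriv derivative_eq_intros)
  qed
  have "snd (local_eqn L y) t = snd L (param y t)" for t
    by (simp add: local_eqn_def pullback_def y dp del: param.simps)
  then have "\<forall>\<^sub>F t in at 0. snd L (param y t) = h t" using h(2) by simp
  then have hT: "\<forall>\<^sub>F t in at 0. snd L (param y (R.T t)) = h (R.T t)"
    using R.T_filterlim by (rule eventually_compose_filterlim)
  obtain r where r: "r > 0" "R.good r" "\<forall>t\<in>ball 0 r - {0}. fst (local_eqn M x) t = - (deriv (deriv R.g) t / deriv R.g t)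
      \<and> snd (local_eqn M x) t = snd L (R.g t) * (deriv R.g t)\<^sup>2" "\<forall>t\<in>ball 0 r - {0}. snd L (param y (R.T t)) = h (R.T t)"
    using eventually_conj[OF R.small_good eventually_conj[OF small_at[OF E[unfolded pulled_near0_def]] small_at[OF hT]]]
    by (rule small_radius) blast
  have p: "fst (local_eqn M x) t = - (deriv R.G t / R.G t)" if t: "t \<in> ball 0 r - {0}" for t
  proof -
    have "deriv (deriv R.g) t / deriv R.g t = of_int (R.k - 1) / t + deriv R.G t / R.G t"
      using t r R.G_holomorphic[OF r(2)] R.g_holomorphic[OF r(2)] R.G_nonzero[OF r(2)] R.deriv_g[OF r(2)]
      by (intro schwarzian_power_form(1)[of "ball 0 r - {0}" _ _ R.G])
         (auto elim: holomorphic_on_subset)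
    then show ?thesis using bspec[OF r(3) t] unfolding k by simp
  qed
  have q: "snd (local_eqn M x) t = h (R.T t) * (R.G t)\<^sup>2" if t: "t \<in> ball 0 r - {0}" for t
  proof -
    have "deriv R.g t = R.G t" using R.deriv_g[OF r(2) t] unfolding k by simp
    moreover have "snd L (R.g t) = h (R.T t)" using bspec[OF r(4) t] unfolding R.g_def .
    ultimately show ?thesis using bspec[OF r(3) t] by simp
  qed
  have "extends_analytically (fst (local_eqn M x))"
    unfolding extends_analytically_def
  proof (intro exI conjI)
    show "(\<lambda>t. - (deriv R.G t / R.G t)) analytic_on {0}"
      using R.G_analytic R.G_0 by (intro analytic_intros) auto
    show "\<forall>\<^sub>F t in at 0. fst (local_eqn M x) t = - (deriv R.G t / R.G t)"
      by (rule eventually_at_ball[OF r(1)]) (use p in auto)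
  qed
  moreover have "extends_analytically (snd (local_eqn M x))"
    unfolding extends_analytically_def
  proof (intro exI conjI)
    have "(\<lambda>t. h (R.T t)) analytic_on {0}"
      using analytic_on_compose[OF R.T_analytic, of h] h(1) R.T_0 by (simp add: o_def)
    then show "(\<lambda>t. h (R.T t) * (R.G t)\<^sup>2) analytic_on {0}"
      using R.G_analytic by (intro analytic_intros)
    show "\<forall>\<^sub>F t in at 0. snd (local_eqn M x) t = h (R.T t) * (R.G t)\<^sup>2"
      by (rule eventually_at_ball[OF r(1)]) (use q in auto)
  qed
  ultimately show ?thesis by (simp add: singular_point_def)
qed

lemma slit_of_at: "(\<forall>\<^sub>F t in at 0. P t) \<Longrightarrow> \<forall>\<^sub>F t in at (0::complex) within - \<real>\<^sub>\<le>\<^sub>0. P t"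
  using at_le[of "- \<real>\<^sub>\<le>\<^sub>0" UNIV "0::complex"] by (auto elim: filter_leD)

lemma finite_point_log_free:
  assumes w: "weight y = enat n" and U: "ramified_coordinate e U" and dvd: "n dvd e"
    and E: "pulled_near0 (local_eqn M x) (ramified_coordinate.g y e U) (snd L)"
    and f: "local_solution M x f"
  shows "log_free f"
proof -
  obtain v V where v: "developed_coordinate e U v V (int (e div n) - 1)" "v analytic_on {0}"
    "\<forall>\<^sub>F t in at 0. snd L (ramified_coordinate.g y e U t) * (deriv (ramified_coordinate.g y e U) t)\<^sup>2
       = schwarzian (ramified_coordinate.g y e U) t - schwarzian v t"
    using finite_point_development[OF w U dvd] by blast
  interpret D: developed_coordinate y e U v V "int (e div n) - 1" by (rule v(1))
  show ?thesis using D.all_solutions_log_free[OF E slit_of_at[OF v(3)] v(2) f] .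
qed

lemma cusp_solution_with_log:
  assumes y: "y \<in> Y" "b y = \<infinity>" and U: "ramified_coordinate e U"
    and E: "pulled_near0 (local_eqn M x) (ramified_coordinate.g y e U) (snd L)"
  shows "\<exists>f. local_solution M x f \<and> involves_log f"
proof -
  obtain v V H where v: "developed_coordinate e U v V (- 1)" "H analytic_on {0}" "\<forall>t. v t = of_nat e * Ln t + H t"
    "\<forall>\<^sub>F t in at 0 within - \<real>\<^sub>\<le>\<^sub>0. snd L (ramified_coordinate.g y e U t) * (deriv (ramified_coordinate.g y e U) t)\<^sup>2
       = schwarzian (ramified_coordinate.g y e U) t - schwarzian v t"
    using cusp_development[OF y U] by blast
  interpret D: developed_coordinate y e U v V "- 1" by (rule v(1))
  show ?thesis using D.solution_with_log[OF E v(4,2), of "of_nat e"] v(3) D.e by simp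
qed

end

subsection \<open>Rational maps in local coordinates\<close>

lemma rational_local_quotient:
  assumes "coprime A B" "B \<noteq> 0"
  shows "\<exists>P Q. (poly P 0 \<noteq> 0 \<or> poly Q 0 \<noteq> 0) \<and>
    (\<forall>t. rat_map A B (chart z t) = (if poly Q t = 0 then Infty else Fin (poly P t / poly Q t)))"
proof (cases z)
  case (Fin a)
  have "poly A a \<noteq> 0 \<or> poly B a \<noteq> 0"
    using assms(1) coprime_poly_0 by blast
  then show ?thesis
    using Fin by (intro exI[of _ "pcompose A [:a, 1:]"] exI[of _ "pcompose B [:a, 1:]"]) (simp add: poly_pcompose)
next
  case Infty
  \<comment> \<open>t^D is the least power that clears the denominators of both A(1/t) and B(1/t).
    At t = 0 only a polynomial of full degree D survives, so P and Q do not both vanish.\<close>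
  define D where "D = max (degree A) (degree B)"
  define P where "P = reflect_poly A * monom 1 (D - degree A)"
  define Q where "Q = reflect_poly B * monom 1 (D - degree B)"
  have P: "poly P t = t ^ D * poly A (1 / t)" and Q: "poly Q t = t ^ D * poly B (1 / t)" if "t \<noteq> 0" for t
    using that by (simp_all add: P_def Q_def D_def poly_reflect_poly_nz poly_monom inverse_eq_divide algebra_simps flip: power_add)
  have P0: "poly P 0 = (if D = degree A then lead_coeff A else 0)" and Q0: "poly Q 0 = (if D = degree B then lead_coeff B else 0)"
    by (auto simp: P_def Q_def D_def poly_monom zero_power)
  show ?thesis
  proof (rule exI[of _ P], rule exI[of _ Q], intro conjI allI)
    have "A \<noteq> 0" if "degree B < degree A" using that by auto
    then show "poly P 0 \<noteq> 0 \<or> poly Q 0 \<noteq> 0"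
      using assms(2) by (auto simp: P0 Q0 D_def max_def)
    fix t
    show "rat_map A B (chart z t) = (if poly Q t = 0 then Infty else Fin (poly P t / poly Q t))"
    proof (cases "t = 0")
      case False
      then show ?thesis using Infty by (simp add: P Q)
    next
      case True
      show ?thesis
      proof (cases "degree B < degree A")
        case True
        then have "poly Q 0 = 0" by (simp add: Q0 D_def)
        then show ?thesis using True Infty \<open>t = 0\<close> by simp
      next
        case False
        then have "poly Q 0 = lead_coeff B" "poly P 0 = coeff A (degree B)"
          by (auto simp: Q0 P0 D_def max_def coeff_eq_0)
        then show ?thesis using False Infty \<open>t = 0\<close> assms(2) by simp
      qed
    qed
  qed
qed

text \<open>An infinite fibre over a finite c makes A - c B the zero polynomial, and then B is a
  unit by coprimality. Over infinity the fibre consists of the zeros of B.\<close>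

lemma rat_map_constant:
  assumes "coprime A B" "B \<noteq> 0" and inf: "infinite {w. rat_map A B (Fin w) = y}"
  shows "rat_map A B constant_on UNIV"
proof (cases y)
  case Infty
  have "{w. rat_map A B (Fin w) = y} \<subseteq> {w. poly B w = 0}"
    using Infty by (auto split: if_splits)
  then show ?thesis using inf poly_roots_finite[OF assms(2)] finite_subset by blast
next
  case (Fin c)
  have "{w. rat_map A B (Fin w) = y} \<subseteq> {w. poly (A - smult c B) w = 0}"
    using Fin by (auto split: if_splits simp: field_simps)
  then have "A - smult c B = 0" using inf poly_roots_finite finite_subset by blast
  then have A: "A = smult c B" by simp
  then have "B dvd A" by (simp add: dvd_smult)
  then have "is_unit B" using assms(1) by (meson coprime_common_divisor dvd_refl)
  then have "degree B = 0" using is_unit_iff_degree[OF assms(2)] by blast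
  then obtain k where k': "B = [:k:]" by (rule degree_eq_zeroE)
  with assms(2) have k: "B = [:k:]" "k \<noteq> 0" by auto
  have "rat_map A B x = Fin c" for x
    using k A by (cases x) simp_all
  then show ?thesis by (simp add: constant_on_def)
qed

text \<open>In centred coordinates R is a quotient of polynomials vanishing at 0. It does not vanish
  identically, as a nonconstant R has only finite fibres, so it is t^n times a unit, and
  \<open>zorder\<close> identifies n with the ramification index.\<close>

lemma rational_map_local_power:
  assumes "rational_map R" "\<not> R constant_on UNIV"
  shows "\<exists>U. ramified_coordinate (ramification_index R z) U \<and>
    (\<forall>\<^sub>F t in at 0. R (chart z t) = chart (R z) (t ^ ramification_index R z * U t))"
proof -
  obtain A B where AB: "coprime A B" "B \<noteq> 0" and R: "R = rat_map A B"
    using assms(1) unfolding rational_map_def by blast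
  obtain P Q where PQ0: "poly P 0 \<noteq> 0 \<or> poly Q 0 \<noteq> 0" and
    PQ: "\<And>t. R (chart z t) = (if poly Q t = 0 then Infty else Fin (poly P t / poly Q t))"
    using rational_local_quotient[OF AB, of z] R by blast
  have Rz: "R z = (if poly Q 0 = 0 then Infty else Fin (poly P 0 / poly Q 0))"
    using PQ[of 0] by simp
  have pan: "poly p analytic_on {0}" for p :: "complex poly"
  proof -
    have "poly p holomorphic_on UNIV"
      unfolding holomorphic_on_def field_differentiable_def using poly_DERIV by blast
    then show ?thesis using analytic_on_open[OF open_UNIV] analytic_on_subset by blast
  qed
  have "\<exists>T. T analytic_on {0} \<and> T 0 = 0 \<and> (\<forall>\<^sub>F t in nhds 0. R (chart z t) = chart (R z) (T t) \<and> coord (R z) (R (chart z t)) = T t)"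
  proof (cases "poly Q 0 = 0")
    case True
    then have "poly P 0 \<noteq> 0" using PQ0 by blast
    then have "\<forall>\<^sub>F t in nhds 0. poly P t \<noteq> 0" using pan by (intro eventually_nhds_nonzero)
    then have "\<forall>\<^sub>F t in nhds 0. R (chart z t) = chart (R z) (poly Q t / poly P t) \<and> coord (R z) (R (chart z t)) = poly Q t / poly P t"
      by (rule eventually_mono) (simp add: PQ Rz True)
    then show ?thesis
      using True \<open>poly P 0 \<noteq> 0\<close> by (intro exI[of _ "\<lambda>t. poly Q t / poly P t"]) (auto intro!: analytic_intros pan)
  next
    case False
    then have "\<forall>\<^sub>F t in nhds 0. poly Q t \<noteq> 0" using pan by (intro eventually_nhds_nonzero)
    then have "\<forall>\<^sub>F t in nhds 0. R (chart z t) = chart (R z) (poly P t / poly Q t - poly P 0 / poly Q 0) \<and>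
        coord (R z) (R (chart z t)) = poly P t / poly Q t - poly P 0 / poly Q 0"
      by (rule eventually_mono) (simp add: PQ Rz False)
    then show ?thesis
      using False by (intro exI[of _ "\<lambda>t. poly P t / poly Q t - poly P 0 / poly Q 0"]) (auto intro!: analytic_intros pan)
  qed
  then obtain T where T: "T analytic_on {0}" "T 0 = 0"
    "\<forall>\<^sub>F t in nhds 0. R (chart z t) = chart (R z) (T t) \<and> coord (R z) (R (chart z t)) = T t"
    by blast
  obtain r where r: "r > 0" "T holomorphic_on ball 0 r"
    "\<forall>t\<in>ball 0 r. R (chart z t) = chart (R z) (T t) \<and> coord (R z) (R (chart z t)) = T t"
    using eventually_conj[OF small_holomorphic[OF T(1)] small_nhds[OF T(3)]] by (rule small_radius) blast
  have nconst: "\<not> T constant_on ball 0 r"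
  proof
    assume "T constant_on ball 0 r"
    then have T0: "T t = 0" if "t \<in> ball 0 r" for t
      using that T(2) r(1) unfolding constant_on_def by (metis centre_in_ball)
    have "param z ` (ball 0 r - {0}) \<subseteq> {w. rat_map A B (Fin w) = R z}"
    proof (rule image_subsetI)
      fix t :: complex assume t: "t \<in> ball 0 r - {0}"
      have "R (Fin (param z t)) = R (chart z t)" using chart_nonzero[of t z] t by simp
      also have "\<dots> = R z" using r(3) t T0[of t] by simp
      finally show "param z t \<in> {w. rat_map A B (Fin w) = R z}" by (simp add: R)
    qed
    moreover have "infinite (param z ` (ball 0 r - {0}))"
    proof -
      have "infinite (ball (0::complex) r - {0})"
        using r(1) finite_imp_not_open[of "ball (0::complex) r"] by auto
      then show ?thesis using finite_imageD[OF _ inj_on_param] by blast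
    qed
    ultimately have "infinite {w. rat_map A B (Fin w) = R z}" using finite_subset by blast
    then show False using rat_map_constant[OF AB] assms(2) R by blast
  qed
  have "0 \<in> ball (0::complex) r" using r(1) by simp
  show ?thesis
  proof (rule holomorphic_factor_zero_nonconstant[OF r(2) open_ball connected_ball \<open>0 \<in> ball 0 r\<close> T(2) nconst])
    fix U s n
    assume *: "0 < (n::nat)" "0 < s" "ball 0 s \<subseteq> ball (0::complex) r" "U holomorphic_on ball 0 s"
       "\<And>w. w \<in> ball 0 s \<Longrightarrow> T w = (w - 0) ^ n * U w" "\<And>w. w \<in> ball 0 s \<Longrightarrow> U w \<noteq> 0"
    have "zorder (\<lambda>t. coord (R z) (R (chart z t))) 0 = int n"
    proof (rule zorder_eqI[of "ball 0 s" 0 U])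
      show "coord (R z) (R (chart z w)) = U w * (w - 0) powi int n" if "w \<in> ball 0 s" "w \<noteq> 0" for w
      proof -
        have "coord (R z) (R (chart z w)) = T w" using bspec[OF r(3) subsetD[OF *(3) that(1)]] by blast
        then show ?thesis using *(5)[OF that(1)] by (simp add: mult.commute)
      qed
    qed (use *(2,4,6) in auto)
    then have n: "ramification_index R z = n" by (simp add: ramification_index_def)
    have "U analytic_on {0}"
      using analytic_at_0I[OF *(4,2)] .
    then have "ramified_coordinate n U" using *(1,2,6) by unfold_locales auto
    moreover have "\<forall>\<^sub>F t in at 0. R (chart z t) = chart (R z) (t ^ n * U t)"
    proof (rule eventually_at_ball[OF *(2)])
      fix t :: complex assume "t \<in> ball 0 s - {0}"
      then have t: "t \<in> ball 0 s" by simp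
      show "R (chart z t) = chart (R z) (t ^ n * U t)"
      proof -
        have "R (chart z t) = chart (R z) (T t)" using bspec[OF r(3) subsetD[OF *(3) t]] by blast
        then show ?thesis using *(5)[OF t] by simp
      qed
    qed
    ultimately show ?thesis unfolding n by blast
  qed
qed

section \<open>Types of the singular points of the pullback\<close>

theorem theorem3p22:
  fixes Y :: "sphere set" and b :: "sphere \<Rightarrow> enat" and L :: ode and R :: "sphere \<Rightarrow> sphere"
  assumes "finite Y"
    and "\<And>y. y \<in> Y \<Longrightarrow> 2 \<le> b y"
    and "orbifold_uniformizing_eqn Y b L"
    and "rational_map R"
    and "\<not> R constant_on UNIV"
  shows
    "fuchsian (sphere_pullback R L) \<and>
     (\<forall>z. regular_singular_point (sphere_pullback R L) z \<longrightarrow>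
        extra_ramification_point Y L R z \<or> regular_singular_point L (R z)) \<and>
     (\<forall>z. extra_ramification_point Y L R z \<longrightarrow>
        apparent_singularity (sphere_pullback R L) z) \<and>
     (\<forall>z. R z \<in> Y \<and> b (R z) = \<infinity> \<longrightarrow>
        orbifold_logarithmic_singularity (sphere_pullback R L) z) \<and>
     (\<forall>z n. R z \<in> Y \<and> b (R z) = enat n \<and> regular_singular_point (sphere_pullback R L) z \<longrightarrow>
        (integral_exponent_difference (sphere_pullback R L) z \<longleftrightarrow> n dvd ramification_index R z) \<and>
        (integral_exponent_difference (sphere_pullback R L) z \<longrightarrow>
           apparent_singularity (sphere_pullback R L) z) \<and>
        (\<not> integral_exponent_difference (sphere_pullback R L) z \<longrightarrow>
           generic_singularity (sphere_pullback R L) z))"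
proof -
  obtain \<pi> where \<pi>: "orbifold_uniformization Y b \<pi>" "fst L = (\<lambda>x. 0)"
    "\<forall>D w. developing_branch \<pi> D w \<longrightarrow> (\<forall>x\<in>D. snd L x = - schwarzian w x)"
    using assms(3) unfolding orbifold_uniformizing_eqn_def by blast
  interpret orbifold Y b L \<pi>
    using assms(1,2) \<pi> by unfold_locales auto
  let ?M = "sphere_pullback R L" and ?e = "ramification_index R"
  have data: "\<exists>U. ramified_coordinate (?e z) U \<and> pulled_near0 (local_eqn ?M z) (ramified_coordinate.g (R z) (?e z) U) (snd L)" for z
  proof -
    obtain U where U: "ramified_coordinate (?e z) U" "\<forall>\<^sub>F t in at 0. R (chart z t) = chart (R z) (t ^ ?e z * U t)"
      using rational_map_local_power[OF assms(4,5)] by blast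
    interpret C: ramified_coordinate "R z" "?e z" U by (rule U(1))
    have "\<forall>\<^sub>F t in at 0. R (chart z t) = chart (R z) (C.T t)"
      using U(2) by (simp add: C.T_def)
    then have "pulled_near0 (local_eqn ?M z) (\<lambda>t. param (R z) (C.T t)) (snd L)"
      by (rule pulled_near0_sphere_pullback[OF \<pi>(2) _ C.T_analytic C.T_eventually])
    then have "pulled_near0 (local_eqn ?M z) C.g (snd L)"
      unfolding C.g_def[abs_def] .
    then show ?thesis using U(1) by blast
  qed
  have e_pos: "?e z > 0" for z
    using data[of z] ramified_coordinate.e by blast
  have reg: "regular_local_data ?M z (1 - of_int (orient (R z) * int (?e z)))
    (((of_int (orient (R z) * int (?e z)))\<^sup>2 - (of_nat (?e z) * \<delta> (R z))\<^sup>2) / 4)" for z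
    using data[of z] pulled_regular by blast
  have ediff: "exponent_difference ?M z d \<longleftrightarrow> d = of_nat (?e z) * \<delta> (R z) \<or> d = - (of_nat (?e z) * \<delta> (R z))" for z d
    using regular_local_data.exponent_difference_iff[OF reg refl refl] .
  \<comment> \<open>Every point of \<open>Y\<close> is a regular singular point of L, so either
    alternative in the definition puts \<open>R z\<close> outside \<open>Y\<close>.\<close>
  have nY: "R z \<notin> Y" if "extra_ramification_point Y L R z" for z
    using that regular_singular_L by (auto simp: extra_ramification_point_def)
  show ?thesis
  proof (intro conjI allI impI)
    show "fuchsian ?M"
      unfolding fuchsian_def using regular_local_data.singular_imp_regular[OF reg] by blast
  next
    fix z assume z: "regular_singular_point ?M z"
    show "extra_ramification_point Y L R z \<or> regular_singular_point L (R z)"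
    proof (rule ccontr)
      assume "\<not> ?thesis"
      then have n: "\<not> ramification_point R z" "\<not> regular_singular_point L (R z)"
        by (auto simp: extra_ramification_point_def)
      have e1: "?e z = 1" using n(1) e_pos[of z] by (simp add: ramification_point_def)
      \<comment> \<open>Infinity is always a regular singular point of L, so \<open>R z\<close> is
        finite.\<close>
      obtain a where a: "R z = Fin a" using n(2) regular_singular_L[of "R z"] by (cases "R z") auto
      have ns: "\<not> singular_point L (R z)"
        using n(2) regular_local_data.singular_imp_regular[OF regular_L] by blast
      obtain U where U: "ramified_coordinate (?e z) U" "pulled_near0 (local_eqn ?M z) (ramified_coordinate.g (R z) (?e z) U) (snd L)"
        using data by blast
      have "\<not> singular_point ?M z"
        using unramified_nonsingular[OF U(1)[unfolded e1] a U(2)[unfolded e1] ns] .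
      then show False using z by (simp add: regular_singular_point_def)
    qed
  next
    fix z assume z: "extra_ramification_point Y L R z"
    have w: "weight (R z) = enat 1" using weight_1[OF nY[OF z]] .
    have e: "?e z > 1" using z by (simp add: extra_ramification_point_def ramification_point_def)
    have "regular_singular_point ?M z"
    proof (rule regular_local_data.singular_if_nonzero[OF reg], rule disjI1)
      \<comment> \<open>The limit of t p is 1 - k, where k is e or -e and e > 1.\<close>
      have "orient (R z) * int (?e z) \<noteq> 1" using e by (auto simp: orient_def split: sphere.splits)
      then show "1 - of_int (orient (R z) * int (?e z)) \<noteq> (0::complex)"
        by (metis eq_iff_diff_eq_0 of_int_1 of_int_eq_iff)
    qed
    \<comment> \<open>Extra ramification points are the case n = 1 of orbifold points: \<delta> = 1
      makes the difference e, and 1 divides every index, so no logarithm occurs.\<close>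
    moreover have "exponent_difference ?M z (of_nat (?e z))"
      unfolding ediff by (simp add: \<delta>_finite[OF w])
    moreover have "log_free f" if f: "local_solution ?M z f" for f
    proof -
      obtain U where "ramified_coordinate (?e z) U" "pulled_near0 (local_eqn ?M z) (ramified_coordinate.g (R z) (?e z) U) (snd L)"
        using data by blast
      then show ?thesis using finite_point_log_free[OF w _ _ _ f] by simp
    qed
    ultimately show "apparent_singularity ?M z"
      unfolding apparent_singularity_def using e_pos[of z] by blast
  next
    fix z assume z: "R z \<in> Y \<and> b (R z) = \<infinity>"
    have \<delta>0: "\<delta> (R z) = 0" using z \<delta>_infinite by blast
    have "regular_singular_point ?M z"
    proof (rule regular_local_data.singular_if_nonzero[OF reg], rule disjI2)
      \<comment> \<open>With \<delta> = 0 the double pole coefficient is k^2/4, which is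
        e^2/4.\<close>
      show "((of_int (orient (R z) * int (?e z)))\<^sup>2 - (of_nat (?e z) * \<delta> (R z))\<^sup>2) / 4 \<noteq> (0::complex)"
        using e_pos[of z] by (simp add: \<delta>0)
    qed
    moreover have "exponent_difference ?M z 0" unfolding ediff by (simp add: \<delta>0)
    moreover have "\<exists>f. local_solution ?M z f \<and> involves_log f"
      using data[of z] cusp_solution_with_log z by blast
    ultimately show "orbifold_logarithmic_singularity ?M z"
      by (simp add: orbifold_logarithmic_singularity_def logarithmic_singularity_def)
  next
    fix z n assume z: "R z \<in> Y \<and> b (R z) = enat n \<and> regular_singular_point ?M z"
    have w: "weight (R z) = enat n" using z by (simp add: orbifold_weight_def)
    have n: "n > 0" using weight_pos[OF w] .
    have ed: "of_nat (?e z) * \<delta> (R z) = of_nat (?e z) / of_nat n" by (simp add: \<delta>_finite[OF w])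
    show int: "integral_exponent_difference ?M z \<longleftrightarrow> n dvd ?e z"
    proof
      assume "integral_exponent_difference ?M z"
      then obtain d :: complex where d: "d \<in> \<int>" "exponent_difference ?M z d"
        unfolding integral_exponent_difference_def by (rule bexE)
      from d(2) have "of_nat (?e z) / of_nat n = d \<or> of_nat (?e z) / of_nat n = - d"
        unfolding ediff ed by auto
      with d(1) have "of_nat (?e z) / of_nat n \<in> (\<int> :: complex set)"
        using Ints_minus by metis
      then obtain i :: int where "of_nat (?e z) / of_nat n = (of_int i :: complex)" by (elim Ints_cases)
      then have "of_nat (?e z) = (of_int i * of_nat n :: complex)" using n by (simp add: field_simps)
      then have "of_int (int (?e z)) = (of_int (i * int n) :: complex)" by simp
      then have "int (?e z) = i * int n" by (simp only: of_int_eq_iff)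
      then show "n dvd ?e z" by (metis dvd_triv_right int_dvd_int_iff)
    next
      assume "n dvd ?e z"
      then obtain i where "?e z = n * i" by blast
      then have "of_nat (?e z) / of_nat n = (of_nat i :: complex)" using n by simp
      then show "integral_exponent_difference ?M z"
        unfolding integral_exponent_difference_def ediff ed by (intro bexI[of _ "of_nat i"]) auto
    qed
    show "apparent_singularity ?M z" if "integral_exponent_difference ?M z"
    proof -
      have dvd: "n dvd ?e z" using that int by blast
      then obtain i where i: "?e z = n * i" by blast
      have "of_nat (?e z) / of_nat n = (of_nat i :: complex)" using i n by simp
      then have "exponent_difference ?M z (of_nat i)" unfolding ediff ed by simp
      moreover have "i > 0" using e_pos[of z] i by (cases i) auto
      moreover have "log_free f" if f: "local_solution ?M z f" for f
        using data[of z] finite_point_log_free[OF w _ dvd _ f] by blast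
      ultimately show ?thesis unfolding apparent_singularity_def using z by blast
    qed
    show "generic_singularity ?M z" if "\<not> integral_exponent_difference ?M z"
      using that z by (simp add: generic_singularity_def)
  qed
qed

end
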